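(* Let $n\geq 2$ be an integer, $0<\alpha\leq 2$, $n>\alpha$, $c_1,c_2\geq 0$ with $c_1+c_2>0$, $0<q_1\leq\frac{2\alpha}{n-\alpha}$, $0<q_2\leq\frac{n+\alpha}{n-\alpha}$, and let $u$ be a positive classical solution of $$(-\Delta)^{\frac{\alpha}{2}}u(y)=c_1\Big(\int_{\mathbb{R}^n}\frac{u^{\frac{n+\alpha}{n-\alpha}}(z)}{|y-z|^{n-\alpha}}\,dz\Big)u^{q_1}(y)+c_2u^{q_2}(y),\qquad y\in\mathbb{R}^n.$$ Fix an arbitrary $x\in\mathbb{R}^n$. For $\lambda>0$, let $\Omega$ be a narrow region in $B_\lambda(x)\setminus\{x\}$ with small thickness $0<l<\lambda$, in the sense that $\Omega\subseteq A_{\lambda,l}(x):=\{y\in\mathbb{R}^n\mid \lambda-l<|y-x|<\lambda\}$. Suppose that $\omega_{x,\lambda}\in\mathcal{L}_\alpha(\mathbb{R}^n)\cap C^{1,1}_{loc}(\Omega)$ if $0<\alpha<2$ (respectively $\omega_{x,\lambda}\in C^2(\Omega)$ if $\alpha=2$) and that: (a) for all $y\in\Omega\cap B_\lambda^-$, $$(-\Delta)^{\frac{\alpha}{2}}\omega_{x,\lambda}(y)-\widetilde{\mathcal{L}}_{x,\lambda}(y)\,\omega_{x,\lambda}(y)-c_1\frac{n+\alpha}{n-\alpha}\Big(\int_{B_\lambda^-}\frac{u^{\frac{2\alpha}{n-\alpha}}(z)\omega_{x,\lambda}(z)}{|y-z|^{n-\alpha}}\,dz\Big)u^{q_1}(y)\geq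 0;$$ (b) if $B_\lambda^-\neq\emptyset$, then the negative minimum of $\omega_{x,\lambda}$ is attained in the interior of $B_\lambda(x)\setminus\{x\}$; (c) the negative minimum of $\omega_{x,\lambda}$ cannot be attained in $(B_\lambda(x)\setminus\{x\})\setminus\Omega$. Here $\widetilde{\mathcal{L}}_{x,\lambda}(y):=c_1q_1Q(y)\max\{u^{q_1-1}(y),u_{x,\lambda}^{q_1-1}(y)\}+c_2q_2\max\{u^{q_2-1}(y),u_{x,\lambda}^{q_2-1}(y)\}$. Then: (i) there exists a sufficiently small constant $\delta_0(x)>0$ such that, for all $0<\lambda\leq\delta_0(x)$, $\omega_{x,\lambda}(y)\geq 0$ for every $y\in\Omega$; (ii) there exists a sufficiently small $l_0(x,\lambda)>0$, depending continuously on $\lambda$, such that, for all $0<l\leq l_0(x,\lambda)$, $\omega_{x,\lambda}(y)\geq 0$ for every $y\in\Omega$.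
   Context: A positive classical solution is $u:\mathbb{R}^n\to(0,\infty)$ satisfying the equation pointwise, with $u\in C^{1,1}_{loc}(\mathbb{R}^n)\cap\mathcal{L}_\alpha(\mathbb{R}^n)$ if $0<\alpha<2$, and $u\in C^2(\mathbb{R}^n)$ if $\alpha=2$. Here $\mathcal{L}_\alpha(\mathbb{R}^n):=\{u\mid \int_{\mathbb{R}^n}\frac{|u(y)|}{1+|y|^{n+\alpha}}dy<\infty\}$ (a function space, not to be confused with the coefficient $\widetilde{\mathcal{L}}_{x,\lambda}$). For $0<\alpha<2$, $(-\Delta)^{\frac{\alpha}{2}}w(y)=C_{\alpha,n}\lim_{\epsilon\to0}\int_{|z-y|\geq\epsilon}\frac{w(y)-w(z)}{|y-z|^{n+\alpha}}dz$ with $C_{\alpha,n}=\big(\int_{\mathbb{R}^n}\frac{1-\cos(2\pi\zeta_1)}{|\zeta|^{n+\alpha}}d\zeta\big)^{-1}$; for $\alpha=2$ it is $-\Delta$. Notation: $B_\lambda(x)=\{y\mid |y-x|<\lambda\}$; for $y\in\mathbb{R}^n\setminus\{x\}$, $y^{x,\lambda}=\frac{\lambda^2(y-x)}{|y-x|^2}+x$, $u_{x,\lambda}(y)=\big(\frac{\lambda}{|y-x|}\big)^{n-\alpha}u(y^{x,\lambda})$, $\omega_{x,\lambda}(y)=u_{x,\lambda}(y)-u(y)$; $B_\lambda^-=\{y\in B_\lambda(x)\setminus\{x\}\mid \omega_{x,\lambda}(y)<0\}$; $Q(y)=\int_{\mathbb{R}^n}\frac{u^{\frac{n+\alpha}{n-\alpha}}(z)}{|y-z|^{n-\alpha}}dz$.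 The "negative minimum of $\omega_{x,\lambda}$" means the minimum of $\omega_{x,\lambda}$ over $B_\lambda(x)\setminus\{x\}$ when it is negative. The constants $\delta_0(x)$ and $l_0(x,\lambda)$ may depend on $u$ and on $n,\alpha,c_1,c_2,q_1,q_2$, but not on $\Omega$. *)

theory Defs
  imports "HOL-Analysis.Analysis"
begin

text \<open>The ambient space is \<^typ>\<open>real^'n\<close> with dimension \<open>n = CARD('n)\<close>; the radius is
  called \<open>r\<close>.\<close>

subsection \<open>Function spaces\<close>

definition L_space :: "real \<Rightarrow> (real^'n \<Rightarrow> real) set" where
  "L_space \<alpha> = {w. w \<in> borel_measurable lebesgue \<and>
     integrable lebesgue (\<lambda>y. \<bar>w y\<bar> / (1 + norm y powr (real CARD('n) + \<alpha>)))}"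

definition C11_loc_on :: "(real^'n) set \<Rightarrow> (real^'n \<Rightarrow> real) \<Rightarrow> bool" where
  "C11_loc_on S w \<longleftrightarrow> (\<exists>G :: real^'n \<Rightarrow> real^'n.
     (\<forall>y\<in>S. (w has_derivative (\<lambda>h. G y \<bullet> h)) (at y)) \<and>
     (\<forall>K. compact K \<and> K \<subseteq> S \<longrightarrow> (\<exists>L. L-lipschitz_on K G)))"

definition C2_on :: "(real^'n) set \<Rightarrow> (real^'n \<Rightarrow> real) \<Rightarrow> bool" where
  "C2_on S w \<longleftrightarrow> (\<exists>(G :: real^'n \<Rightarrow> real^'n) (H :: real^'n \<Rightarrow> real^'n^'n).
     (\<forall>y\<in>S. (w has_derivative (\<lambda>h. G y \<bullet> h)) (at y)) \<and>
     (\<forall>y\<in>S. (G has_derivative (\<lambda>h. H y *v h)) (at y)) \<and>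
     continuous_on S H)"

subsection \<open>The operator \<open>(-\<Delta>)\<^sup>\<alpha>\<^sup>/\<^sup>2\<close>\<close>

definition partial_deriv :: "'n \<Rightarrow> (real^'n \<Rightarrow> real) \<Rightarrow> real^'n \<Rightarrow> real" where
  "partial_deriv i w y = deriv (\<lambda>t. w (y + t *\<^sub>R axis i 1)) 0"

definition laplacian :: "(real^'n \<Rightarrow> real) \<Rightarrow> real^'n \<Rightarrow> real" where
  "laplacian w y = (\<Sum>i\<in>UNIV. partial_deriv i (partial_deriv i w) y)"

text \<open>The index type has no distinguished first element; the integral below is the same for every
  coordinate, so an arbitrary fixed index plays the role of the first one.\<close>

definition frac_const :: "'n::finite itself \<Rightarrow> real \<Rightarrow> real" where
  "frac_const _ \<alpha> = inverse (LINT \<zeta>|lebesgue.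
     (1 - cos (2 * pi * (\<zeta> :: real^'n) $ (SOME i. True))) / norm \<zeta> powr (real CARD('n) + \<alpha>))"

text \<open>For \<open>0 < \<alpha> < 2\<close> the principal value limit exists at \<open>y\<close> whenever \<open>w\<close> is in \<^const>\<open>L_space\<close>
  and is \<open>C\<^sup>1\<^sup>,\<^sup>1\<close> near \<open>y\<close>; the operator is only used under such assumptions.\<close>

definition frac_laplacian :: "real \<Rightarrow> (real^'n \<Rightarrow> real) \<Rightarrow> real^'n \<Rightarrow> real" where
  "frac_laplacian \<alpha> w y =
     (if \<alpha> = 2 then - laplacian w y
      else frac_const TYPE('n) \<alpha> *
        Lim (at_right 0) (\<lambda>\<epsilon>. LINT z:{z. norm (z - y) \<ge> \<epsilon>}|lebesgue.
          (w y - w z) / norm (y - z) powr (real CARD('n) + \<alpha>)))"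

subsection \<open>The equation\<close>

definition potential :: "real \<Rightarrow> (real^'n \<Rightarrow> real) \<Rightarrow> real^'n \<Rightarrow> real" where
  "potential \<alpha> u y = (LINT z|lebesgue.
     u z powr ((real CARD('n) + \<alpha>) / (real CARD('n) - \<alpha>))
       / norm (y - z) powr (real CARD('n) - \<alpha>))"

text \<open>If \<open>c1 > 0\<close>, the equation holding pointwise includes that its nonlocal term is finite
  (a non-integrable function would have integral \<open>0\<close> here); if \<open>c1 = 0\<close>, that term is absent.\<close>

definition positive_classical_solution ::
    "real \<Rightarrow> real \<Rightarrow> real \<Rightarrow> real \<Rightarrow> real \<Rightarrow> (real^'n \<Rightarrow> real) \<Rightarrow> bool" where
  "positive_classical_solution \<alpha> c1 c2 q1 q2 u \<longleftrightarrow>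
     (\<forall>y. 0 < u y) \<and>
     (if \<alpha> = 2 then C2_on UNIV u else C11_loc_on UNIV u \<and> u \<in> L_space \<alpha>) \<and>
     (c1 > 0 \<longrightarrow> (\<forall>y. integrable lebesgue (\<lambda>z.
        u z powr ((real CARD('n) + \<alpha>) / (real CARD('n) - \<alpha>))
          / norm (y - z) powr (real CARD('n) - \<alpha>)))) \<and>
     (\<forall>y. frac_laplacian \<alpha> u y
            = c1 * potential \<alpha> u y * u y powr q1 + c2 * u y powr q2)"

subsection \<open>Kelvin transform\<close>

definition inversion :: "real^'n \<Rightarrow> real \<Rightarrow> real^'n \<Rightarrow> real^'n" where
  "inversion x r y = (r\<^sup>2 / (norm (y - x))\<^sup>2) *\<^sub>R (y - x) + x"

definition kelvin :: "real \<Rightarrow> (real^'n \<Rightarrow> real) \<Rightarrow> real^'n \<Rightarrow> real \<Rightarrow> real^'n \<Rightarrow> real" where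
  "kelvin \<alpha> u x r y =
     (r / norm (y - x)) powr (real CARD('n) - \<alpha>) * u (inversion x r y)"

definition omega :: "real \<Rightarrow> (real^'n \<Rightarrow> real) \<Rightarrow> real^'n \<Rightarrow> real \<Rightarrow> real^'n \<Rightarrow> real" where
  "omega \<alpha> u x r y = kelvin \<alpha> u x r y - u y"

definition B_minus :: "real \<Rightarrow> (real^'n \<Rightarrow> real) \<Rightarrow> real^'n \<Rightarrow> real \<Rightarrow> (real^'n) set" where
  "B_minus \<alpha> u x r = {y \<in> ball x r - {x}. omega \<alpha> u x r y < 0}"

definition L_coeff :: "real \<Rightarrow> real \<Rightarrow> real \<Rightarrow> real \<Rightarrow> real \<Rightarrow> (real^'n \<Rightarrow> real) \<Rightarrow>
    real^'n \<Rightarrow> real \<Rightarrow> real^'n \<Rightarrow> real" where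
  "L_coeff \<alpha> c1 c2 q1 q2 u x r y =
     c1 * q1 * potential \<alpha> u y * max (u y powr (q1 - 1)) (kelvin \<alpha> u x r y powr (q1 - 1))
     + c2 * q2 * max (u y powr (q2 - 1)) (kelvin \<alpha> u x r y powr (q2 - 1))"

definition neg_min_at :: "real \<Rightarrow> (real^'n \<Rightarrow> real) \<Rightarrow> real^'n \<Rightarrow> real \<Rightarrow> real^'n \<Rightarrow> bool" where
  "neg_min_at \<alpha> u x r y \<longleftrightarrow> y \<in> ball x r - {x} \<and> omega \<alpha> u x r y < 0 \<and>
     (\<forall>z \<in> ball x r - {x}. omega \<alpha> u x r y \<le> omega \<alpha> u x r z)"

subsection \<open>Hypotheses on the narrow region\<close>

text \<open>A region is an open set.\<close>

definition narrow_region :: "real^'n \<Rightarrow> real \<Rightarrow> real \<Rightarrow> (real^'n) set \<Rightarrow> bool" where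
  "narrow_region x r l \<Omega> \<longleftrightarrow> 0 < l \<and> l < r \<and> open \<Omega> \<and>
     \<Omega> \<subseteq> {y. r - l < norm (y - x) \<and> norm (y - x) < r}"

definition omega_regular ::
    "real \<Rightarrow> (real^'n \<Rightarrow> real) \<Rightarrow> real^'n \<Rightarrow> real \<Rightarrow> (real^'n) set \<Rightarrow> bool" where
  "omega_regular \<alpha> u x r \<Omega> \<longleftrightarrow>
     (if \<alpha> = 2 then C2_on \<Omega> (omega \<alpha> u x r)
      else omega \<alpha> u x r \<in> L_space \<alpha> \<and> C11_loc_on \<Omega> (omega \<alpha> u x r))"

definition omega_inequality :: "real \<Rightarrow> real \<Rightarrow> real \<Rightarrow> real \<Rightarrow> real \<Rightarrow> (real^'n \<Rightarrow> real) \<Rightarrow>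
    real^'n \<Rightarrow> real \<Rightarrow> (real^'n) set \<Rightarrow> bool" where
  "omega_inequality \<alpha> c1 c2 q1 q2 u x r \<Omega> \<longleftrightarrow>
     (\<forall>y \<in> \<Omega> \<inter> B_minus \<alpha> u x r.
        frac_laplacian \<alpha> (omega \<alpha> u x r) y
        - L_coeff \<alpha> c1 c2 q1 q2 u x r y * omega \<alpha> u x r y
        - c1 * ((real CARD('n) + \<alpha>) / (real CARD('n) - \<alpha>))
          * (LINT z:B_minus \<alpha> u x r|lebesgue.
               u z powr (2 * \<alpha> / (real CARD('n) - \<alpha>)) * omega \<alpha> u x r z
                 / norm (y - z) powr (real CARD('n) - \<alpha>))
          * u y powr q1 \<ge> 0)"

definition narrow_region_hyps :: "real \<Rightarrow> real \<Rightarrow> real \<Rightarrow> real \<Rightarrow> real \<Rightarrow> (real^'n \<Rightarrow> real) \<Rightarrow>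
    real^'n \<Rightarrow> real \<Rightarrow> real \<Rightarrow> (real^'n) set \<Rightarrow> bool" where
  "narrow_region_hyps \<alpha> c1 c2 q1 q2 u x r l \<Omega> \<longleftrightarrow>
     narrow_region x r l \<Omega> \<and>
     omega_regular \<alpha> u x r \<Omega> \<and>
     omega_inequality \<alpha> c1 c2 q1 q2 u x r \<Omega> \<and>
     (B_minus \<alpha> u x r \<noteq> {} \<longrightarrow> (\<exists>y \<in> interior (ball x r - {x}). neg_min_at \<alpha> u x r y)) \<and>
     (\<forall>y \<in> (ball x r - {x}) - \<Omega>. \<not> neg_min_at \<alpha> u x r y)"

end

theory Submission
  imports Defs
begin

text \<open>Part (i) rests on the lower bound \<open>u y \<ge> c * norm (y - x) powr (\<alpha> - n)\<close> away from \<open>x\<close>, a maximum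
  principle for the strictly \<open>\<alpha>\<close>-superharmonic function \<open>u\<close>. Since \<open>t powr ((n - \<alpha>) / 2) * u (x + t \<theta>)\<close>
  increases for small \<open>t\<close>, this bound already gives \<open>\<omega> \<ge> 0\<close> on the whole punctured ball for small radii.

  For part (ii) it suffices to exclude, uniformly for radii in a compact interval, negative minima of
  \<open>\<omega>\<close> at distance less than some \<open>\<eta>\<close> from the sphere; half the distance of \<open>(r, 0)\<close> to the set of bad pairs
  \<open>(r, l)\<close> is then a continuous choice of \<open>l0 r\<close>. If \<open>\<alpha> < 2\<close>, reflecting the exterior of the
  ball into its interior shows that the fractional Laplacian at such a minimum is at most
  \<open>- C * l powr (- \<alpha>) * M\<close>, where \<open>- M\<close> is the minimum, while all other terms of the differential inequality are
  \<open>O(M)\<close>. If \<open>\<alpha> = 2\<close>, a pointwise inequality at the minimum carries no such gain. Instead, the equations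
  for \<open>u\<close> and its Kelvin transform give \<open>\<Delta>\<omega> \<le> K * M\<close> wherever \<open>\<omega> < 0\<close> in \<open>r / 2 \<le> norm (y - x) < r\<close>, and
  comparison with the barrier \<open>M * \<kappa> * (r\<^sup>2 - (norm (y - x))\<^sup>2)\<close> bounds the distance of the minimum from
  the sphere from below.\<close>

subsection \<open>Change of variables under inversion\<close>

text \<open>What drives the nonlocal estimates is one antisymmetry: at the point inverse to
  \<open>z\<close> the function \<omega> takes its value at \<open>z\<close> times a negative
  weight. Together with the Jacobian of the inversion this turns an integral over the exterior of
  the ball into one over the interior, and the kernel of the reflected point, with its conformal
  weight, never exceeds the kernel of the point itself. The exponent (n + \<alpha>) / (n - \<alpha>)
  in the potential is the one for which the Jacobian is absorbed without remainder; the bounds on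
  \<open>q1\<close> and \<open>q2\<close> leave surplus powers of r / |y - x|, which is at least 1
  in the ball, on the favourable side. Two obstacles shape part (ii). The threshold must not depend
  on \<Omega> and must vary continuously, so a bound for each single radius is not enough and all
  constants are taken over compact intervals of radii. For \<alpha> = 2, comparison with a barrier
  needs a differential inequality on a full half shell, whereas (a) speaks of \<Omega> only,
  possibly a tiny neighbourhood of the minimum point; this is why the inequality is derived from the
  equation itself.\<close>

text \<open>The change of variables theorem of the library is stated for well-ordered index types only;
  \<open>'a idx\<close> is a well-ordered copy of \<open>'a\<close>, to and from which the coordinates are relabelled.\<close>

typedef 'a idx = "UNIV :: 'a set" by simp

definition idx_code :: "'a::finite \<Rightarrow> nat" where
  "idx_code = (SOME f. inj f)"

lemma inj_idx_code: "inj (idx_code :: 'a::finite \<Rightarrow> nat)"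
proof -
  have "\<exists>f :: 'a \<Rightarrow> nat. inj f"
    using finite_imp_inj_to_nat_seg[of "UNIV :: 'a set"] by auto
  then show ?thesis
    unfolding idx_code_def by (rule someI_ex)
qed

instance idx :: (finite) finite
proof
  have "inj (Rep_idx :: 'a idx \<Rightarrow> 'a)"
    by (simp add: inj_def Rep_idx_inject)
  then show "finite (UNIV :: 'a idx set)"
    by (rule finite_imageD[rotated]) simp
qed

instantiation idx :: (finite) linorder
begin

definition less_eq_idx :: "'a idx \<Rightarrow> 'a idx \<Rightarrow> bool" where
  "less_eq_idx a b \<longleftrightarrow> idx_code (Rep_idx a) \<le> idx_code (Rep_idx b)"

definition less_idx :: "'a idx \<Rightarrow> 'a idx \<Rightarrow> bool" where
  "less_idx a b \<longleftrightarrow> idx_code (Rep_idx a) < idx_code (Rep_idx b)"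

instance
proof
  fix a b :: "'a idx"
  assume "a \<le> b" "b \<le> a"
  then have "Rep_idx a = Rep_idx b"
    using inj_idx_code[where 'a='a] by (auto simp: less_eq_idx_def inj_def)
  then show "a = b"
    by (simp add: Rep_idx_inject)
qed (auto simp: less_eq_idx_def less_idx_def)

end

instance idx :: (finite) wellorder
proof -
  have "wf {(a :: 'a idx, b). a < b}"
    by (rule wf_subset[OF wf_measure[of "\<lambda>a. idx_code (Rep_idx a)"]]) (auto simp: less_idx_def)
  then show "OFCLASS('a idx, wellorder_class)"
    by (rule wf_wellorderI) intro_classes
qed

lemma bij_Rep_idx: "bij (Rep_idx :: 'a idx \<Rightarrow> 'a)"
  by (rule bij_betwI[of _ _ _ Abs_idx]) (auto simp: Rep_idx_inverse Abs_idx_inverse)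

lemma CARD_idx: "CARD('a idx) = CARD('a::finite)"
  by (rule bij_betw_same_card[OF bij_Rep_idx])

definition from_idx :: "real^('n idx) \<Rightarrow> real^'n::finite" where
  "from_idx w = (\<chi> i. w $ Abs_idx i)"

definition to_idx :: "real^'n::finite \<Rightarrow> real^('n idx)" where
  "to_idx w = (\<chi> i. w $ Rep_idx i)"

lemma from_to_idx [simp]: "from_idx (to_idx w) = w"
  by (simp add: from_idx_def to_idx_def Abs_idx_inverse)

lemma bounded_linear_from_idx: "bounded_linear (from_idx :: real^('n idx) \<Rightarrow> real^'n::finite)"
  unfolding from_idx_def
  by (intro linear_conv_bounded_linear[THEN iffD1] linearI) (auto simp: vec_eq_iff)

lemma norm_from_idx [simp]: "norm (from_idx (w :: real^('n::finite idx))) = norm w"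
proof -
  have "(\<Sum>i\<in>UNIV. (w $ Abs_idx i)\<^sup>2) = (\<Sum>j\<in>UNIV. (w $ j)\<^sup>2)"
    by (rule sum.reindex_bij_witness[of _ Rep_idx Abs_idx]) (auto simp: Rep_idx_inverse Abs_idx_inverse)
  then show ?thesis
    by (simp add: norm_vec_def L2_set_def from_idx_def)
qed

lemma from_idx_inversion:
  "from_idx (inversion x r w) = inversion (from_idx x) r (from_idx (w :: real^('n::finite idx)))"
  unfolding inversion_def
  by (simp add: bounded_linear.linear[OF bounded_linear_from_idx] linear_add linear_cmul
      flip: linear_diff[OF bounded_linear.linear[OF bounded_linear_from_idx]])

lemma borel_measurable_from_idx [measurable]:
  "(from_idx :: real^('n::finite idx) \<Rightarrow> real^'n) \<in> borel_measurable borel"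
  by (intro borel_measurable_continuous_onI linear_continuous_on bounded_linear_from_idx)

text \<open>Relabelling coordinates permutes the sides of a box, and the volumes of boxes determine
  Lebesgue measure.\<close>

lemma lborel_from_idx: "(lborel :: (real^'n::finite) measure) = distr lborel borel from_idx"
proof (rule lborel_eqI)
  fix l u :: "real^'n" assume lu: "\<And>b. b \<in> Basis \<Longrightarrow> l \<bullet> b \<le> u \<bullet> b"
  have lu': "l $ i \<le> u $ i" for i
    using lu[of "axis i 1"] by (simp add: inner_axis axis_in_Basis_iff)
  have eq: "from_idx -` box l u = box (to_idx l) (to_idx u)"
    unfolding mem_box_cart set_eq_iff vimage_eq from_idx_def to_idx_def
    by (auto simp: mem_box_cart) (metis Rep_idx_inverse Abs_idx_inverse UNIV_I)+
  have pr: "(\<Prod>b\<in>Basis. (u - l) \<bullet> b) = (\<Prod>i\<in>UNIV. u $ i - l $ i)" for u l :: "real^'m::finite"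
    unfolding Basis_vec_def
    by (simp add: UNION_singleton_eq_range prod.reindex[of "\<lambda>i. axis i 1"] inj_def axis_eq_axis inner_axis)
  have "emeasure (distr lborel borel from_idx) (box l u) = emeasure lborel (box (to_idx l) (to_idx u))"
    by (simp add: emeasure_distr eq)
  also have "\<dots> = (\<Prod>b\<in>Basis. (to_idx u - to_idx l) \<bullet> b)"
    by (rule emeasure_lborel_box)
      (use lu' in \<open>auto simp: Basis_vec_def inner_axis to_idx_def\<close>)
  also have "(\<Prod>b\<in>Basis. (to_idx u - to_idx l) \<bullet> b) = (\<Prod>i\<in>UNIV. u $ i - l $ i)"
    unfolding pr to_idx_def
    by (auto intro!: prod.reindex_bij_witness[of _ Abs_idx Rep_idx] simp: Rep_idx_inverse Abs_idx_inverse)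
  finally show "emeasure (distr lborel borel from_idx) (box l u) = (\<Prod>b\<in>Basis. (u - l) \<bullet> b)"
    by (simp add: pr)
qed simp

section \<open>The inversion, its derivative and its Jacobian\<close>

lemma norm_inversion_diff: "y \<noteq> x \<Longrightarrow> norm (inversion x r y - x) = r\<^sup>2 / norm (y - x)"
  by (simp add: inversion_def power2_eq_square)

lemma inversion_ne: "y \<noteq> x \<Longrightarrow> r \<noteq> 0 \<Longrightarrow> inversion x r y \<noteq> x"
  by (simp add: inversion_def)

lemma inversion_inversion: "y \<noteq> x \<Longrightarrow> r \<noteq> 0 \<Longrightarrow> inversion x r (inversion x r y) = y"
  using norm_inversion_diff[of y x r]
  by (simp add: inversion_def[of x r "inversion x r y"])
    (simp add: inversion_def power2_eq_square)

lemma borel_measurable_inversion [measurable]: "inversion x r \<in> borel_measurable borel"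
  unfolding inversion_def by measurable

text \<open>This is the Householder reflection along \<open>v\<close>. Up to a scalar it is the
  derivative of the inversion, so that orthogonality yields the Jacobian without expanding a
  determinant.\<close>

lemma reflection_orthogonal:
  fixes v :: "'a::euclidean_space"
  assumes "v \<noteq> 0"
  shows "orthogonal_transformation (\<lambda>h. h - (2 * (v \<bullet> h) / (v \<bullet> v)) *\<^sub>R v)"
  unfolding orthogonal_transformation_def
proof (intro conjI allI linearI)
  fix h k :: 'a
  have "v \<bullet> v \<noteq> 0" using assms by simp
  then show "(h - (2 * (v \<bullet> h) / (v \<bullet> v)) *\<^sub>R v) \<bullet> (k - (2 * (v \<bullet> k) / (v \<bullet> v)) *\<^sub>R v) = h \<bullet> k"
    by (simp add: inner_diff inner_commute[of h v] field_simps)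
next
  fix b1 b2 :: 'a
  show "b1 + b2 - (2 * (v \<bullet> (b1 + b2)) / (v \<bullet> v)) *\<^sub>R v =
       b1 - (2 * (v \<bullet> b1) / (v \<bullet> v)) *\<^sub>R v + (b2 - (2 * (v \<bullet> b2) / (v \<bullet> v)) *\<^sub>R v)"
    by (simp add: inner_add_right add_divide_distrib scaleR_add_left distrib_left)
next
  fix r :: real and b :: 'a
  show "r *\<^sub>R b - (2 * (v \<bullet> r *\<^sub>R b) / (v \<bullet> v)) *\<^sub>R v = r *\<^sub>R (b - (2 * (v \<bullet> b) / (v \<bullet> v)) *\<^sub>R v)"
    by (simp add: algebra_simps)
qed

lemma has_derivative_inversion:
  fixes x y :: "real^'n"
  assumes "y \<noteq> x"
  shows "(inversion x r has_derivative
     (\<lambda>h. (r\<^sup>2 / (norm (y - x))\<^sup>2) *\<^sub>R (h - (2 * ((y - x) \<bullet> h) / ((y - x) \<bullet> (y - x))) *\<^sub>R (y - x)))) (at y)"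
proof -
  define q where "q = (y - x) \<bullet> (y - x)"
  have q: "q \<noteq> 0" using assms by (simp add: q_def)
  have 1: "((\<lambda>y. (y - x) \<bullet> (y - x)) has_derivative (\<lambda>h. 2 * ((y - x) \<bullet> h))) (at y)"
    by (auto intro!: derivative_eq_intros simp: inner_commute)
  have 2: "((\<lambda>y. r\<^sup>2 * inverse ((y - x) \<bullet> (y - x))) has_derivative (\<lambda>h. - (r\<^sup>2 * (2 * ((y - x) \<bullet> h)) / q\<^sup>2))) (at y)"
    using has_derivative_mult_right[OF Deriv.has_derivative_inverse[OF _ 1], of "r\<^sup>2"] assms
    by (simp add: q_def power2_eq_square divide_inverse mult_ac)
  have 3: "((\<lambda>y. y - x) has_derivative (\<lambda>h. h)) (at y)"
    by (auto intro!: derivative_eq_intros)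
  have "((\<lambda>y. (r\<^sup>2 * inverse ((y - x) \<bullet> (y - x))) *\<^sub>R (y - x) + x) has_derivative
     (\<lambda>h. (r\<^sup>2 * inverse q) *\<^sub>R h + (- (r\<^sup>2 * (2 * ((y - x) \<bullet> h)) / q\<^sup>2)) *\<^sub>R (y - x))) (at y)"
    using has_derivative_add[OF has_derivative_scaleR[OF 2 3] has_derivative_const[of x]] by (simp add: q_def)
  also have "(\<lambda>h. (r\<^sup>2 * inverse q) *\<^sub>R h + (- (r\<^sup>2 * (2 * ((y - x) \<bullet> h)) / q\<^sup>2)) *\<^sub>R (y - x)) =
     (\<lambda>h. (r\<^sup>2 / (norm (y - x))\<^sup>2) *\<^sub>R (h - (2 * ((y - x) \<bullet> h) / q) *\<^sub>R (y - x)))"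
    using q unfolding power2_norm_eq_inner q_def[symmetric]
    by (simp add: fun_eq_iff scaleR_diff_right divide_inverse power2_eq_square mult_ac)
  finally have "((\<lambda>y. (r\<^sup>2 * inverse ((y - x) \<bullet> (y - x))) *\<^sub>R (y - x) + x) has_derivative
     (\<lambda>h. (r\<^sup>2 / (norm (y - x))\<^sup>2) *\<^sub>R (h - (2 * ((y - x) \<bullet> h) / ((y - x) \<bullet> (y - x))) *\<^sub>R (y - x)))) (at y)"
    by (simp add: q_def)
  then show ?thesis
    by (simp add: inversion_def[abs_def] power2_norm_eq_inner divide_inverse)
qed

text \<open>The inversion is conformal with factor
  \<open>r\<^sup>2 / (norm (y - x))\<^sup>2\<close>, whose n-th power is the Jacobian. Since it is
  its own inverse, the change of variables theorem is applied with the same map in both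
  directions.\<close>

lemma lborel_inversion_wellorder:
  fixes x :: "real^'n::{finite,wellorder}"
  assumes r: "0 < r"
  shows "lborel = distr (density lborel (\<lambda>y. ennreal ((r / norm (y - x)) ^ (2 * CARD('n))))) borel (inversion x r)"
proof (rule lborel_eqI)
  fix l u :: "real^'n::_" assume lu: "\<And>b. b \<in> Basis \<Longrightarrow> l \<bullet> b \<le> u \<bullet> b"
  define S where "S = UNIV - {x}"
  define J where "J = (\<lambda>y :: (real^'n::_). (r / norm (y - x)) ^ (2 * CARD('n)))"
  define D where "D = (\<lambda>y h. (r\<^sup>2 / (norm (y - x))\<^sup>2) *\<^sub>R (h - (2 * ((y - x) \<bullet> h) / ((y - x) \<bullet> (y - x))) *\<^sub>R (y - x)))"
  let ?f = "indicator (box l u) :: (real^'n::_) \<Rightarrow> real"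
  have J: "\<bar>det (matrix (D y))\<bar> = J y" if "y \<in> S" for y
  proof -
    have ot: "orthogonal_transformation (\<lambda>h. h - (2 * ((y - x) \<bullet> h) / ((y - x) \<bullet> (y - x))) *\<^sub>R (y - x))"
      using that by (intro reflection_orthogonal) (simp add: S_def)
    have "matrix (D y) = (r\<^sup>2 / (norm (y - x))\<^sup>2) *\<^sub>R matrix (\<lambda>h. h - (2 * ((y - x) \<bullet> h) / ((y - x) \<bullet> (y - x))) *\<^sub>R (y - x))"
      by (simp add: D_def matrix_def vec_eq_iff)
    moreover have "det (c *\<^sub>R A) = c ^ CARD('n) * det A" for c :: real and A :: "real^'n::_^'n::_"
    proof -
      have "c *\<^sub>R A = (\<chi> i. c *s row i A)"
        by (simp add: vec_eq_iff row_def)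
      then show ?thesis
        using det_rows_mul[of "\<lambda>_. c" "\<lambda>i. row i A"] by (simp add: row_def)
    qed
    ultimately have "\<bar>det (matrix (D y))\<bar> = \<bar>r\<^sup>2 / (norm (y - x))\<^sup>2\<bar> ^ CARD('n)"
      using orthogonal_transformation_det[OF ot] by (simp add: abs_mult power_abs)
    also have "\<dots> = J y"
      by (simp add: J_def power_mult power_divide)
    finally show ?thesis .
  qed
  have der: "(inversion x r has_derivative D y) (at y within S)" if "y \<in> S" for y
    using has_derivative_at_withinI[OF has_derivative_inversion[of y x r]] that by (simp add: D_def S_def)
  have mapsto: "inversion x r y \<in> S \<and> inversion x r (inversion x r y) = y" if "y \<in> S" for y
    using that r inversion_ne[of y x r] inversion_inversion[of y x r] by (simp add: S_def)
  \<comment> \<open>A point and its inverse lie on one ray from \<open>x\<close>, so both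
    derivatives use the same reflection, which is an involution; the two conformal factors multiply
    to 1.\<close>
  have id: "D y \<circ> D (inversion x r y) = id" if "y \<in> S" for y
  proof
    fix h
    define R where "R v h = h - (2 * (v \<bullet> h) / (v \<bullet> v)) *\<^sub>R v" for v h :: "real^'n::_"
    have D_R: "D y h = (r\<^sup>2 / (norm (y - x))\<^sup>2) *\<^sub>R R (y - x) h" for y h
      by (simp add: D_def R_def)
    have y: "y \<noteq> x" using that by (simp add: S_def)
    define t where "t = r\<^sup>2 / (norm (y - x))\<^sup>2"
    have t: "t > 0" using y r by (simp add: t_def)
    have iv: "inversion x r y - x = t *\<^sub>R (y - x)"
      by (simp add: inversion_def t_def)
    have sc: "R (t *\<^sub>R v) h = R v h" for v h
      using t by (simp add: R_def)
    have lin: "R v (c *\<^sub>R h) = c *\<^sub>R R v h" for v h c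
      by (simp add: R_def algebra_simps)
    have inv: "R v (R v h) = h" if "v \<noteq> 0" for v h
      using that by (simp add: R_def inner_diff_right algebra_simps)
    have coef: "(r\<^sup>2 / (norm (y - x))\<^sup>2) * (r\<^sup>2 / (norm (inversion x r y - x))\<^sup>2) = 1"
      using y r by (simp add: norm_inversion_diff) (simp add: power_divide power2_eq_square power4_eq_xxxx)
    have "D y (D (inversion x r y) h) =
      ((r\<^sup>2 / (norm (y - x))\<^sup>2) * (r\<^sup>2 / (norm (inversion x r y - x))\<^sup>2)) *\<^sub>R R (y - x) (R (inversion x r y - x) h)"
      by (simp only: D_R lin scaleR_scaleR)
    also have "\<dots> = h"
      unfolding coef using y by (simp add: iv sc inv)
    finally show "(D y \<circ> D (inversion x r y)) h = id h" by simp
  qed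
  \<comment> \<open>The centre is removed because the map is not differentiable there; a single
    point does not affect integrals.\<close>
  have S_iff: "(f has_integral b) S \<longleftrightarrow> (f has_integral b) UNIV" for f :: "real^'n::_ \<Rightarrow> real" and b
    unfolding has_integral_restrict_UNIV[of S f, symmetric]
    by (rule has_integral_spike_finite_eq[of "{x}"]) (auto simp: S_def)
  have "(?f has_integral measure lborel (box l u)) UNIV"
    using has_integral_measure_lborel[of "box l u"] emeasure_bounded_finite[of "box l u"]
      has_integral_restrict_UNIV[of "box l u" "\<lambda>_. 1::real"]
    by (simp add: indicator_def[abs_def] of_bool_def)
  then have "(?f has_integral measure lborel (box l u)) S"
    by (simp add: S_iff)
  then have "((\<lambda>y. \<bar>det (matrix (D y))\<bar> * ?f (inversion x r y)) has_integral measure lborel (box l u)) S"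
    using cov_invertible_nonneg_eq[of S "inversion x r" D S "inversion x r" D ?f] der mapsto id by simp
  then have "((\<lambda>y. J y * ?f (inversion x r y)) has_integral measure lborel (box l u)) S"
    by (rule has_integral_eq[rotated]) (simp add: J)
  then have hi: "((\<lambda>y. J y * ?f (inversion x r y)) has_integral measure lborel (box l u)) UNIV"
    by (simp add: S_iff)
  have [measurable]: "inversion x r -` box l u \<in> sets borel"
    using measurable_sets_borel[OF borel_measurable_inversion, of "box l u" x r] by simp
  have "emeasure (distr (density lborel (\<lambda>y. ennreal (J y))) borel (inversion x r)) (box l u)
      = (\<integral>\<^sup>+y. ennreal (J y) * indicator (inversion x r -` box l u) y \<partial>lborel)"
    by (simp add: emeasure_distr emeasure_density J_def)
  also have "\<dots> = (\<integral>\<^sup>+y. ennreal (J y * ?f (inversion x r y)) \<partial>lborel)"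
    by (intro nn_integral_cong) (auto simp: indicator_def)
  also have "\<dots> = ennreal (measure lborel (box l u))"
    by (rule nn_integral_has_integral_lborel[OF _ _ hi]) (use r in \<open>auto simp: J_def\<close>)
  also have "\<dots> = emeasure lborel (box l u)"
    using emeasure_bounded_finite[of "box l u"] by (simp add: emeasure_eq_ennreal_measure)
  also have "\<dots> = (\<Prod>b\<in>Basis. (u - l) \<bullet> b)"
    using lu by (rule emeasure_lborel_box)
  finally show "emeasure (distr (density lborel (\<lambda>y. ennreal ((r / norm (y - x)) ^ (2 * CARD('n))))) borel (inversion x r)) (box l u)
      = (\<Prod>b\<in>Basis. (u - l) \<bullet> b)"
    by (simp add: J_def)
qed simp

text \<open>\<open>from_idx\<close> is an isometry that preserves \<open>lborel\<close> and commutes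
  with inversions, which carries the well-ordered case over to an arbitrary index type.\<close>

lemma lborel_inversion:
  fixes x :: "real^'n"
  assumes r: "0 < r"
  shows "lborel = distr (density lborel (\<lambda>y. ennreal ((r / norm (y - x)) ^ (2 * CARD('n))))) borel (inversion x r)"
proof (rule measure_eqI)
  fix A :: "(real^'n) set" assume "A \<in> sets lborel"
  then have A [measurable]: "A \<in> sets borel" by simp
  define x' where "x' = to_idx x"
  have x: "x = from_idx x'" by (simp add: x'_def)
  have [measurable]: "from_idx -` A \<in> sets borel" "inversion x r -` A \<in> sets borel"
    using measurable_sets_borel[OF borel_measurable_from_idx A]
      measurable_sets_borel[OF borel_measurable_inversion A] by auto
  then have [measurable]: "inversion x' r -` (from_idx -` A) \<in> sets borel"
    using measurable_sets_borel[OF borel_measurable_inversion] by blast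
  have eq: "norm (from_idx w - x) = norm (w - x')" for w
    unfolding x by (metis norm_from_idx bounded_linear.linear bounded_linear_from_idx linear_diff)
  have "emeasure lborel A = emeasure lborel (from_idx -` A)"
    by (subst lborel_from_idx) (simp add: emeasure_distr)
  also have "\<dots> = (\<integral>\<^sup>+w. ennreal ((r / norm (w - x')) ^ (2 * CARD('n))) *
      indicator (inversion x' r -` (from_idx -` A)) w \<partial>lborel)"
    by (subst lborel_inversion_wellorder[OF r, of x']) (simp add: emeasure_distr emeasure_density CARD_idx)
  also have "\<dots> = (\<integral>\<^sup>+w. ennreal ((r / norm (from_idx w - x)) ^ (2 * CARD('n))) *
      indicator (inversion x r -` A) (from_idx w) \<partial>lborel)"
    by (intro nn_integral_cong) (simp add: eq, simp add: x indicator_def from_idx_inversion)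
  also have "\<dots> = (\<integral>\<^sup>+y. ennreal ((r / norm (y - x)) ^ (2 * CARD('n))) *
      indicator (inversion x r -` A) y \<partial>lborel)"
    by (subst (2) lborel_from_idx) (simp add: nn_integral_distr)
  also have "\<dots> = emeasure (distr (density lborel (\<lambda>y. ennreal ((r / norm (y - x)) ^ (2 * CARD('n))))) borel (inversion x r)) A"
    by (simp add: emeasure_distr emeasure_density)
  finally show "emeasure lborel A =
    emeasure (distr (density lborel (\<lambda>y. ennreal ((r / norm (y - x)) ^ (2 * CARD('n))))) borel (inversion x r)) A" .
qed simp

text \<open>The tool for folding the exterior of a ball into the ball. At \<open>y = x\<close>
  division by zero makes the Jacobian factor 0, so the formulas hold without excluding the
  centre.\<close>

lemma
  fixes x :: "real^'n" and f :: "real^'n \<Rightarrow> real"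
  assumes r: "0 < r" and [measurable]: "f \<in> borel_measurable borel"
  shows integrable_inversion_iff: "integrable lborel f \<longleftrightarrow>
      integrable lborel (\<lambda>y. (r / norm (y - x)) ^ (2 * CARD('n)) * f (inversion x r y))"
    and integral_inversion: "integral\<^sup>L lborel f =
      (LINT y|lborel. (r / norm (y - x)) ^ (2 * CARD('n)) * f (inversion x r y))"
proof -
  show "integrable lborel f \<longleftrightarrow>
      integrable lborel (\<lambda>y. (r / norm (y - x)) ^ (2 * CARD('n)) * f (inversion x r y))"
    by (subst lborel_inversion[OF r, of x])
      (use r in \<open>simp add: integrable_distr_eq integrable_density\<close>)
  show "integral\<^sup>L lborel f =
      (LINT y|lborel. (r / norm (y - x)) ^ (2 * CARD('n)) * f (inversion x r y))"
    by (subst lborel_inversion[OF r, of x])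
      (use r in \<open>simp add: integral_distr integral_density\<close>)
qed

lemma pred_mem_ball [measurable]:
  fixes y :: "'a::euclidean_space"
  assumes [measurable]: "f \<in> borel_measurable M"
  shows "Measurable.pred M (\<lambda>z. f z \<in> ball y r)"
  unfolding mem_ball by measurable

subsection \<open>Singular kernels and truncated principal values\<close>

text \<open>Reflection in the point \<open>y\<close>. It kills integrands that are odd about
  \<open>y\<close>, and with \<open>y\<close> halved it recentres balls at the origin.\<close>

lemma integral_lborel_reflect:
  fixes f :: "'a::euclidean_space \<Rightarrow> real"
  assumes [measurable]: "f \<in> borel_measurable borel"
  shows "(LINT z|lborel. f z) = (LINT z|lborel. f (2 *\<^sub>R y - z))"
  by (subst lborel_affine[of "-1" "2 *\<^sub>R y"]) (simp_all add: density_1 integral_distr)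

text \<open>Dyadic shells: where \<open>norm (z - y)\<close> lies between
  \<open>R / 2 ^ Suc k\<close> and \<open>R / 2 ^ k\<close> the integrand is at most
  \<open>c k\<close>. Multiplied by the volumes of the balls of radius \<open>R / 2 ^ k\<close>,
  these bounds form a geometric series of ratio \<open>2 powr (s - ?n)\<close>, which is below
  1.\<close>

lemma integrable_norm_powr_ball:
  fixes y :: "real^'n"
  assumes "0 \<le> s" "s < real CARD('n)"
  shows "integrable lborel (\<lambda>z. indicator (ball y R) z * norm (z - y) powr (- s))"
proof (cases "0 < R")
  case False
  then show ?thesis by (simp add: ball_empty)
next
  case R: True
  let ?n = "CARD('n)"
  define \<omega> where "\<omega> = measure lborel (ball (0::real^'n) 1)"
  define c where "c k = (R / 2 ^ Suc k) powr (- s)" for k :: nat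
  have em: "emeasure lborel (ball y t) = ennreal (t ^ ?n * \<omega>)" if "0 \<le> t" for t
    using content_ball_conv_unit_ball[OF that, of y] emeasure_bounded_finite[of "ball y t"]
    by (simp add: emeasure_eq_ennreal_measure \<omega>_def)
  have pw: "ennreal (indicator (ball y R) z * norm (z - y) powr (- s))
      \<le> (\<Sum>k. ennreal (c k) * indicator (ball y (R / 2 ^ k)) z)" for z
  proof (cases "z \<in> ball y R \<and> z \<noteq> y")
    case True
    define t where "t = norm (z - y)"
    have t: "0 < t" "t < R" using True by (auto simp: t_def dist_norm norm_minus_commute)
    have "\<exists>k. R / 2 ^ Suc k \<le> t"
    proof -
      obtain k where "(1/2) ^ k < t / R"
        using real_arch_pow_inv[of "t / R" "1/2"] t R by auto
      then have "R / 2 ^ k < t"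
        using R by (simp add: field_simps power_divide)
      moreover have "R / 2 ^ Suc k \<le> R / 2 ^ k"
        using R by (simp add: field_simps)
      ultimately show ?thesis by (meson less_imp_le order_trans)
    qed
    \<comment> \<open>The least such \<open>k\<close> names the shell: minimality gives the upper
      bound on \<open>t\<close>, and for \<open>k = 0\<close> that bound is the radius
      \<open>R\<close> itself.\<close>
    define k where "k = (LEAST k. R / 2 ^ Suc k \<le> t)"
    have k1: "R / 2 ^ Suc k \<le> t"
      unfolding k_def by (rule LeastI_ex) fact
    have k2: "t < R / 2 ^ k"
    proof (cases k)
      case 0
      then show ?thesis using t by simp
    next
      case (Suc j)
      then show ?thesis
        using not_less_Least[of j "\<lambda>k. R / 2 ^ Suc k \<le> t"] by (auto simp: k_def not_le)
    qed
    have "indicator (ball y R) z * norm (z - y) powr (- s) \<le> c k"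
      unfolding c_def t_def[symmetric] using k1 R assms(1) t
      by (auto simp: indicator_def intro!: powr_mono2')
    then have "ennreal (indicator (ball y R) z * norm (z - y) powr (- s)) \<le> ennreal (c k) * indicator (ball y (R / 2 ^ k)) z"
      using k2 by (simp add: t_def dist_norm norm_minus_commute ennreal_leI)
    also have "\<dots> \<le> (\<Sum>k. ennreal (c k) * indicator (ball y (R / 2 ^ k)) z)"
      using sum_le_suminf[of "\<lambda>k. ennreal (c k) * indicator (ball y (R / 2 ^ k)) z" "{k}"]
      by (simp del: sum_mult_indicator)
    finally show ?thesis .
  qed auto
  have "(\<integral>\<^sup>+z. ennreal (indicator (ball y R) z * norm (z - y) powr (- s)) \<partial>lborel)
      \<le> (\<integral>\<^sup>+z. (\<Sum>k. ennreal (c k) * indicator (ball y (R / 2 ^ k)) z) \<partial>lborel)"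
    by (intro nn_integral_mono pw)
  also have "\<dots> = (\<Sum>k. \<integral>\<^sup>+z. ennreal (c k) * indicator (ball y (R / 2 ^ k)) z \<partial>lborel)"
    by (rule nn_integral_suminf) auto
  also have "\<dots> = (\<Sum>k. ennreal (c k * ((R / 2 ^ k) ^ ?n * \<omega>)))"
    using R by (intro suminf_cong) (simp add: nn_integral_cmult em c_def ennreal_mult' \<omega>_def)
  also have "\<dots> = (\<Sum>k. ennreal ((R / 2) powr (- s) * R ^ ?n * \<omega> * (2 powr (s - ?n)) ^ k))"
  proof (intro suminf_cong arg_cong[where f=ennreal])
    fix k
    have "c k = (R / 2) powr (- s) * (2 powr s) ^ k"
    proof -
      have "R / 2 ^ Suc k = (R / 2) * (2 powr (- real k))"
        by (simp add: powr_minus powr_realpow field_simps)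
      then have "c k = (R / 2) powr (- s) * (2 powr (- real k)) powr (- s)"
        unfolding c_def using R by (simp only: powr_mult)
      then show ?thesis by (simp add: powr_powr powr_power mult.commute)
    qed
    moreover have "(R / 2 ^ k) ^ ?n = R ^ ?n * (2 powr (- ?n)) ^ k"
      by (simp add: power_divide powr_minus powr_realpow power_mult[symmetric] mult.commute power_inverse divide_inverse power_mult_distrib)
    moreover have "(2 powr (s - ?n)) ^ k = (2 powr s) ^ k * (2 powr (- ?n)) ^ k"
      by (simp add: power_mult_distrib[symmetric] powr_add[symmetric])
    ultimately show "c k * ((R / 2 ^ k) ^ ?n * \<omega>) = (R / 2) powr (- s) * R ^ ?n * \<omega> * (2 powr (s - ?n)) ^ k"
      by simp
  qed
  also have "\<dots> < \<infinity>"
  proof -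
    have "(2::real) powr (s - ?n) < 1" using assms by (simp add: powr_less_one)
    then have "summable (\<lambda>k. (R / 2) powr (- s) * R ^ ?n * \<omega> * (2 powr (s - ?n)) ^ k)"
      by (intro summable_mult summable_geometric) simp
    then show ?thesis
      using R by (subst suminf_ennreal2) (auto simp: \<omega>_def)
  qed
  finally have fin: "(\<integral>\<^sup>+z. ennreal (indicator (ball y R) z * norm (z - y) powr (- s)) \<partial>lborel) < \<infinity>" .
  show ?thesis
    by (rule integrableI_nonneg) (use fin in auto)
qed

text \<open>Inversion in the unit sphere about \<open>y\<close> turns the exponent \<open>s\<close>
  at infinity into 2n - s at \<open>y\<close>, which by the two bounds on \<open>s\<close> is
  nonnegative and below the dimension.\<close>

lemma integrable_norm_powr_outside:
  fixes y :: "real^'n"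
  assumes s: "real CARD('n) < s" "s \<le> 2 * real CARD('n)" and e: "0 < e"
  shows "integrable lborel (\<lambda>z. indicator {z. e \<le> norm (z - y)} z * norm (z - y) powr (- s))"
proof -
  let ?n = "CARD('n)"
  have "integrable lborel (\<lambda>w. (1 / norm (w - y)) ^ (2 * ?n) *
      (indicator {z. e \<le> norm (z - y)} (inversion y 1 w) * norm (inversion y 1 w - y) powr (- s)))"
  proof (rule Bochner_Integration.integrable_bound)
    \<comment> \<open>Radius \<open>2 / e\<close> rather than \<open>1 / e\<close>: the image of the
      closed exterior contains its boundary sphere, which the open ball of radius
      \<open>1 / e\<close> would miss.\<close>
    show "integrable lborel (\<lambda>z. indicator (ball y (2 / e)) z * norm (z - y) powr (- (2 * ?n - s)))"
      using s by (intro integrable_norm_powr_ball) auto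
    show "AE w in lborel. norm ((1 / norm (w - y)) ^ (2 * ?n) *
        (indicator {z. e \<le> norm (z - y)} (inversion y 1 w) * norm (inversion y 1 w - y) powr (- s)))
        \<le> norm (indicator (ball y (2 / e)) w * norm (w - y) powr (- (2 * ?n - s)))"
    proof (rule AE_I2)
      fix w
      show "norm ((1 / norm (w - y)) ^ (2 * ?n) *
        (indicator {z. e \<le> norm (z - y)} (inversion y 1 w) * norm (inversion y 1 w - y) powr (- s)))
        \<le> norm (indicator (ball y (2 / e)) w * norm (w - y) powr (- (2 * ?n - s)))"
      proof (cases "w \<noteq> y \<and> e \<le> 1 / norm (w - y)")
        case True
        define t where "t = norm (w - y)"
        have t: "0 < t" using True by (simp add: t_def)
        have "e * t \<le> 1"
          using True t unfolding t_def[symmetric] by (simp add: pos_le_divide_eq)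
        then have "e * t < 2" by simp
        then have "w \<in> ball y (2 / e)"
          using e by (simp add: t_def dist_norm norm_minus_commute field_simps)
        moreover have "(1 / t) ^ (2 * ?n) * (1 / t) powr (- s) = t powr (- (2 * ?n - s))"
          using t by (simp add: powr_realpow[symmetric] powr_divide powr_minus powr_add[symmetric] powr_diff divide_simps)
        ultimately show ?thesis
          using True t by (simp add: norm_inversion_diff t_def[symmetric] abs_mult del: power_one_over)
      next
        case False
        then show ?thesis
          by (cases "w = y") (auto simp: norm_inversion_diff zero_power)
      qed
    qed
  qed measurable
  then show ?thesis
    by (subst integrable_inversion_iff[of 1 _ y]) auto
qed

text \<open>Away from \<open>y\<close> the kernel is thus dominated by the weight in
  \<open>L_space\<close>; this makes truncated integrals of functions in that space finite.\<close>

lemma one_plus_norm_powr_le: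
  fixes y z :: "'a::real_normed_vector"
  assumes e: "0 < e" "e \<le> norm (z - y)" and s: "0 < s"
  shows "1 + norm z powr s \<le> ((1 / e) powr s + (1 + norm y / e) powr s) * norm (z - y) powr s"
proof -
  define t where "t = norm (z - y)"
  have t: "0 < t" "e \<le> t" using e by (auto simp: t_def)
  have "1 \<le> (t / e) powr s"
    using t e s by (intro ge_one_powr_ge_zero) (auto simp: field_simps)
  then have 1: "1 \<le> (1 / e) powr s * t powr s"
    using t e by (simp add: powr_mult[symmetric])
  have "norm z \<le> t + norm y"
    using norm_triangle_ineq[of "z - y" y] by (simp add: t_def)
  also have "\<dots> \<le> (1 + norm y / e) * t"
    using t e mult_left_mono[of e t "norm y"] by (simp add: field_simps)
  finally have "norm z powr s \<le> ((1 + norm y / e) * t) powr s"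
    using s by (intro powr_mono2) auto
  also have "\<dots> = (1 + norm y / e) powr s * t powr s"
    using t e by (intro powr_mult)
  finally show ?thesis
    using 1 by (simp add: t_def distrib_right)
qed

lemma integrable_kernel_outside:
  fixes w :: "real^'n \<Rightarrow> real"
  assumes [measurable]: "w \<in> borel_measurable borel"
    and w: "integrable lborel (\<lambda>z. \<bar>w z\<bar> / (1 + norm z powr s))" and e: "0 < e" and s: "0 < s"
  shows "integrable lborel (\<lambda>z. indicator {z. e \<le> norm (z - y)} z * (w z * norm (z - y) powr (- s)))"
proof -
  define C where "C = (1 / e) powr s + (1 + norm y / e) powr s"
  have C: "0 \<le> C" by (simp add: C_def)
  show ?thesis
  proof (rule Bochner_Integration.integrable_bound)
    show "integrable lborel (\<lambda>z. C * (\<bar>w z\<bar> / (1 + norm z powr s)))"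
      using integrable_mult_right[OF w, of C] .
    show "AE z in lborel. norm (indicator {z. e \<le> norm (z - y)} z * (w z * norm (z - y) powr (- s)))
        \<le> norm (C * (\<bar>w z\<bar> / (1 + norm z powr s)))"
    proof (rule AE_I2)
      fix z
      show "norm (indicator {z. e \<le> norm (z - y)} z * (w z * norm (z - y) powr (- s)))
        \<le> norm (C * (\<bar>w z\<bar> / (1 + norm z powr s)))"
      proof (cases "e \<le> norm (z - y)")
        case True
        have p: "1 + norm z powr s > 0" by (smt (verit) powr_ge_zero)
        have q: "norm (z - y) powr s > 0" using True e by auto
        have "norm (z - y) powr (- s) \<le> C / (1 + norm z powr s)"
          using one_plus_norm_powr_le[OF e True s] p q unfolding C_def[symmetric]
          by (simp add: powr_minus field_simps)
        then have "\<bar>w z\<bar> * norm (z - y) powr (- s) \<le> \<bar>w z\<bar> * (C / (1 + norm z powr s))"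
          by (rule mult_left_mono) simp
        then show ?thesis
          using True p C by (simp add: abs_mult mult_ac)
      qed simp
    qed
  qed measurable
qed

text \<open>The integral under the limit in \<open>frac_laplacian\<close>, with \<open>s\<close> in
  the role of n + \<alpha>. It is taken over \<open>lborel\<close> with the kernel as a factor, the
  form to which the inversion formulas apply.\<close>

definition truncated :: "real \<Rightarrow> (real^'n \<Rightarrow> real) \<Rightarrow> real^'n \<Rightarrow> real \<Rightarrow> real" where
  "truncated s w y \<epsilon> =
     (LINT z|lborel. indicator {z. \<epsilon> \<le> norm (z - y)} z * ((w y - w z) * norm (z - y) powr (- s)))"

lemma truncated_eq:
  fixes w :: "real^'n \<Rightarrow> real"
  assumes [measurable]: "w \<in> borel_measurable borel"
  shows "(LINT z:{z. norm (z - y) \<ge> \<epsilon>}|lebesgue. (w y - w z) / norm (y - z) powr s) = truncated s w y \<epsilon>"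
proof -
  have "(LINT z:{z. norm (z - y) \<ge> \<epsilon>}|lebesgue. (w y - w z) / norm (y - z) powr s)
     = (LINT z|lborel. indicator {z. norm (z - y) \<ge> \<epsilon>} z *\<^sub>R ((w y - w z) / norm (y - z) powr s))"
    unfolding set_lebesgue_integral_def by (rule integral_completion) measurable
  then show ?thesis
    by (simp add: truncated_def powr_minus divide_inverse norm_minus_commute)
qed

lemma integrable_truncated:
  fixes w :: "real^'n \<Rightarrow> real"
  assumes [measurable]: "w \<in> borel_measurable borel"
    and w: "integrable lborel (\<lambda>z. \<bar>w z\<bar> / (1 + norm z powr s))" and e: "0 < e"
    and s: "real CARD('n) < s" "s \<le> 2 * real CARD('n)"
  shows "integrable lborel (\<lambda>z. indicator {z. e \<le> norm (z - y)} z * ((c - w z) * norm (z - y) powr (- s)))"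
proof -
  have "integrable lborel (\<lambda>z. c * (indicator {z. e \<le> norm (z - y)} z * norm (z - y) powr (- s))
     - indicator {z. e \<le> norm (z - y)} z * (w z * norm (z - y) powr (- s)))"
    using integrable_norm_powr_outside[OF s e, of y] integrable_kernel_outside[OF assms(1) w e, of y] s
    by (intro Bochner_Integration.integrable_diff integrable_mult_right) auto
  then show ?thesis
    by (simp add: algebra_simps)
qed

text \<open>Mean value inequality for \<open>w\<close> minus its linear part at \<open>y\<close>, on
  the ball of radius \<open>norm (z - y)\<close>: there the gradient of the difference is at most
  \<open>L * norm (z - y)\<close>.\<close>

lemma second_order_remainder:
  fixes w :: "'a::euclidean_space \<Rightarrow> real"
  assumes der: "\<And>z. z \<in> cball y \<rho> \<Longrightarrow> (w has_derivative (\<lambda>h. G z \<bullet> h)) (at z)"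
    and lip: "L-lipschitz_on (cball y \<rho>) G" and z: "z \<in> cball y \<rho>"
  shows "\<bar>w y - w z + G y \<bullet> (z - y)\<bar> \<le> L * (norm (z - y))\<^sup>2"
proof -
  define d where "d = norm (z - y)"
  have d: "d \<le> \<rho>" "0 \<le> d" using z by (auto simp: d_def dist_norm norm_minus_commute)
  have "norm ((w z - G y \<bullet> z) - (w y - G y \<bullet> y)) \<le> (L * d) * norm (z - y)"
  proof (rule differentiable_bound[of "cball y d" "\<lambda>z. w z - G y \<bullet> z" "\<lambda>z h. (G z - G y) \<bullet> h"])
    fix v assume v: "v \<in> cball y d"
    then have v': "v \<in> cball y \<rho>" using d by auto
    have "((\<lambda>z. w z - G y \<bullet> z) has_derivative (\<lambda>h. G v \<bullet> h - G y \<bullet> h)) (at v)"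
      by (intro has_derivative_diff der v' has_derivative_inner_right has_derivative_ident)
    then show "((\<lambda>z. w z - G y \<bullet> z) has_derivative (\<lambda>h. (G v - G y) \<bullet> h)) (at v within cball y d)"
      by (simp add: inner_diff_left has_derivative_at_withinI)
    have "norm (G v - G y) \<le> L * d"
      using lipschitz_onD[OF lip v', of y] d v lipschitz_on_nonneg[OF lip]
      by (simp add: dist_norm) (smt (verit, best) mult_left_mono norm_minus_commute)
    moreover have "onorm (\<lambda>h. (G v - G y) \<bullet> h) \<le> norm (G v - G y)"
      by (rule onorm_le) (simp add: Cauchy_Schwarz_ineq2)
    ultimately show "onorm (\<lambda>h. (G v - G y) \<bullet> h) \<le> L * d" by simp
  qed (use d in \<open>auto simp: d_def dist_norm norm_minus_commute\<close>)
  then show ?thesis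
    by (simp add: d_def inner_diff_right power2_eq_square algebra_simps abs_minus_commute)
qed

text \<open>Subtracting the gradient term, whose integral vanishes by oddness, leaves an absolutely integrable
  integrand.\<close>

lemma truncated_converges:
  fixes w :: "real^'n \<Rightarrow> real"
  assumes \<alpha>: "0 < \<alpha>" "\<alpha> < 2" and n2: "2 \<le> CARD('n)"
    and [measurable]: "w \<in> borel_measurable borel"
    and w: "integrable lborel (\<lambda>z. \<bar>w z\<bar> / (1 + norm z powr (real CARD('n) + \<alpha>)))"
    and S: "open S" "y \<in> S" and C11: "C11_loc_on S w"
  shows "\<exists>L. (truncated (real CARD('n) + \<alpha>) w y \<longlongrightarrow> L) (at_right 0)"
proof -
  define s where "s = real CARD('n) + \<alpha>"
  have s: "real CARD('n) < s" "s \<le> 2 * real CARD('n)" "0 < s"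
    using \<alpha> n2 by (auto simp: s_def)
  obtain \<rho> where \<rho>: "0 < \<rho>" "cball y \<rho> \<subseteq> S"
    using S open_contains_cball by blast
  obtain G where G: "\<And>z. z \<in> S \<Longrightarrow> (w has_derivative (\<lambda>h. G z \<bullet> h)) (at z)"
    and "\<exists>L. L-lipschitz_on (cball y \<rho>) G"
    using C11 \<rho> unfolding C11_loc_on_def by (metis compact_cball)
  then obtain L where L: "L-lipschitz_on (cball y \<rho>) G" by blast
  \<comment> \<open>The gradient term is cut off to \<open>ball y \<rho>\<close>; over the whole
    space it would not be integrable at infinity when \<alpha> \<le> 1.\<close>
  define k where "k z = (w y - w z + indicator (ball y \<rho>) z * (G y \<bullet> (z - y))) * norm (z - y) powr (- s)" for z
  have [measurable]: "k \<in> borel_measurable borel"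
    unfolding k_def by measurable
  have k: "integrable lborel k"
  proof (rule Bochner_Integration.integrable_bound)
    \<comment> \<open>Near \<open>y\<close> the second-order remainder lowers the exponent to
      \<open>s - 2\<close>, less than the dimension since \<alpha> < 2; away from \<open>y\<close>
      no gradient term is left.\<close>
    show "integrable lborel (\<lambda>z. L * (indicator (ball y \<rho>) z * norm (z - y) powr (- (s - 2)))
       + \<bar>indicator {z. \<rho> \<le> norm (z - y)} z * ((w y - w z) * norm (z - y) powr (- s))\<bar>)"
      using integrable_norm_powr_ball[of "s - 2" y \<rho>] integrable_truncated[OF \<open>w \<in> borel_measurable borel\<close> w[folded s_def] \<rho>(1) s(1,2)]
        s \<alpha> n2 by (auto simp: s_def)
    show "AE z in lborel. norm (k z) \<le> norm (L * (indicator (ball y \<rho>) z * norm (z - y) powr (- (s - 2)))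
       + \<bar>indicator {z. \<rho> \<le> norm (z - y)} z * ((w y - w z) * norm (z - y) powr (- s))\<bar>)"
    proof (rule AE_I2)
      fix z
      show "norm (k z) \<le> norm (L * (indicator (ball y \<rho>) z * norm (z - y) powr (- (s - 2)))
       + \<bar>indicator {z. \<rho> \<le> norm (z - y)} z * ((w y - w z) * norm (z - y) powr (- s))\<bar>)"
      proof (cases "z \<in> ball y \<rho>")
        case True
        then have nz: "\<not> \<rho> \<le> norm (z - y)" by (simp add: dist_norm norm_minus_commute)
        show ?thesis
        proof (cases "z = y")
          case False
          have "\<bar>w y - w z + G y \<bullet> (z - y)\<bar> \<le> L * (norm (z - y))\<^sup>2"
            by (rule second_order_remainder[of y \<rho>, OF _ L]) (use True G \<rho> in auto)
          then have "\<bar>w y - w z + G y \<bullet> (z - y)\<bar> * norm (z - y) powr (- s) \<le> (L * (norm (z - y))\<^sup>2) * norm (z - y) powr (- s)"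
            by (rule mult_right_mono) simp
          also have "\<dots> = L * norm (z - y) powr (- (s - 2))"
            using False by (simp add: powr_add[symmetric] flip: powr_numeral)
          finally show ?thesis
            using True nz lipschitz_on_nonneg[OF L] by (simp add: k_def abs_mult)
        qed (simp add: k_def)
      next
        case False
        then show ?thesis by (simp add: k_def dist_norm norm_minus_commute)
      qed
    qed
  qed measurable
  have odd: "truncated s w y \<epsilon> = (LINT z|lborel. indicator {z. \<epsilon> \<le> norm (z - y)} z * k z)" if \<epsilon>: "0 < \<epsilon>" for \<epsilon>
  proof -
    define g where "g z = indicator {z. \<epsilon> \<le> norm (z - y)} z * (indicator (ball y \<rho>) z * (G y \<bullet> (z - y)) * norm (z - y) powr (- s))" for z
    have [measurable]: "g \<in> borel_measurable borel"
      unfolding g_def by measurable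
    have gr: "g (2 *\<^sub>R y - z) = - g z" for z
    proof -
      have "2 *\<^sub>R y - z - y = - (z - y)" by (simp add: scaleR_2)
      moreover have "dist y (2 *\<^sub>R y - z) = dist y z" by (simp add: dist_norm scaleR_2 norm_minus_commute)
      ultimately show ?thesis
        by (simp add: g_def indicator_def norm_minus_commute inner_diff_right algebra_simps)
    qed
    have "(LINT z|lborel. g z) = - (LINT z|lborel. g z)"
      by (subst integral_lborel_reflect[of g y]) (simp_all add: gr)
    then have g0: "(LINT z|lborel. g z) = 0" by simp
    have t: "integrable lborel (\<lambda>z. indicator {z. \<epsilon> \<le> norm (z - y)} z * ((w y - w z) * norm (z - y) powr (- s)))"
      using integrable_truncated[OF \<open>w \<in> borel_measurable borel\<close> w[folded s_def] \<epsilon> s(1,2)] .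
    have ki: "integrable lborel (\<lambda>z. indicator {z. \<epsilon> \<le> norm (z - y)} z * k z)"
      by (rule Bochner_Integration.integrable_bound[OF k]) (auto simp: indicator_def)
    have g_eq: "g z = indicator {z. \<epsilon> \<le> norm (z - y)} z * k z - indicator {z. \<epsilon> \<le> norm (z - y)} z * ((w y - w z) * norm (z - y) powr (- s))" for z
      by (simp add: g_def k_def algebra_simps)
    have "(LINT z|lborel. g z) = (LINT z|lborel. indicator {z. \<epsilon> \<le> norm (z - y)} z * k z) - truncated s w y \<epsilon>"
      unfolding g_eq truncated_def by (rule Bochner_Integration.integral_diff[OF ki t])
    then show ?thesis using g0 by simp
  qed
  have "(truncated s w y \<longlongrightarrow> (LINT z|lborel. k z)) (at_right 0)"
  proof (rule tendsto_at_right_sequentially[of _ 1])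
    fix X :: "nat \<Rightarrow> real"
    assume X: "\<And>n. 0 < X n" "X \<longlonglongrightarrow> 0"
    have "(\<lambda>n. LINT z|lborel. indicator {z. X n \<le> norm (z - y)} z * k z) \<longlonglongrightarrow> (LINT z|lborel. k z)"
    proof (rule integral_dominated_convergence[where w="\<lambda>z. norm (k z)"])
      show "AE z in lborel. (\<lambda>n. indicator {z. X n \<le> norm (z - y)} z * k z) \<longlonglongrightarrow> k z"
      proof (rule AE_I2)
        fix z
        show "(\<lambda>n. indicator {z. X n \<le> norm (z - y)} z * k z) \<longlonglongrightarrow> k z"
        proof (cases "z = y")
          case False
          then have "eventually (\<lambda>n. X n < norm (z - y)) sequentially"
            using order_tendstoD(2)[OF X(2)] by simp
          then have "eventually (\<lambda>n. indicator {z. X n \<le> norm (z - y)} z * k z = k z) sequentially"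
            by eventually_elim simp
          then show ?thesis by (rule tendsto_eventually)
        qed (simp add: k_def)
      qed
    qed (use k in \<open>auto simp: indicator_def\<close>)
    then show "(\<lambda>n. truncated s w y (X n)) \<longlonglongrightarrow> (LINT z|lborel. k z)"
      using X(1) by (simp add: odd)
  qed simp
  then show ?thesis
    unfolding s_def by blast
qed

subsection \<open>Geometry of the inversion and small radii\<close>

lemma norm_inversion_inversion_diff:
  assumes "y \<noteq> x" "z \<noteq> x"
  shows "norm (inversion x r y - inversion x r z) = r\<^sup>2 * norm (y - z) / (norm (y - x) * norm (z - x))"
proof -
  define a b where "a = y - x" and "b = z - x"
  have ab: "a \<bullet> a > 0" "b \<bullet> b > 0" using assms by (auto simp: a_def b_def)
  have "(norm (inversion x r y - inversion x r z))\<^sup>2 = (norm ((r\<^sup>2 / (a \<bullet> a)) *\<^sub>R a - (r\<^sup>2 / (b \<bullet> b)) *\<^sub>R b))\<^sup>2"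
    by (simp add: inversion_def a_def b_def power2_norm_eq_inner)
  also have "\<dots> = (r\<^sup>2)\<^sup>2 * ((a - b) \<bullet> (a - b)) / ((a \<bullet> a) * (b \<bullet> b))"
    using ab unfolding power2_norm_eq_inner
    by (simp add: inner_diff inner_commute[of b a] field_simps power2_eq_square)
  also have "\<dots> = (r\<^sup>2 * norm (y - z) / (norm (y - x) * norm (z - x)))\<^sup>2"
    by (simp add: power_divide power_mult_distrib power2_norm_eq_inner a_def b_def)
  finally show ?thesis
    by (rule power2_eq_imp_eq) auto
qed

lemma inversion_sphere: "norm (y - x) = r \<Longrightarrow> r \<noteq> 0 \<Longrightarrow> inversion x r y = y"
  by (simp add: inversion_def)

text \<open>After squaring, the difference of the two sides is
  \<open>(r\<^sup>2 - A) * (B - r\<^sup>2)\<close>, where \<open>A\<close> and \<open>B\<close> are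
  the squared distances of \<open>y\<close> and \<open>z\<close> from \<open>x\<close>; one point
  inside and one outside make it nonnegative.\<close>

lemma norm_diff_inversion_outer:
  assumes "z \<noteq> x" "0 < r" "norm (y - x) \<le> r" "r \<le> norm (z - x)"
  shows "norm (z - x) * norm (y - inversion x r z) \<le> r * norm (y - z)"
proof -
  define a b where "a = y - x" and "b = z - x"
  define A B where "A = a \<bullet> a" and "B = b \<bullet> b"
  have B: "B > 0" using assms by (simp add: b_def B_def)
  have AB: "A \<le> r\<^sup>2" "r\<^sup>2 \<le> B"
    using assms power_mono[of "norm a" r 2] power_mono[of r "norm b" 2]
    by (auto simp: A_def B_def a_def b_def power2_norm_eq_inner)
  have sq: "(norm (a - c *\<^sub>R b))\<^sup>2 = A - 2 * c * (a \<bullet> b) + c\<^sup>2 * B" for c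
    unfolding power2_norm_eq_inner A_def B_def
    by (simp add: inner_diff inner_commute[of b a] power2_eq_square algebra_simps)
  have "y - inversion x r z = a - (r\<^sup>2 / B) *\<^sub>R b"
    by (simp add: inversion_def a_def b_def B_def power2_norm_eq_inner)
  then have 0: "(norm (y - inversion x r z))\<^sup>2 = A - 2 * (r\<^sup>2 / B) * (a \<bullet> b) + (r\<^sup>2 / B)\<^sup>2 * B"
    using sq[of "r\<^sup>2 / B"] by simp
  have 1: "(norm (z - x) * norm (y - inversion x r z))\<^sup>2 = B * A - 2 * r\<^sup>2 * (a \<bullet> b) + r\<^sup>2 * r\<^sup>2"
  proof -
    have "(norm (z - x))\<^sup>2 = B"
      by (simp add: power2_norm_eq_inner b_def B_def)
    with 0 show ?thesis
      using B by (simp only: power_mult_distrib) (simp add: field_simps power2_eq_square)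
  qed
  have "y - z = a - b" by (simp add: a_def b_def)
  then have 2: "(r * norm (y - z))\<^sup>2 = r\<^sup>2 * (A - 2 * (a \<bullet> b) + B)"
    unfolding power_mult_distrib power2_norm_eq_inner A_def B_def
    by (simp add: inner_diff inner_commute[of b a])
  have "0 \<le> (r\<^sup>2 - A) * (B - r\<^sup>2)" using AB by simp
  then have "(norm (z - x) * norm (y - inversion x r z))\<^sup>2 \<le> (r * norm (y - z))\<^sup>2"
    unfolding 1 2 by (simp add: algebra_simps)
  then show ?thesis
    by (rule power2_le_imp_le) (use assms in \<open>auto\<close>)
qed

text \<open>The outer estimate applied to the inverse of \<open>z\<close>. Raised to a negative
  power, it says that the reflected kernel, conformal factor included, is at most the original one;
  both comparisons of \<open>omega\<close> with its reflection rest on this.\<close>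

lemma norm_diff_inversion_inner:
  assumes z: "z \<noteq> x" "norm (z - x) < r" and y: "norm (y - x) \<le> r"
  shows "norm (z - y) \<le> norm (z - x) / r * norm (inversion x r z - y)"
proof -
  define t where "t = norm (z - x)"
  have t: "0 < t" "t < r" using z by (auto simp: t_def)
  have ni: "norm (inversion x r z - x) = r\<^sup>2 / t" using z by (simp add: norm_inversion_diff t_def)
  have "r \<le> r\<^sup>2 / t" using t by (simp add: field_simps power2_eq_square)
  then have "norm (inversion x r z - x) * norm (y - inversion x r (inversion x r z)) \<le> r * norm (y - inversion x r z)"
    using t ni z y by (intro norm_diff_inversion_outer inversion_ne) auto
  then have "r\<^sup>2 / t * norm (z - y) \<le> r * norm (inversion x r z - y)"
    using z t by (simp add: inversion_inversion ni norm_minus_commute[of y])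
  then show ?thesis
    using t by (simp add: t_def[symmetric] field_simps power2_eq_square)
qed

lemma positive_lower_bound_cball:
  fixes u :: "'a::heine_borel \<Rightarrow> real"
  assumes "continuous_on UNIV u" "\<And>y. 0 < u y" "0 \<le> R"
  obtains m where "0 < m" "\<And>y. y \<in> cball x R \<Longrightarrow> m \<le> u y"
proof -
  obtain p where "\<forall>y\<in>cball x R. u p \<le> u y"
    using continuous_attains_inf[of "cball x R" u] assms by (auto intro: continuous_on_subset)
  then show ?thesis using that[of "u p"] assms(2) by blast
qed

lemma power_eq_powr: "0 < x \<Longrightarrow> x ^ (2 * n) = x powr (2 * real n)" for x :: real
  using powr_realpow[of x "2 * n"] by simp

lemma kelvin_inversion:
  fixes x z :: "real^'n"
  assumes "z \<noteq> x" "0 < r"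
  shows "kelvin \<alpha> u x r (inversion x r z) = (norm (z - x) / r) powr (real CARD('n) - \<alpha>) * u z"
    "u (inversion x r z) = (norm (z - x) / r) powr (real CARD('n) - \<alpha>) * kelvin \<alpha> u x r z"
proof -
  have nz: "norm (z - x) > 0" using assms by simp
  have "r / (r\<^sup>2 / norm (z - x)) = norm (z - x) / r"
    using assms by (simp add: power2_eq_square)
  then show "kelvin \<alpha> u x r (inversion x r z) = (norm (z - x) / r) powr (real CARD('n) - \<alpha>) * u z"
    using assms by (simp add: kelvin_def inversion_inversion norm_inversion_diff)
  have "(norm (z - x) / r) powr (real CARD('n) - \<alpha>) * (r / norm (z - x)) powr (real CARD('n) - \<alpha>) = 1"
    using assms nz by (simp add: powr_mult[symmetric])
  then show "u (inversion x r z) = (norm (z - x) / r) powr (real CARD('n) - \<alpha>) * kelvin \<alpha> u x r z"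
    by (simp add: kelvin_def mult.assoc[symmetric])
qed

text \<open>Inverting twice is the identity, so the two terms of \<open>omega\<close> exchange their
  roles. An exterior integral of \<open>omega\<close> thereby becomes an integral over the ball with
  the sign reversed.\<close>

lemma omega_inversion:
  fixes x :: "real^'n"
  assumes "z \<noteq> x" "0 < r"
  shows "omega \<alpha> u x r (inversion x r z) = - ((norm (z - x) / r) powr (real CARD('n) - \<alpha>) * omega \<alpha> u x r z)"
  using kelvin_inversion(1)[OF assms, of \<alpha> u] kelvin_inversion(2)[OF assms, of u \<alpha>]
  by (simp add: omega_def right_diff_distrib)

lemma borel_measurable_omega:
  assumes [measurable]: "u \<in> borel_measurable borel"
  shows "omega \<alpha> u x r \<in> borel_measurable borel"
  unfolding omega_def kelvin_def by measurable

text \<open>For small \<open>t\<close> the function \<open>t \<mapsto> t powr ((n - \<alpha>) / 2) * u (x + t \<theta>)\<close> is increasing, and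
  \<open>\<omega> \<ge> 0\<close> at \<open>x + s \<theta>\<close> compares its values at \<open>s\<close> and \<open>r\<^sup>2 / s\<close>; if \<open>r\<^sup>2 / s\<close> is not small, the lower bound on
  \<open>u\<close> takes over.\<close>

lemma omega_nonneg_small_radius:
  fixes u :: "real^'n \<Rightarrow> real" and x :: "real^'n"
  assumes \<alpha>: "\<alpha> < real CARD('n)" and pos: "\<And>y. 0 < u y"
    and der: "\<And>y. (u has_derivative (\<lambda>h. G y \<bullet> h)) (at y)" and G: "continuous_on UNIV G"
    and c: "0 < c" "\<And>y. 2 \<le> norm (y - x) \<Longrightarrow> c * norm (y - x) powr (\<alpha> - real CARD('n)) \<le> u y"
  shows "\<exists>\<delta>>0. \<forall>r. 0 < r \<and> r \<le> \<delta> \<longrightarrow> (\<forall>y \<in> ball x r - {x}. 0 \<le> omega \<alpha> u x r y)"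
proof -
  \<comment> \<open>Half the exponent of the Kelvin factor: since
    \<open>(r / s)\<^sup>2 = t / s\<close>, that factor equals \<open>(t / s) powr a\<close>, which
    splits evenly between a point and its inverse.\<close>
  define a where "a = (real CARD('n) - \<alpha>) / 2"
  have a: "0 < a" "real CARD('n) - \<alpha> = 2 * a" "\<alpha> - real CARD('n) = - (2 * a)"
  proof -
    have "2 * a = real CARD('n) - \<alpha>" by (simp add: a_def)
    then show "0 < a" "real CARD('n) - \<alpha> = 2 * a" "\<alpha> - real CARD('n) = - (2 * a)"
      using \<alpha> by linarith+
  qed
  have cont: "continuous_on S u" for S
    by (rule has_derivative_continuous_on) (rule has_derivative_at_withinI[OF der])
  obtain m where m: "0 < m" "\<And>y. y \<in> cball x 2 \<Longrightarrow> m \<le> u y"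
    using positive_lower_bound_cball[OF cont pos, of 2 x] by auto
  obtain U where U: "\<And>y. y \<in> cball x 2 \<Longrightarrow> u y \<le> U"
  proof -
    obtain p where "\<forall>y\<in>cball x 2. u y \<le> u p"
      using continuous_attains_sup[OF compact_cball _ cont, of x 2] by auto
    then show ?thesis using that[of "u p"] by blast
  qed
  have Upos: "0 < U" using U[of x] pos[of x] by simp
  have "compact (G ` cball x 2)"
    using G by (intro compact_continuous_image) (auto intro: continuous_on_subset)
  then obtain B where B: "0 < B" "\<And>y. y \<in> cball x 2 \<Longrightarrow> norm (G y) \<le> B"
    using that compact_imp_bounded[of "G ` cball x 2"] by (auto simp: bounded_pos)
  \<comment> \<open>For \<open>v \<le> t0\<close> the derivative of
    \<open>v powr a * u (x + v *\<^sub>R \<theta>)\<close> has the sign of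
    \<open>a * u p + v * (G p \<bullet> \<theta>)\<close>, which is at least
    \<open>a * m - t0 * B\<close>.\<close>
  define t0 where "t0 = min 1 (a * m / B)"
  have t0: "0 < t0" "t0 \<le> 1" "t0 * B \<le> a * m"
    using a m B by (auto simp: t0_def min_def field_simps)
  \<comment> \<open>One constant for all points at distance at least \<open>t0\<close>: between
    \<open>t0\<close> and 2 the lower bound \<open>m\<close> of \<open>u\<close> takes the place of
    the assumed decay bound.\<close>
  define c' where "c' = min c (m * t0 powr (2 * a))"
  have c': "0 < c'" using c m t0 by (simp add: c'_def)
  have lower: "c' * norm (y - x) powr (- (2 * a)) \<le> u y" if "t0 \<le> norm (y - x)" for y
  proof (cases "2 \<le> norm (y - x)")
    case True
    have "c' * norm (y - x) powr (- (2 * a)) \<le> c * norm (y - x) powr (- (2 * a))"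
      by (intro mult_right_mono) (auto simp: c'_def)
    then show ?thesis using c(2)[OF True] a by simp
  next
    case False
    then have "m \<le> u y" by (intro m) (auto simp: dist_norm norm_minus_commute)
    have "norm (y - x) powr (- (2 * a)) \<le> t0 powr (- (2 * a))"
      using that t0 a by (intro powr_mono2') auto
    then have "c' * norm (y - x) powr (- (2 * a)) \<le> (m * t0 powr (2 * a)) * t0 powr (- (2 * a))"
      using c' by (intro mult_mono) (auto simp: c'_def)
    also have "\<dots> = m" using t0 by (simp add: powr_minus)
    finally show ?thesis using \<open>m \<le> u y\<close> by simp
  qed
  \<comment> \<open>For such radii \<open>c' * r powr (- (2 * a))\<close>, a lower bound of the
    Kelvin transform at points whose inverse is not close to \<open>x\<close>, is at least the upper
    bound \<open>U\<close> of \<open>u\<close>.\<close>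
  define \<delta> where "\<delta> = min t0 ((c' / U) powr (1 / (2 * a)))"
  have \<delta>: "0 < \<delta>" "\<delta> \<le> t0" using t0 c' Upos by (auto simp: \<delta>_def)
  have \<delta>U: "U \<le> c' * r powr (- (2 * a))" if "0 < r" "r \<le> \<delta>" for r
  proof -
    have "r powr (2 * a) \<le> ((c' / U) powr (1 / (2 * a))) powr (2 * a)"
      using that a by (intro powr_mono2) (auto simp: \<delta>_def)
    also have "\<dots> = c' / U"
      using a c' Upos by (simp add: powr_powr)
    finally show ?thesis
      using that Upos by (simp add: powr_minus field_simps)
  qed
  have "0 \<le> omega \<alpha> u x r y" if r: "0 < r" "r \<le> \<delta>" and y: "y \<in> ball x r - {x}" for r y
  proof -
    define s where "s = norm (y - x)"
    define t where "t = r\<^sup>2 / s"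
    define \<theta> where "\<theta> = (1 / s) *\<^sub>R (y - x)"
    have s: "0 < s" "s < r" using y by (auto simp: s_def dist_norm norm_minus_commute)
    have t: "r < t" "s < t"
      using s r by (auto simp: t_def field_simps power2_eq_square intro!: mult_strict_mono)
    have th: "norm \<theta> = 1" using s by (simp add: \<theta>_def s_def)
    have ye: "y = x + s *\<^sub>R \<theta>" using s by (simp add: \<theta>_def)
    have ie: "inversion x r y = x + t *\<^sub>R \<theta>"
      using s by (simp add: inversion_def \<theta>_def t_def s_def[symmetric] power2_eq_square)
    have "(r / s)\<^sup>2 = t / s" using s by (simp add: t_def power2_eq_square)
    moreover have "(r / s) powr (2 * a) = ((r / s)\<^sup>2) powr a"
      using s r by (simp add: powr_powr[symmetric])
    ultimately have k: "kelvin \<alpha> u x r y = (t / s) powr a * u (x + t *\<^sub>R \<theta>)"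
      by (simp add: kelvin_def a(2) ie s_def[symmetric])
    have "u y \<le> kelvin \<alpha> u x r y"
    proof (cases "t \<le> t0")
      case True
      define \<phi> where "\<phi> v = v powr a * u (x + v *\<^sub>R \<theta>)" for v
      have "\<phi> s \<le> \<phi> t"
      proof (rule DERIV_nonneg_imp_nondecreasing[of s t])
        fix v assume v: "s \<le> v" "v \<le> t"
        have v0: "0 < v" "v \<le> t0" using v s True by auto
        define p where "p = x + v *\<^sub>R \<theta>"
        have p: "p \<in> cball x 2" using v0 t0 th by (simp add: p_def dist_norm)
        have "((\<lambda>v. x + v *\<^sub>R \<theta>) has_vector_derivative \<theta>) (at v)"
          by (auto intro!: derivative_eq_intros simp: has_vector_derivative_def)
        then have "((\<lambda>v. u (x + v *\<^sub>R \<theta>)) has_real_derivative G p \<bullet> \<theta>) (at v)"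
          using vector_derivative_diff_chain_within[of "\<lambda>v. x + v *\<^sub>R \<theta>" \<theta> v UNIV u "\<lambda>h. G p \<bullet> h"] der[of p]
          by (simp add: p_def o_def has_real_derivative_iff_has_vector_derivative has_derivative_at_withinI)
        then have D: "(\<phi> has_real_derivative (a * v powr (a - 1)) * u p + v powr a * (G p \<bullet> \<theta>)) (at v)"
          unfolding \<phi>_def using v0 by (auto intro!: derivative_eq_intros simp: p_def mult_ac)
        have "\<bar>G p \<bullet> \<theta>\<bar> \<le> B"
          using Cauchy_Schwarz_ineq2[of "G p" \<theta>] th B(2)[OF p] by simp
        then have "v * \<bar>G p \<bullet> \<theta>\<bar> \<le> t0 * B"
          using v0 B by (intro mult_mono) auto
        moreover have "a * m \<le> a * u p" using m(2)[OF p] a by simp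
        ultimately have "0 \<le> a * u p + v * (G p \<bullet> \<theta>)"
          using t0(3) v0 abs_ge_minus_self[of "v * (G p \<bullet> \<theta>)"] by (simp add: abs_mult)
        then have "0 \<le> v powr (a - 1) * (a * u p + v * (G p \<bullet> \<theta>))" by simp
        also have "\<dots> = (a * v powr (a - 1)) * u p + v powr a * (G p \<bullet> \<theta>)"
          using v0 by (simp add: powr_diff algebra_simps)
        finally show "\<exists>d. (\<phi> has_real_derivative d) (at v) \<and> 0 \<le> d"
          using D by blast
      qed (use t in simp)
      then have "u (x + s *\<^sub>R \<theta>) \<le> (t powr a / s powr a) * u (x + t *\<^sub>R \<theta>)"
        using s by (simp add: \<phi>_def field_simps)
      then show ?thesis
        using s t by (simp add: k ye[symmetric] powr_divide)
    next
      case False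
      have "c' * t powr (- (2 * a)) \<le> u (x + t *\<^sub>R \<theta>)"
        using lower[of "x + t *\<^sub>R \<theta>"] False th s t by simp
      then have "(t / s) powr a * (c' * t powr (- (2 * a))) \<le> kelvin \<alpha> u x r y"
        unfolding k by (intro mult_left_mono) auto
      \<comment> \<open>By \<open>s * t = r\<^sup>2\<close> the powers of \<open>s\<close> and
        \<open>t\<close> combine to a power of \<open>r\<close> alone.\<close>
      moreover have "(t / s) powr a * (c' * t powr (- (2 * a))) = c' * r powr (- (2 * a))"
      proof -
        have "r powr (- (2 * a)) = (r\<^sup>2) powr (- a)"
          using r powr_powr[of r 2 "- a"] by simp
        also have "r\<^sup>2 = s * t" using s by (simp add: t_def)
        also have "(s * t) powr (- a) = s powr (- a) * t powr (- a)"
          using s t by (intro powr_mult)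
        also have "t powr (- a) = t powr a * t powr (- (2 * a))"
          by (simp add: powr_add[symmetric])
        finally have 1: "r powr (- (2 * a)) = s powr (- a) * (t powr a * t powr (- (2 * a)))" .
        have 2: "(t / s) powr a = t powr a * s powr (- a)"
          using s t by (simp add: powr_divide powr_minus_divide)
        show ?thesis
          unfolding 1 2 by (simp only: mult_ac)
      qed
      moreover have "u y \<le> U"
      proof (rule U)
        have "dist y x \<le> 2" using s r \<delta> t0 by (simp add: dist_norm flip: s_def)
        then show "y \<in> cball x 2" by (simp add: dist_commute)
      qed
      ultimately show ?thesis using \<delta>U[OF r] by simp
    qed
    then show ?thesis by (simp add: omega_def)
  qed
  then show ?thesis using \<delta>(1) by blast
qed

text \<open>A distance function is continuous, whatever the set. The hypothesis keeps
  \<open>Bad\<close> away from each point \<open>(r, 0)\<close> with \<open>r > 0\<close>, which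
  makes the distance positive; and a bad pair \<open>(r, l)\<close> is at distance \<open>l\<close>
  from \<open>(r, 0)\<close>, so \<open>l\<close> exceeds half the distance to the set.\<close>

lemma continuous_threshold:
  fixes Bad :: "(real \<times> real) set"
  assumes unif: "\<And>a b. 0 < a \<Longrightarrow> a \<le> b \<Longrightarrow>
      \<exists>\<eta>>0. \<forall>r l. a \<le> r \<and> r \<le> b \<and> (r, l) \<in> Bad \<longrightarrow> \<eta> \<le> l"
  shows "\<exists>l0. continuous_on {0<..} l0 \<and> (\<forall>r>0. 0 < l0 r) \<and>
      (\<forall>r l. 0 < r \<and> 0 < l \<and> l \<le> l0 r \<longrightarrow> (r, l) \<notin> Bad)"
proof (intro exI conjI allI impI)
  \<comment> \<open>The extra point keeps the set nonempty, since \<open>infdist\<close> to the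
    empty set is 0; being at distance \<open>r\<close> from \<open>(r, 0)\<close> it does no
    harm.\<close>
  define A where "A = insert (0, 0) Bad"
  define l0 where "l0 r = infdist (r, 0) A / 2" for r :: real
  have pos: "0 < l0 r" if r: "0 < r" for r
  proof -
    obtain \<eta> where \<eta>: "0 < \<eta>" "\<And>r' l. r / 2 \<le> r' \<Longrightarrow> r' \<le> 2 * r \<Longrightarrow> (r', l) \<in> Bad \<Longrightarrow> \<eta> \<le> l"
      using unif[of "r / 2" "2 * r"] r by auto
    have "min (r / 2) \<eta> \<le> dist (r, 0) p" if "p \<in> A" for p
    proof (cases p)
      case (Pair r' l)
      have d: "\<bar>r - r'\<bar> \<le> dist (r, 0) p" "\<bar>l\<bar> \<le> dist (r, 0) p"
        using dist_fst_le[of "(r, 0)" p] dist_snd_le[of "(r, 0)" p] by (auto simp: Pair dist_real_def)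
      show ?thesis
      proof (cases "\<bar>r - r'\<bar> < r / 2")
        case True
        then have "(r', l) \<in> Bad" using that r by (auto simp: A_def Pair)
        then have "\<eta> \<le> l" using True by (intro \<eta>(2)[of r']) linarith+
        then show ?thesis using d by linarith
      next
        case False
        then show ?thesis using d by linarith
      qed
    qed
    then have "min (r / 2) \<eta> \<le> infdist (r, 0) A"
      using cINF_greatest[of A "min (r / 2) \<eta>" "dist (r, 0)"] infdist_notempty[of A "(r, 0)"]
      by (simp add: A_def)
    then show ?thesis using r \<eta> by (simp add: l0_def)
  qed
  show "continuous_on {0<..} l0"
    unfolding l0_def by (intro continuous_intros) auto
  show "0 < l0 r" if "0 < r" for r using pos[OF that] .
  show "(r, l) \<notin> Bad" if "0 < r \<and> 0 < l \<and> l \<le> l0 r" for r l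
  proof
    assume "(r, l) \<in> Bad"
    then have "infdist (r, 0) A \<le> dist (r, 0) (r, l)"
      by (intro infdist_le) (simp add: A_def)
    also have "\<dots> = l" using that by (simp add: dist_Pair_Pair dist_real_def)
    finally show False using that by (simp add: l0_def)
  qed
qed

section \<open>Riesz potentials as Borel integrals\<close>

lemma potential_lborel:
  fixes u :: "real^'n \<Rightarrow> real"
  assumes [measurable]: "u \<in> borel_measurable borel"
  shows "potential \<alpha> u y = (LINT z|lborel.
     u z powr ((real CARD('n) + \<alpha>) / (real CARD('n) - \<alpha>)) * norm (z - y) powr (- (real CARD('n) - \<alpha>)))"
proof -
  have "potential \<alpha> u y = (LINT z|lborel.
     u z powr ((real CARD('n) + \<alpha>) / (real CARD('n) - \<alpha>)) / norm (y - z) powr (real CARD('n) - \<alpha>))"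
    unfolding potential_def by (rule integral_completion) measurable
  also have "\<dots> = (LINT z|lborel.
     u z powr ((real CARD('n) + \<alpha>) / (real CARD('n) - \<alpha>)) * norm (z - y) powr (- (real CARD('n) - \<alpha>)))"
    by (simp only: powr_minus divide_inverse norm_minus_commute[of y])
  finally show ?thesis .
qed

lemma integrable_potential_lborel:
  fixes u :: "real^'n \<Rightarrow> real"
  assumes [measurable]: "u \<in> borel_measurable borel"
    and "integrable lebesgue (\<lambda>z. u z powr p / norm (y - z) powr q)"
  shows "integrable lborel (\<lambda>z. u z powr p * norm (z - y) powr (- q))"
proof -
  have "integrable lborel (\<lambda>z. u z powr p / norm (y - z) powr q)"
    using assms(2) by (subst (asm) integrable_completion) measurable
  then show ?thesis
    by (simp add: powr_minus divide_inverse norm_minus_commute[of y])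
qed

text \<open>The exceptional point \<open>y\<close> is there for kernels
  \<open>norm (z - y) powr (- q)\<close>, whose value at \<open>z = y\<close> is 0.\<close>

lemma integral_lborel_pos:
  fixes f :: "'a::euclidean_space \<Rightarrow> real"
  assumes f: "integrable lborel f" and pos: "\<And>z. z \<noteq> y \<Longrightarrow> 0 < f z" and "0 \<le> f y"
  shows "0 < integral\<^sup>L lborel f"
proof -
  have nn: "0 \<le> f z" for z using pos[of z] assms(3) by (cases "z = y") auto
  have "integral\<^sup>L lborel f \<noteq> 0"
  proof
    assume "integral\<^sup>L lborel f = 0"
    then have "AE z in lborel. f z = 0"
      using integral_nonneg_eq_0_iff_AE[OF f] nn by simp
    moreover have "AE z in lborel. z \<noteq> y"
      by (rule AE_lborel_singleton)
    ultimately have "AE z in (lborel :: 'a measure). False"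
      by eventually_elim (use pos in force)
    then show False
      using AE_iff_null[of "lborel :: 'a measure" "\<lambda>_. False"] null_setsD1[of UNIV "lborel :: 'a measure"] by simp
  qed
  moreover have "0 \<le> integral\<^sup>L lborel f" using nn by simp
  ultimately show ?thesis by simp
qed

subsection \<open>The fractional Laplacian\<close>

lemma measure_ball:
  "0 \<le> t \<Longrightarrow> measure lborel (ball (y::real^'n) t) = t ^ CARD('n) * measure lborel (ball (0::real^'n) 1)"
  using content_ball_conv_unit_ball[of t y] by simp

lemma measure_unit_ball_pos: "0 < measure lborel (ball (0::real^'n) 1)"
  by (rule content_ball_pos) simp

lemma finite_emeasure_ball: "emeasure lborel (ball (y::'a::euclidean_space) t) < \<infinity>"
  using emeasure_bounded_finite[of "ball y t"] by simp

text \<open>Inversion in the sphere through \<open>y\<close> maps the exterior part of the principal value of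
  \<open>norm (z - x) powr (\<alpha> - n)\<close> at \<open>y\<close> to minus its interior part. The two cancel up to a shell where the
  truncations do not match, which contributes \<open>O(\<epsilon> powr (2 - \<alpha>))\<close>; the constant \<open>K\<close> pays for removing
  the singularity at \<open>x\<close>.\<close>

lemma truncated_radial_barrier_le:
  fixes x y :: "real^'n" and \<alpha> K :: real
  defines "\<beta> \<equiv> real CARD('n) - \<alpha>" and "s \<equiv> real CARD('n) + \<alpha>"
  defines "V \<equiv> measure lborel (ball (0::real^'n) 1)"
  assumes \<alpha>: "0 < \<alpha>" "\<alpha> < 2" and n2: "2 \<le> CARD('n)"
    and \<phi>: "\<And>z. \<phi> z = (if norm (z - x) < 1 then K else norm (z - x) powr (- \<beta>))"
    and K: "3 powr s * (LINT z|lborel. indicator (ball x 1) z * norm (z - x) powr (- \<beta>)) \<le> K * V" "1 \<le> K"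
    and y: "2 \<le> norm (y - x)" and \<epsilon>: "0 < \<epsilon>" "\<epsilon> \<le> 1 / 2"
  shows "truncated s \<phi> y \<epsilon> \<le> (\<beta> * 2 powr s * V * real CARD('n)) * \<epsilon> powr (2 - \<alpha>)"
proof -
  let ?n = "CARD('n)"
  define \<Phi> where "\<Phi> z = norm (z - x) powr (- \<beta>)" for z :: "real^'n"
  define \<kappa> where "\<kappa> z = norm (z - y) powr (- s)" for z :: "real^'n"
  define \<rho> where "\<rho> = norm (y - x)"
  have \<beta>: "0 < \<beta>" "\<beta> < real ?n" "2 * real ?n - s = \<beta>" and s: "real ?n < s" "s \<le> 2 * real ?n"
    using \<alpha> n2 by (auto simp: \<beta>_def s_def)
  have \<rho>: "2 \<le> \<rho>" using y by (simp add: \<rho>_def)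
  have \<kappa>0: "0 \<le> \<kappa> z" for z by (simp add: \<kappa>_def)
  have [measurable]: "\<phi> \<in> borel_measurable borel" "\<Phi> \<in> borel_measurable borel" "\<kappa> \<in> borel_measurable borel"
    unfolding \<phi>[abs_def] \<Phi>_def[abs_def] \<kappa>_def[abs_def] by measurable
  have \<Phi>1: "\<Phi> z \<le> 1" if "1 \<le> norm (z - x)" for z
    using powr_mono2'[of "- \<beta>" 1 "norm (z - x)"] that \<beta> by (simp add: \<Phi>_def)
  have \<phi>y: "\<phi> y = \<Phi> y" using \<rho> by (simp add: \<phi> \<Phi>_def \<rho>_def)
  have \<phi>b: "0 \<le> \<phi> z" "\<phi> z \<le> K" for z
    using \<Phi>1[of z] K by (auto simp: \<phi> \<Phi>_def)
  define E where "E = {z. \<epsilon> \<le> norm (z - y)}"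
  have [measurable]: "E \<in> sets borel" unfolding E_def by measurable
  have \<kappa>E: "integrable lborel (\<lambda>z. indicator E z * \<kappa> z)"
    unfolding E_def \<kappa>_def using integrable_norm_powr_outside[OF s \<epsilon>(1)] .
  \<comment> \<open>\<open>Fo\<close> will be folded into the ball of radius \<open>\<rho>\<close>
    about \<open>x\<close>, \<open>Fi\<close> stays. On the sphere between them, which contains
    \<open>y\<close>, the factor \<open>\<phi> y - \<phi> z\<close> is 0.\<close>
  define Fo where "Fo z = indicator {z. \<rho> < norm (z - x)} z * (indicator E z * ((\<Phi> y - \<Phi> z) * \<kappa> z))" for z
  define Fi where "Fi z = indicator {z. norm (z - x) < \<rho>} z * (indicator E z * ((\<phi> y - \<phi> z) * \<kappa> z))" for z
  have [measurable]: "Fo \<in> borel_measurable borel" "Fi \<in> borel_measurable borel"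
    unfolding Fo_def[abs_def] Fi_def[abs_def] by measurable
  have split: "indicator E z * ((\<phi> y - \<phi> z) * \<kappa> z) = Fo z + Fi z" for z
    using \<rho> by (cases "norm (z - x)" \<rho> rule: linorder_cases)
      (auto simp: Fo_def Fi_def \<phi>y, auto simp: \<phi> \<Phi>_def \<rho>_def)
  have bound: "\<bar>indicator E z * ((\<phi> y - \<phi> z) * \<kappa> z)\<bar> \<le> K * (indicator E z * \<kappa> z)" for z
  proof -
    have "\<bar>\<phi> y - \<phi> z\<bar> \<le> K" using \<phi>b[of y] \<phi>b[of z] by linarith
    then show ?thesis using \<kappa>0[of z] by (simp add: abs_mult indicator_def mult_right_mono)
  qed
  have F: "integrable lborel (\<lambda>z. Fo z + Fi z)"
  proof (rule Bochner_Integration.integrable_bound[OF integrable_mult_right[OF \<kappa>E, of K]])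
    show "AE z in lborel. norm (Fo z + Fi z) \<le> norm (K * (indicator E z * \<kappa> z))"
      unfolding split[symmetric] using bound K \<kappa>0 by (intro AE_I2) (simp add: abs_mult)
  qed simp
  have Fo: "integrable lborel Fo" and Fi: "integrable lborel Fi"
    by (rule Bochner_Integration.integrable_bound[OF F]; auto simp: Fo_def Fi_def indicator_def)+
  define R where "R z = (\<rho> / norm (z - x)) ^ (2 * ?n) * Fo (inversion x \<rho> z)" for z
  have R: "integrable lborel R" and intR: "integral\<^sup>L lborel Fo = integral\<^sup>L lborel R"
    unfolding R_def[abs_def]
    using integrable_inversion_iff[of \<rho> Fo x] integral_inversion[of \<rho> Fo x] Fo \<rho> by auto
  \<comment> \<open>The identity 2n - s = \<beta> makes the folded exterior the exact negative of
    the interior integrand for \<open>\<Phi>\<close>. Only the truncation differs: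
    \<open>\<epsilon> \<le> norm (z - y)\<close> has turned into
    \<open>\<epsilon> * norm (z - x) \<le> \<rho> * norm (z - y)\<close>.\<close>
  have R_eq: "R z = indicator {z. norm (z - x) < \<rho> \<and> \<epsilon> * norm (z - x) \<le> \<rho> * norm (z - y)} z * ((\<Phi> z - \<Phi> y) * \<kappa> z)"
    if z: "z \<noteq> x" for z
  proof -
    define t where "t = norm (z - x)"
    define d where "d = norm (z - y)"
    have t: "0 < t" using z by (simp add: t_def)
    have yx: "y \<noteq> x" using \<rho> by (auto simp: \<rho>_def)
    have i1: "norm (inversion x \<rho> z - x) = \<rho>\<^sup>2 / t"
      using z by (simp add: norm_inversion_diff t_def)
    have "inversion x \<rho> y = y" using \<rho> by (intro inversion_sphere) (auto simp: \<rho>_def)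
    then have i2: "norm (inversion x \<rho> z - y) = \<rho> * d / t"
      using norm_inversion_inversion_diff[OF z yx, of \<rho>] \<rho>
      by (simp add: t_def d_def \<rho>_def[symmetric] power2_eq_square)
    have c1: "\<rho> < \<rho>\<^sup>2 / t \<longleftrightarrow> t < \<rho>"
      using t \<rho> by (simp add: field_simps power2_eq_square)
    have c2: "\<epsilon> \<le> \<rho> * d / t \<longleftrightarrow> \<epsilon> * t \<le> \<rho> * d"
      using t by (simp add: field_simps)
    have k: "(\<rho> / t) ^ (2 * ?n) * ((\<rho> powr (- \<beta>) - (\<rho>\<^sup>2 / t) powr (- \<beta>)) * (\<rho> * d / t) powr (- s))
       = (t powr (- \<beta>) - \<rho> powr (- \<beta>)) * d powr (- s)"
    proof -
      have e1: "(\<rho> * d / t) powr (- s) = (\<rho> / t) powr (- s) * d powr (- s)"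
        using powr_mult[of "\<rho> / t" d "- s"] t \<rho> by (simp add: d_def)
      have e2: "(\<rho> / t) ^ (2 * ?n) = (\<rho> / t) powr (2 * real ?n)"
        using t \<rho> by (intro power_eq_powr) simp
      have e3: "(\<rho> / t) powr (2 * real ?n) * (\<rho> / t) powr (- s) = (\<rho> / t) powr \<beta>"
        using \<beta> by (simp add: powr_add[symmetric])
      have e4: "(\<rho> / t) powr \<beta> * \<rho> powr (- \<beta>) = t powr (- \<beta>)"
        using t \<rho> by (simp add: powr_divide powr_minus field_simps)
      have e5: "(\<rho> / t) powr \<beta> * (\<rho>\<^sup>2 / t) powr (- \<beta>) = \<rho> powr (- \<beta>)"
      proof -
        have "\<rho>\<^sup>2 / t = (\<rho> / t) * \<rho>" by (simp add: power2_eq_square)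
        then have "(\<rho>\<^sup>2 / t) powr (- \<beta>) = (\<rho> / t) powr (- \<beta>) * \<rho> powr (- \<beta>)"
          using t \<rho> by (simp only: powr_mult)
        then show ?thesis using t \<rho> by (simp add: powr_minus)
      qed
      have "(\<rho> / t) ^ (2 * ?n) * ((\<rho> powr (- \<beta>) - (\<rho>\<^sup>2 / t) powr (- \<beta>)) * (\<rho> * d / t) powr (- s))
        = ((\<rho> / t) powr (2 * real ?n) * (\<rho> / t) powr (- s)) * (\<rho> powr (- \<beta>) - (\<rho>\<^sup>2 / t) powr (- \<beta>)) * d powr (- s)"
        unfolding e1 e2 by (simp only: mult_ac)
      also have "\<dots> = (t powr (- \<beta>) - \<rho> powr (- \<beta>)) * d powr (- s)"
        unfolding e3 right_diff_distrib e4 e5 ..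
      finally show ?thesis .
    qed
    show ?thesis
      unfolding R_def Fo_def \<Phi>_def \<kappa>_def E_def indicator_def mem_Collect_eq i1 i2
      using k c1 c2 by (auto simp: t_def[symmetric] d_def[symmetric] \<rho>_def[symmetric])
  qed
  \<comment> \<open>The mismatch of the truncations: \<open>norm (z - y) < \<epsilon>\<close> forces
    \<open>norm (z - x) \<ge> \<rho> - \<epsilon>\<close>, and then the folded condition gives
    \<open>norm (z - y) \<ge> \<epsilon> * (\<rho> - \<epsilon>) / \<rho>\<close>.\<close>
  define A where "A = ball y \<epsilon> - ball y (\<epsilon> * (1 - \<epsilon> / \<rho>))"
  have [measurable]: "A \<in> sets borel" by (simp add: A_def)
  \<comment> \<open>On the shell \<open>\<Phi> z - \<Phi> y\<close> is at most
    \<open>\<beta> * \<epsilon>\<close> by the mean value theorem, and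
    \<open>(\<epsilon> / 2) powr (- s)\<close> bounds the kernel because the inner radius is at
    least \<open>\<epsilon> / 2\<close>.\<close>
  define C where "C = \<beta> * \<epsilon> * (\<epsilon> / 2) powr (- s)"
  have C0: "0 \<le> C" using \<beta> \<epsilon> by (simp add: C_def)
  \<comment> \<open>In \<open>ball x 1\<close> the cancellation leaves
    \<open>(\<Phi> z - K) * \<kappa> z\<close>. There \<open>norm (z - y)\<close> lies between
    \<open>\<rho> - 1\<close> and \<open>3 * (\<rho> - 1)\<close>, by \<open>\<rho> \<ge> 2\<close>,
    so the kernel can be frozen at the cost of \<open>3 powr s\<close>, the factor in the assumption
    on \<open>K\<close>.\<close>
  have pw: "R z + Fi z \<le> C * indicator A z + indicator (ball x 1) z * ((\<rho> - 1) powr (- s) * (\<Phi> z - K * 3 powr (- s)))"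
    if z: "z \<noteq> x" for z
  proof -
    define t where "t = norm (z - x)"
    define d where "d = norm (z - y)"
    have t: "0 < t" using z by (simp add: t_def)
    have td: "\<rho> \<le> t + d" "d \<le> t + \<rho>" "t \<le> \<rho> + d"
      using norm_triangle_ineq[of "y - z" "z - x"] norm_triangle_ineq[of "z - x" "x - y"] norm_triangle_ineq[of "z - y" "y - x"]
      by (auto simp: t_def d_def \<rho>_def norm_minus_commute)
    consider "t < 1" | "1 \<le> t" "t < \<rho>" | "\<rho> \<le> t" by linarith
    then show ?thesis
    proof cases
      case 1
      then have b: "z \<in> ball x 1" by (simp add: t_def dist_norm norm_minus_commute)
      have d1: "1 \<le> d" "\<rho> - 1 \<le> d" using 1 td \<rho> by linarith+
      have "d \<le> 1 + \<rho>" using 1 td(2) by linarith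
      also have "1 + \<rho> \<le> 3 * (\<rho> - 1)" using \<rho> by (simp add: algebra_simps)
      finally have d3: "d \<le> 3 * (\<rho> - 1)" .
      have "\<epsilon> * t \<le> \<rho> * d" using \<epsilon> t d1 1 \<rho> by (intro mult_mono) auto
      then have "R z = (\<Phi> z - \<Phi> y) * \<kappa> z"
        using 1 \<rho> by (simp add: R_eq[OF z] t_def[symmetric] d_def[symmetric])
      moreover have "Fi z = (\<Phi> y - K) * \<kappa> z"
        using 1 d1 \<rho> \<epsilon> by (simp add: Fi_def \<phi>y E_def t_def[symmetric] d_def[symmetric]) (simp add: \<phi> t_def)
      ultimately have "R z + Fi z = \<Phi> z * \<kappa> z - K * \<kappa> z"
        by (simp add: algebra_simps)
      moreover have "\<Phi> z * \<kappa> z \<le> \<Phi> z * (\<rho> - 1) powr (- s)"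
        using d1 \<rho> s unfolding \<kappa>_def d_def[symmetric]
        by (intro mult_left_mono powr_mono2') (auto simp: \<Phi>_def)
      moreover have "K * (3 powr (- s) * (\<rho> - 1) powr (- s)) \<le> K * \<kappa> z"
      proof -
        have "(3 * (\<rho> - 1)) powr (- s) \<le> \<kappa> z"
          using d1 d3 \<rho> s unfolding \<kappa>_def d_def[symmetric] by (intro powr_mono2') auto
        moreover have "(3 * (\<rho> - 1)) powr (- s) = 3 powr (- s) * (\<rho> - 1) powr (- s)"
          using \<rho> by (intro powr_mult)
        ultimately show ?thesis using K by (intro mult_left_mono) simp_all
      qed
      moreover have "0 \<le> C * indicator A z" using C0 by simp
      ultimately show ?thesis using b by (simp add: algebra_simps)
    next
      case 2
      then have b: "z \<notin> ball x 1" by (simp add: t_def dist_norm norm_minus_commute)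
      have Fi': "Fi z = indicator E z * ((\<Phi> y - \<Phi> z) * \<kappa> z)"
        using 2 by (simp add: Fi_def \<phi>y t_def[symmetric]) (simp add: \<phi> \<Phi>_def t_def)
      show ?thesis
      proof (cases "\<epsilon> \<le> d")
        case True
        then have "\<epsilon> * t \<le> \<rho> * d" using 2 \<epsilon> mult_mono[of \<epsilon> d t \<rho>] by (simp add: mult.commute)
        then have "R z = (\<Phi> z - \<Phi> y) * \<kappa> z"
          using 2 by (simp add: R_eq[OF z] t_def[symmetric] d_def[symmetric])
        then have "R z + Fi z = 0"
          using True Fi' by (simp add: E_def d_def algebra_simps)
        then show ?thesis using b C0 by simp
      next
        case False
        then have Fi0: "Fi z = 0" using Fi' by (simp add: E_def d_def)
        show ?thesis
        proof (cases "\<epsilon> * t \<le> \<rho> * d")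
          case True
          have "\<epsilon> * (1 - \<epsilon> / \<rho>) = \<epsilon> * (\<rho> - \<epsilon>) / \<rho>" using \<rho> by (simp add: field_simps)
          also have "\<dots> \<le> \<epsilon> * t / \<rho>"
            using td False \<epsilon> \<rho> by (intro divide_right_mono mult_left_mono) auto
          also have "\<dots> \<le> d" using True \<rho> by (simp add: field_simps)
          finally have dl: "\<epsilon> * (1 - \<epsilon> / \<rho>) \<le> d" .
          then have "z \<in> A" using False by (simp add: A_def d_def dist_norm norm_minus_commute)
          have "\<epsilon> / \<rho> \<le> 1 / 2" using \<epsilon> \<rho> by (simp add: field_simps)
          then have "1 / 2 \<le> 1 - \<epsilon> / \<rho>" by linarith
          then have "\<epsilon> * (1 / 2) \<le> \<epsilon> * (1 - \<epsilon> / \<rho>)" using \<epsilon> by (intro mult_left_mono) auto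
          then have "\<epsilon> / 2 \<le> d" using dl by linarith
          then have k1: "\<kappa> z \<le> (\<epsilon> / 2) powr (- s)"
            unfolding \<kappa>_def d_def[symmetric] using \<epsilon> s by (intro powr_mono2') auto
          have "\<exists>\<xi>. t < \<xi> \<and> \<xi> < \<rho> \<and> \<rho> powr (- \<beta>) - t powr (- \<beta>) = (\<rho> - t) * (- \<beta> * \<xi> powr (- \<beta> - 1))"
            using 2 t by (intro MVT2) (auto intro!: derivative_eq_intros)
          then obtain \<xi> where \<xi>: "t < \<xi>" "\<rho> powr (- \<beta>) - t powr (- \<beta>) = (\<rho> - t) * (- \<beta> * \<xi> powr (- \<beta> - 1))" by blast
          have "\<xi> powr (- \<beta> - 1) \<le> 1"
            using powr_mono2'[of "- \<beta> - 1" 1 \<xi>] \<xi> 2 \<beta> by simp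
          then have "(\<rho> - t) * (\<beta> * \<xi> powr (- \<beta> - 1)) \<le> \<epsilon> * (\<beta> * 1)"
            using 2 td False \<beta> \<epsilon> by (intro mult_mono) auto
          then have k2: "\<Phi> z - \<Phi> y \<le> \<beta> * \<epsilon>"
            using \<xi>(2) by (simp add: \<Phi>_def t_def \<rho>_def mult.commute)
          have "(\<Phi> z - \<Phi> y) * \<kappa> z \<le> C"
            unfolding C_def using k1 k2 \<beta> \<epsilon> \<kappa>0 by (intro mult_mono) auto
          moreover have "R z = (\<Phi> z - \<Phi> y) * \<kappa> z"
            using 2 True by (simp add: R_eq[OF z] t_def[symmetric] d_def[symmetric])
          ultimately show ?thesis using Fi0 b \<open>z \<in> A\<close> by simp
        next
          case False
          then have "R z = 0" by (simp add: R_eq[OF z] t_def[symmetric] d_def[symmetric])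
          then show ?thesis using Fi0 b C0 by simp
        qed
      qed
    next
      case 3
      then have "z \<notin> ball x 1" using \<rho> by (simp add: t_def dist_norm norm_minus_commute)
      moreover have "R z = 0" using 3 by (simp add: R_eq[OF z] t_def[symmetric])
      moreover have "Fi z = 0" using 3 by (simp add: Fi_def t_def[symmetric])
      ultimately show ?thesis using C0 by simp
    qed
  qed
  have A_fin: "emeasure lborel A < \<infinity>"
    by (rule le_less_trans[OF emeasure_mono finite_emeasure_ball[of y \<epsilon>]]) (auto simp: A_def)
  have er: "0 \<le> 1 - \<epsilon> / \<rho>" "\<epsilon> / \<rho> \<le> \<epsilon>" using \<epsilon> \<rho> by (auto simp: field_simps)
  \<comment> \<open>By Bernoulli the shell takes up a fraction of order \<open>\<epsilon>\<close> of
    the ball, hence a volume of order \<open>\<epsilon> ^ Suc ?n\<close>; with \<open>C\<close> of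
    order \<open>\<epsilon> powr (1 - s)\<close> the product has exponent
    \<open>2 - \<alpha>\<close>.\<close>
  have mA: "measure lborel A \<le> V * real ?n * \<epsilon> ^ Suc ?n"
  proof -
    have "measure lborel A = measure lborel (ball y \<epsilon>) - measure lborel (ball y (\<epsilon> * (1 - \<epsilon> / \<rho>)))"
      unfolding A_def using finite_emeasure_ball[of y \<epsilon>] er \<epsilon> \<rho>
      by (intro measure_Diff) (auto intro!: mult_left_le subset_ball simp: less_top)
    also have "\<dots> = \<epsilon> ^ ?n * V * (1 - (1 - \<epsilon> / \<rho>) ^ ?n)"
    proof -
      define q where "q = 1 - \<epsilon> / \<rho>"
      have "measure lborel (ball y (\<epsilon> * q)) = (\<epsilon> * q) ^ ?n * V"
        using er \<epsilon> unfolding V_def by (intro measure_ball) (simp add: q_def)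
      moreover have "measure lborel (ball y \<epsilon>) = \<epsilon> ^ ?n * V"
        using \<epsilon> unfolding V_def by (intro measure_ball) simp
      ultimately show ?thesis
        unfolding q_def[symmetric] by (simp add: power_mult_distrib) (simp add: algebra_simps)
    qed
    also have "\<dots> \<le> \<epsilon> ^ ?n * V * (real ?n * \<epsilon>)"
    proof (rule mult_left_mono)
      have "1 + real ?n * (- (\<epsilon> / \<rho>)) \<le> (1 + - (\<epsilon> / \<rho>)) ^ ?n"
        using er by (intro Bernoulli_inequality) auto
      moreover have "real ?n * (\<epsilon> / \<rho>) \<le> real ?n * \<epsilon>" using er by (intro mult_left_mono) auto
      ultimately show "1 - (1 - \<epsilon> / \<rho>) ^ ?n \<le> real ?n * \<epsilon>" by simp
    qed (use \<epsilon> in \<open>auto simp: V_def\<close>)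
    finally show ?thesis by (simp add: mult_ac)
  qed
  have \<Phi>i: "integrable lborel (\<lambda>z. indicator (ball x 1) z * \<Phi> z)"
    unfolding \<Phi>_def using \<beta> by (intro integrable_norm_powr_ball) auto
  have B1: "integrable lborel (indicator (ball x 1) :: _ \<Rightarrow> real)"
    using finite_emeasure_ball[of x 1] by (intro integrable_real_indicator) auto
  have rhs_eq: "indicator (ball x 1) z * ((\<rho> - 1) powr (- s) * (\<Phi> z - K * 3 powr (- s)))
     = (\<rho> - 1) powr (- s) * (indicator (ball x 1) z * \<Phi> z - K * 3 powr (- s) * indicator (ball x 1) z)" for z
    by (simp add: algebra_simps)
  have ir: "integrable lborel (\<lambda>z. indicator (ball x 1) z * ((\<rho> - 1) powr (- s) * (\<Phi> z - K * 3 powr (- s))))"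
    unfolding rhs_eq using \<Phi>i B1 by (intro integrable_mult_right Bochner_Integration.integrable_diff) auto
  have iA: "integrable lborel (\<lambda>z. C * indicator A z)"
    using A_fin by (intro integrable_mult_right integrable_real_indicator) auto
  have "truncated s \<phi> y \<epsilon> = (LINT z|lborel. Fo z + Fi z)"
    unfolding truncated_def split[symmetric] E_def \<kappa>_def ..
  also have "\<dots> = (LINT z|lborel. R z + Fi z)"
    using Fo Fi R intR by simp
  also have "\<dots> \<le> (LINT z|lborel. C * indicator A z + indicator (ball x 1) z * ((\<rho> - 1) powr (- s) * (\<Phi> z - K * 3 powr (- s))))"
  proof (rule integral_mono_AE)
    show "AE z in lborel. R z + Fi z \<le> C * indicator A z + indicator (ball x 1) z * ((\<rho> - 1) powr (- s) * (\<Phi> z - K * 3 powr (- s)))"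
      using AE_lborel_singleton[of x] by eventually_elim (rule pw)
  qed (use R Fi iA ir in auto)
  also have "\<dots> = C * measure lborel A + (\<rho> - 1) powr (- s) * ((LINT z|lborel. indicator (ball x 1) z * \<Phi> z) - K * 3 powr (- s) * V)"
  proof -
    have "measure lborel (ball x 1) = V"
      using measure_ball[of 1 x] by (simp add: V_def)
    then have "(LINT z|lborel. indicator (ball x 1) z * \<Phi> z - K * 3 powr (- s) * indicator (ball x 1) z)
        = (LINT z|lborel. indicator (ball x 1) z * \<Phi> z) - K * 3 powr (- s) * V"
      using \<Phi>i B1 by simp
    then show ?thesis
      using iA ir unfolding rhs_eq by simp
  qed
  also have "\<dots> \<le> C * measure lborel A"
  proof -
    have "(LINT z|lborel. indicator (ball x 1) z * \<Phi> z) \<le> K * 3 powr (- s) * V"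
      using K(1) by (simp add: \<Phi>_def powr_minus field_simps)
    then show ?thesis by (simp add: mult_nonneg_nonpos)
  qed
  also have "\<dots> \<le> C * (V * real ?n * \<epsilon> ^ Suc ?n)"
    using mA C0 by (rule mult_left_mono)
  also have "\<dots> = (\<beta> * 2 powr s * V * real ?n) * \<epsilon> powr (2 - \<alpha>)"
  proof -
    have "(\<epsilon> / 2) powr (- s) = \<epsilon> powr (- s) * 2 powr s"
      using \<epsilon> by (simp add: powr_divide powr_minus field_simps)
    moreover have "\<epsilon> * \<epsilon> powr (- s) * \<epsilon> ^ Suc ?n = \<epsilon> powr (2 - \<alpha>)"
    proof -
      have "\<epsilon> * \<epsilon> powr (- s) * \<epsilon> ^ Suc ?n = \<epsilon> powr 1 * \<epsilon> powr (- s) * \<epsilon> powr (real (Suc ?n))"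
        using \<epsilon> by (simp only: powr_realpow powr_one)
      also have "\<dots> = \<epsilon> powr (2 - \<alpha>)"
        unfolding powr_add[symmetric] by (simp add: s_def)
      finally show ?thesis .
    qed
    ultimately show ?thesis by (simp add: C_def mult_ac)
  qed
  finally show ?thesis .
qed

text \<open>The barrier tends to 0 at infinity and \<open>u\<close> is positive, so \<open>f\<close>
  does not go below \<open>f y\<close> far out, and it suffices to minimise over a compact
  shell.\<close>

lemma comparison_negative_min:
  fixes u :: "real^'n \<Rightarrow> real" and x y :: "real^'n"
  assumes cont: "continuous_on UNIV u" and pos: "\<And>z. 0 < u z" and "0 < \<beta>" "0 < c"
    and y: "2 \<le> norm (y - x)" and below: "\<not> c * norm (y - x) powr (- \<beta>) \<le> u y"
  defines "f \<equiv> \<lambda>z. u z - c * norm (z - x) powr (- \<beta>)"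
  obtains y1 where "2 \<le> norm (y1 - x)" "f y1 < 0" "\<And>z. 2 \<le> norm (z - x) \<Longrightarrow> f y1 \<le> f z"
proof -
  define m0 where "m0 = - f y"
  have m0: "0 < m0" using below by (simp add: m0_def f_def)
  \<comment> \<open>Beyond the second radius the barrier is at most \<open>m0\<close>; the maximum
    keeps \<open>y\<close> inside the shell.\<close>
  define R where "R = max (norm (y - x)) ((m0 / c) powr (- (1 / \<beta>)))"
  have far: "- m0 \<le> f z" if "R \<le> norm (z - x)" for z
  proof -
    have "0 < (m0 / c) powr (- (1 / \<beta>))" using m0 assms(4) by simp
    then have "norm (z - x) powr (- \<beta>) \<le> ((m0 / c) powr (- (1 / \<beta>))) powr (- \<beta>)"
      using that assms(3) by (intro powr_mono2') (auto simp: R_def)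
    also have "\<dots> = m0 / c" using assms(3,4) m0 by (simp add: powr_powr)
    finally have "c * norm (z - x) powr (- \<beta>) \<le> m0" using assms(4) by (simp add: field_simps)
    then show ?thesis using pos[of z] by (simp add: f_def)
  qed
  define S where "S = cball x R - ball x 2"
  have S: "compact S" unfolding S_def by (intro compact_diff) auto
  have yS: "y \<in> S" using y by (simp add: S_def R_def dist_norm norm_minus_commute)
  have "continuous_on S f"
    unfolding f_def by (intro continuous_intros continuous_on_subset[OF cont]) (auto simp: S_def)
  then obtain y1 where y1: "y1 \<in> S" "\<And>z. z \<in> S \<Longrightarrow> f y1 \<le> f z"
    using continuous_attains_inf[OF S] yS by blast
  have f1: "f y1 \<le> - m0" using y1(2)[OF yS] by (simp add: m0_def)
  show ?thesis
  proof (rule that[of y1])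
    fix z assume z: "2 \<le> norm (z - x)"
    show "f y1 \<le> f z"
    proof (cases "norm (z - x) \<le> R")
      case True
      then show ?thesis using z by (intro y1(2)) (simp add: S_def dist_norm norm_minus_commute)
    next
      case False
      then show ?thesis using far[of z] f1 by simp
    qed
  qed (use y1(1) f1 m0 in \<open>auto simp: S_def dist_norm norm_minus_commute\<close>)
qed

text \<open>At a global minimum point of \<open>u - c * \<phi>\<close> the truncation of
  \<open>u\<close> is at most \<open>c\<close> times that of \<open>\<phi>\<close>. The latter has
  an upper bound that vanishes with \<open>\<epsilon>\<close>, against the positive limit of the
  former.\<close>

lemma lower_bound_fractional:
  fixes u :: "real^'n \<Rightarrow> real" and x :: "real^'n"
  assumes \<alpha>: "0 < \<alpha>" "\<alpha> < 2" and n2: "2 \<le> CARD('n)" and pos: "\<And>y. 0 < u y"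
    and cont: "continuous_on UNIV u"
    and w: "integrable lborel (\<lambda>z. \<bar>u z\<bar> / (1 + norm z powr (real CARD('n) + \<alpha>)))"
    and lim: "\<And>y. \<exists>L>0. (truncated (real CARD('n) + \<alpha>) u y \<longlongrightarrow> L) (at_right 0)"
  shows "\<exists>c>0. \<forall>y. 2 \<le> norm (y - x) \<longrightarrow> c * norm (y - x) powr (\<alpha> - real CARD('n)) \<le> u y"
proof -
  define \<beta> where "\<beta> = real CARD('n) - \<alpha>"
  define s where "s = real CARD('n) + \<alpha>"
  define V where "V = measure lborel (ball (0::real^'n) 1)"
  \<comment> \<open>The height of the cap that replaces the singularity. It makes up for the mass
    removed near \<open>x\<close>, and being at least 1 it dominates \<open>\<phi>\<close>
    everywhere.\<close>
  define K where "K = max 1 (3 powr s * (LINT z|lborel. indicator (ball x 1) z * norm (z - x) powr (- \<beta>)) / V)"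
  define \<phi> where "\<phi> z = (if norm (z - x) < 1 then K else norm (z - x) powr (- \<beta>))" for z
  have V: "0 < V" using measure_unit_ball_pos by (simp add: V_def)
  have \<beta>: "0 < \<beta>" "\<alpha> - real CARD('n) = - \<beta>" using \<alpha> n2 by (auto simp: \<beta>_def)
  have s: "real CARD('n) < s" "s \<le> 2 * real CARD('n)" "0 < s"
    using \<alpha> n2 by (auto simp: s_def)
  have K: "1 \<le> K" "3 powr s * (LINT z|lborel. indicator (ball x 1) z * norm (z - x) powr (- \<beta>)) \<le> K * V"
  proof -
    show "1 \<le> K" by (simp add: K_def)
    have "3 powr s * (LINT z|lborel. indicator (ball x 1) z * norm (z - x) powr (- \<beta>)) / V \<le> K"
      by (simp add: K_def)
    then show "3 powr s * (LINT z|lborel. indicator (ball x 1) z * norm (z - x) powr (- \<beta>)) \<le> K * V"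
      using V by (simp add: field_simps)
  qed
  have [measurable]: "u \<in> borel_measurable borel"
    using cont by (rule borel_measurable_continuous_onI)
  have [measurable]: "\<phi> \<in> borel_measurable borel"
    unfolding \<phi>_def[abs_def] by measurable
  have \<phi>K: "\<phi> z \<le> K" "0 \<le> \<phi> z" for z
    using powr_mono2'[of "- \<beta>" 1 "norm (z - x)"] K \<beta> by (auto simp: \<phi>_def)
  obtain m where m: "0 < m" "\<And>y. y \<in> cball x 2 \<Longrightarrow> m \<le> u y"
    using positive_lower_bound_cball[OF cont pos, of 2 x] by auto
  define c where "c = m / K"
  have c: "0 < c" using m K by (simp add: c_def)
  have inner: "c * \<phi> z \<le> u z" if "z \<in> cball x 2" for z
  proof -
    have "c * \<phi> z \<le> c * K" using \<phi>K[of z] c by (intro mult_left_mono) auto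
    also have "\<dots> = m" using K by (simp add: c_def)
    finally show ?thesis using m(2)[OF that] by simp
  qed
  have "c * norm (y - x) powr (- \<beta>) \<le> u y" if y: "2 \<le> norm (y - x)" for y
  proof (rule ccontr)
    assume "\<not> c * norm (y - x) powr (- \<beta>) \<le> u y"
    then obtain y1 where y1x: "2 \<le> norm (y1 - x)" and f1: "u y1 - c * norm (y1 - x) powr (- \<beta>) < 0"
      and fmin: "\<And>z. 2 \<le> norm (z - x) \<Longrightarrow> u y1 - c * norm (y1 - x) powr (- \<beta>) \<le> u z - c * norm (z - x) powr (- \<beta>)"
      by (rule comparison_negative_min[OF cont pos \<beta>(1) c y]) blast
    have \<phi>1: "\<phi> y1 = norm (y1 - x) powr (- \<beta>)" using y1x by (simp add: \<phi>_def)
    \<comment> \<open>By \<open>c = m / K\<close> the difference \<open>u - c * \<phi>\<close> is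
      nonnegative on \<open>cball x 2\<close>, so a negative minimum over the exterior is a minimum
      over the whole space.\<close>
    have min: "u y1 - u z \<le> c * (\<phi> y1 - \<phi> z)" for z
    proof (cases "z \<in> cball x 2")
      case True
      then show ?thesis using inner[OF True] f1 by (simp add: \<phi>1 algebra_simps)
    next
      case False
      then have "2 < norm (z - x)" by (simp add: dist_norm norm_minus_commute)
      then show ?thesis using fmin[of z] by (simp add: \<phi>1 algebra_simps) (simp add: \<phi>_def)
    qed
    obtain L where L: "0 < L" "(truncated s u y1 \<longlongrightarrow> L) (at_right 0)"
      using lim[of y1] unfolding s_def by blast
    define D where "D = \<beta> * 2 powr s * V * real CARD('n)"
    have tr: "truncated s u y1 \<epsilon> \<le> c * (D * \<epsilon> powr (2 - \<alpha>))" if \<epsilon>: "0 < \<epsilon>" "\<epsilon> \<le> 1 / 2" for \<epsilon>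
    proof -
      let ?I = "\<lambda>z. indicator {z. \<epsilon> \<le> norm (z - y1)} z"
      have \<phi>i: "integrable lborel (\<lambda>z. ?I z * ((\<phi> y1 - \<phi> z) * norm (z - y1) powr (- s)))"
      proof (rule Bochner_Integration.integrable_bound)
        show "integrable lborel (\<lambda>z. K * (?I z * norm (z - y1) powr (- s)))"
          by (intro integrable_mult_right integrable_norm_powr_outside s \<epsilon>)
        show "AE z in lborel. norm (?I z * ((\<phi> y1 - \<phi> z) * norm (z - y1) powr (- s))) \<le> norm (K * (?I z * norm (z - y1) powr (- s)))"
        proof (rule AE_I2)
          fix z
          have "\<bar>\<phi> y1 - \<phi> z\<bar> \<le> K" using \<phi>K[of y1] \<phi>K[of z] by linarith
          then show "norm (?I z * ((\<phi> y1 - \<phi> z) * norm (z - y1) powr (- s))) \<le> norm (K * (?I z * norm (z - y1) powr (- s)))"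
            using K by (simp add: abs_mult indicator_def mult_right_mono)
        qed
      qed measurable
      have "truncated s u y1 \<epsilon> \<le> (LINT z|lborel. c * (?I z * ((\<phi> y1 - \<phi> z) * norm (z - y1) powr (- s))))"
        unfolding truncated_def
      proof (rule integral_mono)
        show "integrable lborel (\<lambda>z. ?I z * ((u y1 - u z) * norm (z - y1) powr (- s)))"
          by (rule integrable_truncated[OF \<open>u \<in> borel_measurable borel\<close> w[folded s_def] \<epsilon>(1) s(1,2)])
        show "integrable lborel (\<lambda>z. c * (?I z * ((\<phi> y1 - \<phi> z) * norm (z - y1) powr (- s))))"
          using \<phi>i by (rule integrable_mult_right)
        show "?I z * ((u y1 - u z) * norm (z - y1) powr (- s)) \<le> c * (?I z * ((\<phi> y1 - \<phi> z) * norm (z - y1) powr (- s)))" for z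
          using mult_right_mono[OF min[of z], of "norm (z - y1) powr (- s)"] by (simp add: indicator_def mult_ac)
      qed
      also have "\<dots> = c * truncated s \<phi> y1 \<epsilon>"
        by (simp add: truncated_def)
      also have "\<dots> \<le> c * (D * \<epsilon> powr (2 - \<alpha>))"
        unfolding D_def V_def s_def \<beta>_def
        by (intro mult_left_mono truncated_radial_barrier_le[where K=K] \<alpha> n2 \<epsilon> y1x)
          (use K c y1x in \<open>auto simp: \<phi>_def \<beta>_def s_def V_def\<close>)
      finally show ?thesis .
    qed
    have "((\<lambda>\<epsilon>. c * (D * \<epsilon> powr (2 - \<alpha>))) \<longlongrightarrow> c * (D * 0)) (at_right 0)"
    proof (intro tendsto_mult tendsto_const)
      have "((\<lambda>\<epsilon>::real. \<epsilon> powr (2 - \<alpha>)) \<longlongrightarrow> 0 powr (2 - \<alpha>)) (at_right 0)"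
        using \<alpha> by (intro tendsto_powr' tendsto_const tendsto_ident_at)
          (auto simp: eventually_at_right_field intro!: exI[of _ 1])
      then show "((\<lambda>\<epsilon>::real. \<epsilon> powr (2 - \<alpha>)) \<longlongrightarrow> 0) (at_right 0)" by simp
    qed
    moreover have "eventually (\<lambda>\<epsilon>. truncated s u y1 \<epsilon> \<le> c * (D * \<epsilon> powr (2 - \<alpha>))) (at_right 0)"
      unfolding eventually_at_right_field using tr by (intro exI[of _ "1/2"]) auto
    ultimately have "L \<le> c * (D * 0)"
      using L(2) by (intro tendsto_le[of "at_right 0"]) auto
    then show False using L(1) by simp
  qed
  then show ?thesis using c \<beta>(2) by auto
qed

text \<open>The exponent may have either sign, so the power may be increasing or decreasing; the sum
  of both endpoint values covers the two cases.\<close>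

lemma powr_le_sum_endpoints:
  assumes "0 < m" "m \<le> v" "v \<le> U"
  shows "v powr e \<le> m powr e + U powr (e::real)"
proof (cases "0 \<le> e")
  case True
  then have "v powr e \<le> U powr e" using assms by (intro powr_mono2) auto
  then show ?thesis by (simp add: add_increasing)
next
  case False
  then have "v powr e \<le> m powr e" using assms by (intro powr_mono2') auto
  then show ?thesis by (simp add: add_increasing2)
qed

lemma integral_norm_powr_ball:
  fixes y :: "real^'n"
  shows "(LINT z|lborel. indicator (ball y R) z * norm (z - y) powr q)
     = (LINT z|lborel. indicator (ball (0::real^'n) R) z * norm z powr q)"
proof -
  define f where "f = (\<lambda>z::real^'n. indicator (ball y R) z * norm (z - y) powr q)"
  have [measurable]: "f \<in> borel_measurable borel" unfolding f_def by measurable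
  have "(LINT z|lborel. f z) = (LINT z|lborel. f (2 *\<^sub>R ((1 / 2) *\<^sub>R y) - z))"
    by (rule integral_lborel_reflect) measurable
  also have "(\<lambda>z. f (2 *\<^sub>R ((1 / 2) *\<^sub>R y) - z)) = (\<lambda>z. indicator (ball 0 R) z * norm z powr q)"
  proof
    fix z
    have "2 *\<^sub>R ((1 / 2) *\<^sub>R y) - z = y - z" by simp
    then show "f (2 *\<^sub>R ((1 / 2) *\<^sub>R y) - z) = indicator (ball 0 R) z * norm z powr q"
      by (simp only:) (simp add: f_def indicator_def dist_norm)
  qed
  finally show ?thesis by (simp only: f_def)
qed

text \<open>Points within \<open>2 * b\<close> of \<open>x\<close> see a bounded \<open>u\<close>
  and an integrable kernel on the ball of radius \<open>3 * b\<close> about \<open>y\<close>.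
  Farther out \<open>norm (z - y) \<ge> norm (z - x) / 2\<close>, so the potential at
  \<open>x\<close> takes over.\<close>

lemma potential_le:
  fixes u :: "real^'n \<Rightarrow> real" and x y :: "real^'n"
  assumes [measurable]: "u \<in> borel_measurable borel" and pos: "\<And>z. 0 < u z"
    and \<beta>: "0 < \<beta>" "\<beta> < real CARD('n)" and p: "0 \<le> p"
    and int: "\<And>y. integrable lborel (\<lambda>z. u z powr p * norm (z - y) powr (- \<beta>))"
    and U: "\<And>z. z \<in> cball x (2 * b) \<Longrightarrow> u z \<le> U" and y: "norm (y - x) \<le> b" and b: "0 < b"
  shows "(LINT z|lborel. u z powr p * norm (z - y) powr (- \<beta>))
    \<le> U powr p * (LINT z|lborel. indicator (ball (0::real^'n) (3 * b)) z * norm z powr (- \<beta>))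
      + 2 powr \<beta> * (LINT z|lborel. u z powr p * norm (z - x) powr (- \<beta>))"
proof -
  have k: "integrable lborel (\<lambda>z. indicator (ball y (3 * b)) z * norm (z - y) powr (- \<beta>))"
    using \<beta> by (intro integrable_norm_powr_ball) auto
  have "(LINT z|lborel. u z powr p * norm (z - y) powr (- \<beta>))
    \<le> (LINT z|lborel. U powr p * (indicator (ball y (3 * b)) z * norm (z - y) powr (- \<beta>))
      + 2 powr \<beta> * (u z powr p * norm (z - x) powr (- \<beta>)))"
  proof (rule integral_mono)
    fix z
    show "u z powr p * norm (z - y) powr (- \<beta>) \<le> U powr p * (indicator (ball y (3 * b)) z * norm (z - y) powr (- \<beta>))
      + 2 powr \<beta> * (u z powr p * norm (z - x) powr (- \<beta>))"
    proof (cases "norm (z - x) < 2 * b")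
      case True
      have "norm (z - y) < 3 * b"
        using norm_triangle_ineq[of "z - x" "x - y"] True y by (simp add: norm_minus_commute)
      then have "z \<in> ball y (3 * b)" by (simp add: dist_norm norm_minus_commute)
      moreover have "u z \<le> U" using True by (intro U) (simp add: dist_norm norm_minus_commute)
      then have "u z powr p * norm (z - y) powr (- \<beta>) \<le> U powr p * norm (z - y) powr (- \<beta>)"
        using pos[of z] p by (intro mult_right_mono powr_mono2) auto
      ultimately show ?thesis by (simp add: add_increasing2)
    next
      case False
      have zp: "0 < norm (z - x)"
        using False b by linarith
      have "norm (z - x) / 2 \<le> norm (z - y)"
        using norm_triangle_ineq[of "z - y" "y - x"] False y by simp
      then have "norm (z - y) powr (- \<beta>) \<le> (norm (z - x) / 2) powr (- \<beta>)"
        using zp \<beta> by (intro powr_mono2') auto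
      also have "\<dots> = 2 powr \<beta> * norm (z - x) powr (- \<beta>)"
        by (simp add: powr_divide powr_minus field_simps)
      finally have "u z powr p * norm (z - y) powr (- \<beta>) \<le> u z powr p * (2 powr \<beta> * norm (z - x) powr (- \<beta>))"
        by (intro mult_left_mono) auto
      then show ?thesis by (simp add: add_increasing mult_ac)
    qed
  qed (use k int in \<open>auto intro!: Bochner_Integration.integrable_add integrable_mult_right\<close>)
  also have "\<dots> = U powr p * (LINT z|lborel. indicator (ball y (3 * b)) z * norm (z - y) powr (- \<beta>))
      + 2 powr \<beta> * (LINT z|lborel. u z powr p * norm (z - x) powr (- \<beta>))"
    using k int[of x] by simp
  finally show ?thesis by (simp add: integral_norm_powr_ball)
qed

text \<open>Reflecting the exterior part into the ball, the kernel gets smaller, so the positive part of \<open>w\<close>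
  contributes nonpositively; what remains is the mass of the kernel outside the ball.\<close>

lemma truncated_at_negative_min:
  fixes x y :: "real^'n" and w :: "real^'n \<Rightarrow> real"
  assumes \<alpha>: "0 < \<alpha>" "\<alpha> < 2" and n2: "2 \<le> CARD('n)"
    and [measurable]: "w \<in> borel_measurable borel"
    and wi: "integrable lborel (\<lambda>z. \<bar>w z\<bar> / (1 + norm z powr (real CARD('n) + \<alpha>)))"
    and anti: "\<And>z. z \<noteq> x \<Longrightarrow> w (inversion x r z) = - ((norm (z - x) / r) powr (real CARD('n) - \<alpha>) * w z)"
    and l: "0 < l" "r - l < norm (y - x)" and r: "norm (y - x) < r" "y \<noteq> x"
    and neg: "w y < 0" and cont: "isCont w y"
    and min: "\<And>z. z \<in> ball x r - {x} \<Longrightarrow> w y \<le> w z"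
  shows "eventually (\<lambda>\<epsilon>. truncated (real CARD('n) + \<alpha>) w y \<epsilon> \<le>
     w y * (measure lborel (ball (0::real^'n) 1) * 3 powr (- (real CARD('n) + \<alpha>)) * l powr (- \<alpha>))) (at_right 0)"
proof -
  let ?n = "CARD('n)"
  define \<beta> where "\<beta> = real ?n - \<alpha>"
  define s where "s = real ?n + \<alpha>"
  define V where "V = measure lborel (ball (0::real^'n) 1)"
  define \<kappa> where "\<kappa> z = norm (z - y) powr (- s)" for z :: "real^'n"
  have s: "real ?n < s" "s \<le> 2 * real ?n" "0 < s" "2 * real ?n - \<beta> = s"
    using \<alpha> n2 by (auto simp: s_def \<beta>_def)
  have r0: "0 < r" using r(1) norm_ge_zero[of "y - x"] by linarith
  have [measurable]: "\<kappa> \<in> borel_measurable borel" unfolding \<kappa>_def[abs_def] by measurable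
  have \<kappa>0: "0 \<le> \<kappa> z" for z by (simp add: \<kappa>_def)
  define W where "W z = max 0 (w z)" for z
  have [measurable]: "W \<in> borel_measurable borel" unfolding W_def[abs_def] by measurable
  have "eventually (\<lambda>z. w z < 0) (nhds y)"
    by (rule order_tendstoD(2)[OF cont[unfolded isCont_def tendsto_at_iff_tendsto_nhds] neg])
  then obtain e1 where e1: "0 < e1" "\<And>z. dist z y < e1 \<Longrightarrow> w z < 0"
    unfolding eventually_nhds_metric by blast
  \<comment> \<open>Within \<open>e0\<close> of \<open>y\<close> the function \<open>w\<close> is
    negative and points stay in the ball, so neither the positive part inside nor anything outside
    meets the singularity of the kernel.\<close>
  define e0 where "e0 = min e1 (r - norm (y - x))"
  have e0: "0 < e0" using e1 r by (simp add: e0_def)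
  have near: "w z < 0" if "norm (z - y) < e0" for z
    using that e1(2)[of z] by (simp add: e0_def dist_norm)
  have outer: "e0 \<le> norm (z - y)" if "r \<le> norm (z - x)" for z
    using norm_triangle_ineq[of "z - y" "y - x"] that by (simp add: e0_def)
  define wk where "wk z = indicator {z. e0 \<le> norm (z - y)} z * (w z * \<kappa> z)" for z
  have wk: "integrable lborel wk"
    unfolding wk_def[abs_def] \<kappa>_def using integrable_kernel_outside[OF _ wi[folded s_def] e0 s(3), of y] by simp
  \<comment> \<open>\<open>A\<close> carries the positive part of \<open>w\<close> inside the ball,
    \<open>B\<close> below the negative part outside; antisymmetry exchanges the two.\<close>
  define A where "A z = indicator (ball x r - {x}) z * (W z * \<kappa> z)" for z
  have [measurable]: "A \<in> borel_measurable borel" unfolding A_def[abs_def] by measurable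
  have A: "integrable lborel A"
  proof (rule Bochner_Integration.integrable_bound[OF wk])
    show "AE z in lborel. norm (A z) \<le> norm (wk z)"
    proof (rule AE_I2)
      fix z
      show "norm (A z) \<le> norm (wk z)"
        using near[of z] \<kappa>0[of z]
        by (cases "e0 \<le> norm (z - y)") (auto simp: A_def wk_def W_def indicator_def abs_mult max_def mult_right_mono mult_nonpos_nonneg)
    qed
  qed simp
  define N where "N z = max 0 (- w z)" for z
  define B where "B z = indicator {z. r < norm (z - x)} z * (N z * \<kappa> z)" for z
  have [measurable]: "B \<in> borel_measurable borel" unfolding B_def[abs_def] N_def[abs_def] by measurable
  have B: "integrable lborel B"
  proof (rule Bochner_Integration.integrable_bound[OF wk])
    show "AE z in lborel. norm (B z) \<le> norm (wk z)"
    proof (rule AE_I2)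
      fix z
      show "norm (B z) \<le> norm (wk z)"
        using outer[of z] \<kappa>0[of z]
        by (cases "r < norm (z - x)") (auto simp: B_def wk_def N_def abs_mult max_def mult_right_mono mult_nonpos_nonneg)
    qed
  qed simp
  have BA: "integral\<^sup>L lborel B \<le> integral\<^sup>L lborel A"
  proof -
    define B' where "B' z = (r / norm (z - x)) ^ (2 * ?n) * B (inversion x r z)" for z
    have B': "integrable lborel B'" "integral\<^sup>L lborel B = integral\<^sup>L lborel B'"
      unfolding B'_def[abs_def] using integrable_inversion_iff[of r B x] integral_inversion[of r B x] B r0 by auto
    have pw: "B' z \<le> A z" if z: "z \<noteq> x" for z
    proof (cases "norm (z - x) < r")
      case False
      have "r\<^sup>2 / norm (z - x) \<le> r"
        using False r0 z by (simp add: field_simps power2_eq_square)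
      then have "B' z = 0"
        using z by (simp add: B'_def B_def norm_inversion_diff)
      moreover have "A z = 0" using False by (simp add: A_def dist_norm norm_minus_commute)
      ultimately show ?thesis by simp
    next
      case True
      define t where "t = norm (z - x)"
      have t: "0 < t" "t < r" using True z by (auto simp: t_def)
      define d where "d = norm (inversion x r z - y)"
      define D where "D = norm (z - y)"
      have ni: "norm (inversion x r z - x) = r\<^sup>2 / t" using z by (simp add: norm_inversion_diff t_def)
      have rt: "r < r\<^sup>2 / t" using t r0 by (simp add: field_simps power2_eq_square)
      have le: "D \<le> t / r * d"
        using norm_diff_inversion_inner[OF z True] r(1) by (simp add: t_def d_def D_def)
      have NW: "N (inversion x r z) = (t / r) powr \<beta> * W z"
        using anti[OF z] by (simp add: N_def W_def \<beta>_def t_def max_def mult_le_0_iff zero_le_mult_iff)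
      \<comment> \<open>At \<open>z = y\<close> the kernel has the value 0 and monotonicity would
        fail; there \<open>W z = 0\<close> saves the inequality.\<close>
      have "W z * (t / r * d) powr (- s) \<le> W z * D powr (- s)"
      proof (cases "D = 0")
        case True
        then have "z = y" by (simp add: D_def)
        then show ?thesis using neg by (simp add: W_def)
      next
        case False
        then show ?thesis using le s
          by (intro mult_left_mono powr_mono2') (auto simp: W_def D_def)
      qed
      moreover have "(r / t) ^ (2 * ?n) * (((t / r) powr \<beta> * W z) * d powr (- s)) = W z * (t / r * d) powr (- s)"
      proof -
        have "(r / t) ^ (2 * ?n) = (r / t) powr (2 * real ?n)"
          using t r0 by (intro power_eq_powr) simp
        also have "\<dots> = (t / r) powr (- (2 * real ?n))"
          using t r0 by (simp add: powr_divide powr_minus field_simps)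
        finally have "(r / t) ^ (2 * ?n) * (t / r) powr \<beta> = (t / r) powr (- s)"
          by (simp add: powr_add[symmetric]) (simp add: s(4)[symmetric])
        moreover have "(t / r * d) powr (- s) = (t / r) powr (- s) * d powr (- s)"
          using t r0 by (intro powr_mult)
        ultimately show ?thesis by (simp add: mult_ac)
      qed
      moreover have "B' z = (r / t) ^ (2 * ?n) * (((t / r) powr \<beta> * W z) * d powr (- s))"
        using rt by (simp add: B'_def B_def NW \<kappa>_def ni t_def[symmetric] d_def[symmetric])
      moreover have "z \<in> ball x r - {x}"
        using True z by (simp add: dist_norm norm_minus_commute)
      then have "A z = W z * D powr (- s)"
        by (simp add: A_def \<kappa>_def D_def)
      ultimately show ?thesis by (simp only:)
    qed
    show ?thesis
      unfolding B'(2) by (rule integral_mono_AE[OF B'(1) A])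
        (use AE_lborel_singleton[of x] in \<open>eventually_elim, auto intro: pw\<close>)
  qed
  define P where "P z = indicator {z. r < norm (z - x)} z * \<kappa> z" for z
  have [measurable]: "P \<in> borel_measurable borel" unfolding P_def[abs_def] by measurable
  have P: "integrable lborel P"
  proof (rule Bochner_Integration.integrable_bound)
    show "integrable lborel (\<lambda>z. indicator {z. e0 \<le> norm (z - y)} z * norm (z - y) powr (- s))"
      by (rule integrable_norm_powr_outside[OF s(1,2) e0])
    show "AE z in lborel. norm (P z) \<le> norm (indicator {z. e0 \<le> norm (z - y)} z * norm (z - y) powr (- s))"
      using outer by (intro AE_I2) (auto simp: P_def \<kappa>_def indicator_def)
  qed simp
  have P_ge: "V * 3 powr (- s) * l powr (- \<alpha>) \<le> integral\<^sup>L lborel P"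
  proof -
    \<comment> \<open>Centre of a ball of radius \<open>l\<close> that touches the sphere from
      outside on the ray through \<open>y\<close>. This ball lies within \<open>3 * l\<close> of
      \<open>y\<close>, so its volume times the least kernel value is a constant times
      \<open>l powr (- \<alpha>)\<close>.\<close>
    define p where "p = x + ((r + l) / norm (y - x)) *\<^sub>R (y - x)"
    have px: "norm (p - x) = r + l" using r r0 l by (simp add: p_def)
    have "p - y = ((r + l) / norm (y - x) - 1) *\<^sub>R (y - x)"
      by (simp add: p_def algebra_simps)
    then have "norm (p - y) = \<bar>(r + l) / norm (y - x) - 1\<bar> * norm (y - x)" by simp
    also have "\<dots> = r + l - norm (y - x)"
      using r l by (simp add: abs_if field_simps)
    finally have py: "norm (p - y) < 2 * l" using l by linarith
    have pw: "(3 * l) powr (- s) * indicator (ball p l) z \<le> P z" for z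
    proof (cases "z \<in> ball p l")
      case True
      then have zp: "norm (z - p) < l" by (simp add: dist_norm norm_minus_commute)
      have "r < norm (z - x)"
        using norm_triangle_ineq[of "z - x" "p - z"] zp px by (simp add: norm_minus_commute)
      moreover have "norm (z - y) \<le> 3 * l"
        using norm_triangle_ineq[of "z - p" "p - y"] zp py by simp
      moreover have "0 < norm (z - y)" using outer[of z] \<open>r < norm (z - x)\<close> e0 by linarith
      ultimately show ?thesis
        using True s by (simp add: P_def \<kappa>_def powr_mono2')
    qed (simp add: P_def \<kappa>0)
    have "(LINT z|lborel. (3 * l) powr (- s) * indicator (ball p l) z) \<le> integral\<^sup>L lborel P"
      using pw finite_emeasure_ball[of p l]
      by (intro integral_mono P integrable_mult_right integrable_real_indicator) auto
    moreover have "(LINT z|lborel. (3 * l) powr (- s) * indicator (ball p l) z) = (3 * l) powr (- s) * (l ^ ?n * V)"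
      using l measure_ball[of l p] by (simp add: V_def)
    moreover have "(3 * l) powr (- s) * (l ^ ?n * V) = V * 3 powr (- s) * l powr (- \<alpha>)"
    proof -
      have "(3 * l) powr (- s) = 3 powr (- s) * l powr (- s)" using l by (intro powr_mult)
      moreover have "l powr (- s) * l ^ ?n = l powr (- \<alpha>)"
      proof -
        have "l powr (- s) * l ^ ?n = l powr (- s) * l powr (real ?n)"
          using l by (simp only: powr_realpow)
        also have "\<dots> = l powr (- \<alpha>)"
          unfolding powr_add[symmetric] by (simp add: s_def)
        finally show ?thesis .
      qed
      ultimately show ?thesis by (simp add: mult_ac)
    qed
    ultimately show ?thesis by simp
  qed
  have "truncated s w y \<epsilon> \<le> w y * (V * 3 powr (- s) * l powr (- \<alpha>))" if \<epsilon>: "0 < \<epsilon>" "\<epsilon> \<le> e0" for \<epsilon>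
  proof -
    let ?F = "\<lambda>z. indicator {z. \<epsilon> \<le> norm (z - y)} z * ((w y - w z) * norm (z - y) powr (- s))"
    have F: "integrable lborel ?F"
      using integrable_truncated[OF _ wi[folded s_def] \<epsilon>(1) s(1,2)] by simp
    \<comment> \<open>Inside, \<open>w y\<close> is below both 0 and \<open>w z\<close>, hence
      \<open>w y - w z \<le> - W z\<close>; outside, \<open>w y - w z \<le> w y + N z\<close>; on
      the sphere antisymmetry forces \<open>w z = 0\<close>.\<close>
    have pw: "?F z \<le> w y * P z + B z - A z" if z: "z \<noteq> x" for z
    proof (cases "norm (z - x)" r rule: linorder_cases)
      case less
      then have zb: "z \<in> ball x r - {x}" using z by (simp add: dist_norm norm_minus_commute)
      have "w y - w z \<le> - W z" using min[OF zb] neg by (simp add: W_def)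
      then have "(w y - w z) * \<kappa> z \<le> - W z * \<kappa> z" using \<kappa>0 by (rule mult_right_mono)
      moreover have "W z = 0" if "norm (z - y) < \<epsilon>" using near[of z] that \<epsilon> by (simp add: W_def)
      ultimately show ?thesis
        using less zb by (cases "\<epsilon> \<le> norm (z - y)") (auto simp: P_def B_def A_def \<kappa>_def)
    next
      case equal
      then have "w z = 0"
        using anti[OF z] inversion_sphere[of z x r] r0 by simp
      moreover have "z \<notin> ball x r" using equal by (simp add: dist_norm norm_minus_commute)
      ultimately show ?thesis
        using equal neg \<kappa>0[of z] by (simp add: P_def B_def A_def \<kappa>_def indicator_def mult_nonpos_nonneg)
    next
      case greater
      then have "z \<notin> ball x r" by (simp add: dist_norm norm_minus_commute)
      moreover have "\<epsilon> \<le> norm (z - y)" using outer[of z] greater \<epsilon> by simp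
      moreover have "(w y - w z) * \<kappa> z \<le> (w y + N z) * \<kappa> z"
        using \<kappa>0 by (intro mult_right_mono) (auto simp: N_def)
      ultimately show ?thesis
        using greater by (simp add: P_def B_def A_def \<kappa>_def distrib_right)
    qed
    have "truncated s w y \<epsilon> \<le> (LINT z|lborel. w y * P z + B z - A z)"
      unfolding truncated_def
      by (rule integral_mono_AE[OF F])
        (use P A B AE_lborel_singleton[of x] in \<open>auto intro!: Bochner_Integration.integrable_diff Bochner_Integration.integrable_add integrable_mult_right elim!: eventually_mono pw\<close>)
    also have "\<dots> = w y * integral\<^sup>L lborel P + integral\<^sup>L lborel B - integral\<^sup>L lborel A"
      using P A B by simp
    also have "\<dots> \<le> w y * integral\<^sup>L lborel P" using BA by simp
    also have "\<dots> \<le> w y * (V * 3 powr (- s) * l powr (- \<alpha>))"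
      using P_ge neg by (intro mult_left_mono_neg) auto
    finally show ?thesis .
  qed
  then show ?thesis
    unfolding eventually_at_right_field s_def V_def using e0 by (intro exI[of _ e0]) auto
qed

text \<open>Strict positivity would require integrability of the integrand. It is instead deduced
  later from the equation, whose right-hand side is positive.\<close>

lemma frac_const_nonneg: "0 \<le> frac_const TYPE('n::finite) \<alpha>"
  unfolding frac_const_def by (auto intro!: Bochner_Integration.integral_nonneg)

lemma L_space_integrable:
  fixes w :: "real^'n \<Rightarrow> real"
  assumes [measurable]: "w \<in> borel_measurable borel" and "w \<in> L_space \<alpha>"
  shows "integrable lborel (\<lambda>z. \<bar>w z\<bar> / (1 + norm z powr (real CARD('n) + \<alpha>)))"
proof -
  have "integrable lebesgue (\<lambda>z. \<bar>w z\<bar> / (1 + norm z powr (real CARD('n) + \<alpha>)))"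
    using assms(2) by (simp add: L_space_def)
  then show ?thesis
    by (subst (asm) integrable_completion) measurable
qed

lemma frac_laplacian_limit:
  fixes w :: "real^'n \<Rightarrow> real"
  assumes \<alpha>: "0 < \<alpha>" "\<alpha> < 2" and n2: "2 \<le> CARD('n)"
    and w: "w \<in> borel_measurable borel" "w \<in> L_space \<alpha>"
    and S: "open S" "y \<in> S" "C11_loc_on S w"
  shows "\<exists>L. (truncated (real CARD('n) + \<alpha>) w y \<longlongrightarrow> L) (at_right 0) \<and>
     frac_laplacian \<alpha> w y = frac_const TYPE('n) \<alpha> * L"
proof -
  obtain L where L: "(truncated (real CARD('n) + \<alpha>) w y \<longlongrightarrow> L) (at_right 0)"
    using truncated_converges[OF \<alpha> n2 w(1) L_space_integrable[OF w] S] by blast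
  have "Lim (at_right 0) (truncated (real CARD('n) + \<alpha>) w y) = L"
    using L by (intro tendsto_Lim) auto
  then show ?thesis
    using L \<alpha> by (auto simp: frac_laplacian_def truncated_eq[OF w(1)])
qed

section \<open>Regularity, positivity and local bounds of solutions\<close>

lemma C11_loc_on_gradient:
  assumes "C11_loc_on UNIV u"
  shows "\<exists>G. (\<forall>y. (u has_derivative (\<lambda>h. G y \<bullet> h)) (at y)) \<and> continuous_on UNIV G"
proof -
  obtain G where G: "\<And>y. (u has_derivative (\<lambda>h. G y \<bullet> h)) (at y)"
    and lip: "\<And>K. compact K \<Longrightarrow> \<exists>L. L-lipschitz_on K G"
    using assms by (auto simp: C11_loc_on_def)
  have "isCont G y" for y
  proof -
    have "continuous_on (cball y 1) G"
      using lip[of "cball y 1"] lipschitz_on_continuous_on by auto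
    then show ?thesis
      by (rule continuous_on_interior) simp
  qed
  then show ?thesis
    using G by (auto simp: continuous_on_eq_continuous_at)
qed

lemma C2_on_gradient:
  assumes "C2_on UNIV u"
  shows "\<exists>G. (\<forall>y. (u has_derivative (\<lambda>h. G y \<bullet> h)) (at y)) \<and> continuous_on UNIV G"
proof -
  obtain G H where G: "\<And>y. (u has_derivative (\<lambda>h. G y \<bullet> h)) (at y)"
    and H: "\<And>y. (G has_derivative (\<lambda>h. H y *v h)) (at y)"
    using assms by (auto simp: C2_on_def)
  have "continuous_on UNIV G"
    by (rule has_derivative_continuous_on) (rule has_derivative_at_withinI[OF H])
  then show ?thesis using G by blast
qed

lemma solution_gradient:
  assumes "positive_classical_solution \<alpha> c1 c2 q1 q2 u"
  shows "\<exists>G. (\<forall>y. (u has_derivative (\<lambda>h. G y \<bullet> h)) (at y)) \<and> continuous_on UNIV G"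
  using assms C2_on_gradient C11_loc_on_gradient
  by (cases "\<alpha> = 2") (auto simp: positive_classical_solution_def)

lemma solution_continuous:
  assumes "positive_classical_solution \<alpha> c1 c2 q1 q2 u"
  shows "continuous_on UNIV u"
proof -
  obtain G where G: "\<And>y. (u has_derivative (\<lambda>h. G y \<bullet> h)) (at y)"
    using solution_gradient[OF assms] by blast
  show ?thesis
    by (rule has_derivative_continuous_on) (rule has_derivative_at_withinI[OF G])
qed

lemma solution_borel:
  assumes "positive_classical_solution \<alpha> c1 c2 q1 q2 u"
  shows "u \<in> borel_measurable borel"
  using solution_continuous[OF assms] by (rule borel_measurable_continuous_onI)

lemma solution_pos: "positive_classical_solution \<alpha> c1 c2 q1 q2 u \<Longrightarrow> 0 < u y"
  by (simp add: positive_classical_solution_def)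

lemma solution_potential_integrable:
  fixes u :: "real^'n \<Rightarrow> real"
  assumes sol: "positive_classical_solution \<alpha> c1 c2 q1 q2 u" and "0 < c1"
  shows "integrable lborel (\<lambda>z. u z powr ((real CARD('n) + \<alpha>) / (real CARD('n) - \<alpha>)) *
     norm (z - y) powr (- (real CARD('n) - \<alpha>)))"
  using assms by (intro integrable_potential_lborel solution_borel[OF sol])
    (auto simp: positive_classical_solution_def)

lemma solution_frac_laplacian_pos:
  fixes u :: "real^'n \<Rightarrow> real"
  assumes sol: "positive_classical_solution \<alpha> c1 c2 q1 q2 u"
    and c: "0 \<le> c1" "0 \<le> c2" "0 < c1 + c2"
  shows "0 < frac_laplacian \<alpha> u y"
proof -
  have "0 < c1 * potential \<alpha> u y * u y powr q1 + c2 * u y powr q2"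
  proof (cases "0 < c1")
    case True
    have un: "u z \<noteq> 0" for z using solution_pos[OF sol, of z] by simp
    have "0 < potential \<alpha> u y"
      unfolding potential_lborel[OF solution_borel[OF sol]]
      by (rule integral_lborel_pos[OF solution_potential_integrable[OF sol True], of y])
        (use un in \<open>auto simp: zero_less_mult_iff\<close>)
    then show ?thesis
      using True c solution_pos[OF sol, of y] by (intro add_pos_nonneg) auto
  next
    case False
    then show ?thesis using c solution_pos[OF sol, of y] by simp
  qed
  then show ?thesis
    using sol by (simp add: positive_classical_solution_def)
qed

text \<open>Both sides carry the factor \<open>c1\<close> because finiteness of the potential is
  known for \<open>c1 > 0\<close> only.\<close>

lemma solution_potential_bounded:
  fixes u :: "real^'n \<Rightarrow> real"
  assumes sol: "positive_classical_solution \<alpha> c1 c2 q1 q2 u"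
    and \<alpha>: "0 < \<alpha>" "\<alpha> < real CARD('n)" and c1: "0 \<le> c1" and b: "0 < b"
    and U: "\<And>z. z \<in> cball x (2 * b) \<Longrightarrow> u z \<le> U"
  shows "\<exists>QB\<ge>0. \<forall>y. norm (y - x) \<le> b \<longrightarrow> c1 * potential \<alpha> u y \<le> c1 * QB"
proof (cases "0 < c1")
  case True
  define \<beta> where "\<beta> = real CARD('n) - \<alpha>"
  define p where "p = (real CARD('n) + \<alpha>) / \<beta>"
  have \<beta>: "0 < \<beta>" "\<beta> < real CARD('n)" "0 \<le> p" using \<alpha> by (auto simp: \<beta>_def p_def)
  define QB where "QB = U powr p * (LINT z|lborel. indicator (ball (0::real^'n) (3 * b)) z * norm z powr (- \<beta>))
      + 2 powr \<beta> * (LINT z|lborel. u z powr p * norm (z - x) powr (- \<beta>))"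
  have "0 \<le> QB" by (simp add: QB_def)
  moreover have "potential \<alpha> u y \<le> QB" if "norm (y - x) \<le> b" for y
    unfolding potential_lborel[OF solution_borel[OF sol]] \<beta>_def[symmetric] p_def[symmetric] QB_def
    using solution_potential_integrable[OF sol True] U that b \<beta>
    by (intro potential_le solution_borel[OF sol] solution_pos[OF sol]) (auto simp: \<beta>_def p_def)
  ultimately show ?thesis using True by (intro exI[of _ QB]) auto
qed (use c1 in auto)

lemma solution_bounds:
  assumes sol: "positive_classical_solution \<alpha> c1 c2 q1 q2 u"
  shows "\<exists>m U. 0 < m \<and> (\<forall>z\<in>cball x R. m \<le> u z \<and> u z \<le> U)"
proof (cases "0 \<le> R")
  case True
  have cont: "continuous_on (cball x R) u"
    using solution_continuous[OF sol] continuous_on_subset by blast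
  obtain p1 p2 where "\<forall>z\<in>cball x R. u p1 \<le> u z" "\<forall>z\<in>cball x R. u z \<le> u p2"
    using continuous_attains_inf[OF compact_cball _ cont] continuous_attains_sup[OF compact_cball _ cont] True
    by (metis cball_eq_empty not_less)
  then show ?thesis using solution_pos[OF sol, of p1] by blast
qed (auto intro: exI[of _ 1])

text \<open>In the outer half of the ball the inverse of \<open>y\<close> stays within
  \<open>2 * b\<close> of \<open>x\<close> and the Kelvin factor is at least 1; negativity of
  \<open>omega\<close> supplies the upper bound.\<close>

lemma kelvin_bounds:
  fixes u :: "real^'n \<Rightarrow> real"
  assumes mU: "\<And>z. z \<in> cball x (2 * b) \<Longrightarrow> m \<le> u z" "\<And>z. z \<in> cball x (2 * b) \<Longrightarrow> u z \<le> U" and m: "0 < m"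
    and y: "r / 2 \<le> norm (y - x)" "norm (y - x) < r" and r: "r \<le> b" and \<alpha>: "\<alpha> \<le> real CARD('n)"
    and neg: "omega \<alpha> u x r y < 0"
  shows "m \<le> kelvin \<alpha> u x r y" "kelvin \<alpha> u x r y \<le> u y" "u y \<le> U" "m \<le> u y"
proof -
  have r0: "0 < r" using y norm_ge_zero[of "y - x"] by linarith
  have yx: "y \<noteq> x" using y r0 by auto
  have "r\<^sup>2 \<le> (2 * b) * norm (y - x)"
    using mult_mono[of r "2 * b" "r / 2" "norm (y - x)"] y r r0
      mult_mono[of r b r "2 * norm (y - x)"] by (simp add: power2_eq_square)
  then have "r\<^sup>2 / norm (y - x) \<le> 2 * b"
    using yx by (simp add: field_simps)
  then have "dist (inversion x r y) x \<le> 2 * b"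
    using norm_inversion_diff[OF yx, of r] by (simp add: dist_norm)
  then have "m \<le> u (inversion x r y)" by (intro mU) (simp add: dist_commute)
  moreover have "1 \<le> (r / norm (y - x)) powr (real CARD('n) - \<alpha>)"
    using y yx \<alpha> by (intro ge_one_powr_ge_zero) (auto simp: field_simps)
  ultimately show "m \<le> kelvin \<alpha> u x r y"
    using mult_mono[of 1 "(r / norm (y - x)) powr (real CARD('n) - \<alpha>)" m "u (inversion x r y)"] m
    by (simp add: kelvin_def)
  show "kelvin \<alpha> u x r y \<le> u y" using neg by (simp add: omega_def)
  have "dist y x \<le> 2 * b" using y r by (simp add: dist_norm)
  then have "y \<in> cball x (2 * b)" by (simp add: dist_commute)
  then show "u y \<le> U" "m \<le> u y" using mU by auto
qed

text \<open>A negative value in \<Omega> makes \<open>B_minus\<close> nonempty; hypothesis (b) then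
  provides a minimum point, and (c) places it in \<Omega>.\<close>

lemma narrow_region_negative_min:
  assumes "narrow_region_hyps \<alpha> c1 c2 q1 q2 u x r l \<Omega>" and "y \<in> \<Omega>" "omega \<alpha> u x r y < 0"
  shows "\<exists>y0\<in>\<Omega>. neg_min_at \<alpha> u x r y0"
proof -
  have "r - l < norm (y - x)" "norm (y - x) < r" "l < r"
    using assms by (auto simp: narrow_region_hyps_def narrow_region_def)
  then have "y \<in> B_minus \<alpha> u x r"
    using assms(3) by (auto simp: B_minus_def dist_norm norm_minus_commute)
  then obtain y0 where "neg_min_at \<alpha> u x r y0"
    using assms(1) unfolding narrow_region_hyps_def by blast
  moreover from this have "y0 \<in> \<Omega>"
    using assms(1) by (auto simp: narrow_region_hyps_def neg_min_at_def)
  ultimately show ?thesis by blast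
qed

lemma isCont_omega:
  assumes cont: "continuous_on UNIV u" and "y \<noteq> x" and "0 < r"
  shows "isCont (omega \<alpha> u x r) y"
proof -
  have u: "isCont u z" for z using cont by (simp add: continuous_on_eq_continuous_at)
  have "isCont (inversion x r) y"
    using has_derivative_inversion[OF assms(2)] has_derivative_continuous by blast
  then have "isCont (\<lambda>z. u (inversion x r z)) y"
    using continuous_at_compose[of y "inversion x r" u] u by (simp add: o_def)
  then show ?thesis
    unfolding omega_def kelvin_def using assms(2,3) u by (intro continuous_intros) auto
qed

lemma threshold_fractional:
  fixes u :: "real^'n \<Rightarrow> real" and x :: "real^'n"
  assumes n2: "2 \<le> CARD('n)" and \<alpha>: "0 < \<alpha>" "\<alpha> < 2"
    and c: "0 \<le> c1" "0 \<le> c2" "0 < c1 + c2" and q: "0 < q1" "0 < q2"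
    and sol: "positive_classical_solution \<alpha> c1 c2 q1 q2 u"
    and ab: "0 < a" "a \<le> b"
  shows "\<exists>\<eta>>0. \<forall>r l \<Omega>. a \<le> r \<and> r \<le> b \<and> narrow_region_hyps \<alpha> c1 c2 q1 q2 u x r l \<Omega> \<and>
      (\<exists>y\<in>\<Omega>. omega \<alpha> u x r y < 0) \<longrightarrow> \<eta> \<le> l"
proof -
  let ?n = "CARD('n)"
  define \<beta> where "\<beta> = real ?n - \<alpha>"
  define p where "p = (real ?n + \<alpha>) / \<beta>"
  define e where "e = 2 * \<alpha> / \<beta>"
  have \<beta>: "0 < \<beta>" "\<beta> < real ?n" "\<alpha> < real ?n" using \<alpha> n2 by (auto simp: \<beta>_def)
  have p: "0 < p" "0 < e" using \<beta> \<alpha> by (auto simp: p_def e_def)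
  have ub [measurable]: "u \<in> borel_measurable borel" by (rule solution_borel[OF sol])
  have b: "0 < b" using ab by simp
  obtain m U where m: "0 < m" and mU: "\<And>z. z \<in> cball x (2 * b) \<Longrightarrow> m \<le> u z"
    "\<And>z. z \<in> cball x (2 * b) \<Longrightarrow> u z \<le> U"
    using solution_bounds[OF sol, of x "2 * b"] by blast
  have U: "0 < U" using mU[of x] m b by simp
  obtain QB where QB: "0 \<le> QB" "\<And>y. norm (y - x) \<le> b \<Longrightarrow> c1 * potential \<alpha> u y \<le> c1 * QB"
    using solution_potential_bounded[OF sol \<alpha>(1) \<beta>(3) c(1) b mU(2)] by blast
  define J where "J = U powr e * (LINT z|lborel. indicator (ball (0::real^'n) (2 * b)) z * norm z powr (- \<beta>))"
  have J: "0 \<le> J" by (simp add: J_def)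
  define T where "T q = m powr (q - 1) + U powr (q - 1)" for q
  \<comment> \<open>Bounds all coefficients for radii between \<open>a\<close> and \<open>b\<close>
    at once: the first two summands belong to \<open>L_coeff\<close>, the last to the integral over
    \<open>B_minus\<close>.\<close>
  define K where "K = c1 * QB * q1 * T q1 + c2 * q2 * T q2 + c1 * p * J * U powr q1"
  have K: "0 \<le> K" using c q QB p J by (simp add: K_def T_def)
  define \<kappa> where "\<kappa> = measure lborel (ball (0::real^'n) 1) * 3 powr (- (real ?n + \<alpha>))"
  have \<kappa>: "0 < \<kappa>" using measure_unit_ball_pos[where 'n='n] by (simp add: \<kappa>_def)
  define Cf where "Cf = frac_const TYPE('n) \<alpha>"
  \<comment> \<open>If the constant vanished, so would the operator on \<open>u\<close>, against the
    positive right-hand side of the equation.\<close>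
  have Cf: "0 < Cf"
  proof -
    have "u \<in> L_space \<alpha>" "C11_loc_on UNIV u"
      using sol \<alpha> by (auto simp: positive_classical_solution_def)
    then obtain L where "frac_laplacian \<alpha> u x = Cf * L"
      using frac_laplacian_limit[OF \<alpha> n2 ub, of UNIV x] by (auto simp: Cf_def)
    then show ?thesis
      using solution_frac_laplacian_pos[OF sol c, of x] frac_const_nonneg[where 'n='n, of \<alpha>]
      by (cases "Cf = 0") (auto simp: Cf_def)
  qed
  \<comment> \<open>\<open>a / 2\<close> keeps the minimum point in the outer half of the ball; the
    other bound makes \<open>Cf * \<kappa> * l powr (- \<alpha>)\<close> at least
    \<open>K + 1\<close>.\<close>
  define \<eta> where "\<eta> = min (a / 2) ((Cf * \<kappa> / (K + 1)) powr (1 / \<alpha>))"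
  have \<eta>: "0 < \<eta>" using ab Cf \<kappa> K by (simp add: \<eta>_def)
  have "\<eta> \<le> l" if r: "a \<le> r" "r \<le> b" and hyps: "narrow_region_hyps \<alpha> c1 c2 q1 q2 u x r l \<Omega>"
    and neg: "\<exists>y\<in>\<Omega>. omega \<alpha> u x r y < 0" for r l \<Omega>
  proof (rule ccontr)
    assume "\<not> \<eta> \<le> l"
    then have l\<eta>: "l < \<eta>" by simp
    define w where "w = omega \<alpha> u x r"
    obtain y where y: "y \<in> \<Omega>" "neg_min_at \<alpha> u x r y"
      using narrow_region_negative_min[OF hyps] neg by blast
    have l: "0 < l" "r - l < norm (y - x)" "norm (y - x) < r" "open \<Omega>"
      using hyps y(1) by (auto simp: narrow_region_hyps_def narrow_region_def)
    have r0: "0 < r" using r ab by simp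
    have wy: "w y < 0" "y \<noteq> x" "\<And>z. z \<in> ball x r - {x} \<Longrightarrow> w y \<le> w z"
      using y(2) by (auto simp: neg_min_at_def w_def)
    have half: "r / 2 \<le> norm (y - x)"
      using l l\<eta> r by (simp add: \<eta>_def)
    have wreg: "w \<in> L_space \<alpha>" "C11_loc_on \<Omega> w"
      using hyps \<alpha> by (auto simp: narrow_region_hyps_def omega_regular_def w_def)
    have wb [measurable]: "w \<in> borel_measurable borel"
      unfolding w_def by (rule borel_measurable_omega[OF ub])
    obtain L where L: "(truncated (real ?n + \<alpha>) w y \<longlongrightarrow> L) (at_right 0)" "frac_laplacian \<alpha> w y = Cf * L"
      using frac_laplacian_limit[OF \<alpha> n2 wb wreg(1) l(4) y(1) wreg(2)] by (auto simp: Cf_def)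
    have "eventually (\<lambda>\<epsilon>. truncated (real ?n + \<alpha>) w y \<epsilon> \<le> w y * (\<kappa> * l powr (- \<alpha>))) (at_right 0)"
      unfolding \<kappa>_def
      using truncated_at_negative_min[OF \<alpha> n2 wb L_space_integrable[OF wb wreg(1)] _ l(1-3) wy(2,1) _ wy(3)]
        omega_inversion[OF _ r0] isCont_omega[OF solution_continuous[OF sol] wy(2) r0]
      by (auto simp: w_def)
    then have Lle: "L \<le> w y * (\<kappa> * l powr (- \<alpha>))"
      using L(1) by (intro tendsto_upperbound) auto
    have kb: "m \<le> kelvin \<alpha> u x r y" "kelvin \<alpha> u x r y \<le> u y" "u y \<le> U" "m \<le> u y"
      using kelvin_bounds[of x b m u U r y \<alpha>] mU m half l(3) r \<beta>(3) wy(1) by (auto simp: w_def)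
    have Tmax: "max (u y powr (q - 1)) (kelvin \<alpha> u x r y powr (q - 1)) \<le> T q" for q
      unfolding T_def using kb m by (auto intro!: powr_le_sum_endpoints max.boundedI)
    have pQ: "c1 * potential \<alpha> u y \<le> c1 * QB" using l(3) r by (intro QB(2)) simp
    have max0: "0 \<le> max (u y powr (q - 1)) (kelvin \<alpha> u x r y powr (q - 1))" for q
      by (simp add: max.coboundedI1)
    have "(c1 * potential \<alpha> u y) * (q1 * max (u y powr (q1 - 1)) (kelvin \<alpha> u x r y powr (q1 - 1)))
        \<le> (c1 * QB) * (q1 * max (u y powr (q1 - 1)) (kelvin \<alpha> u x r y powr (q1 - 1)))"
      by (rule mult_right_mono[OF pQ]) (use q max0[of q1] in simp)
    also have "\<dots> \<le> (c1 * QB) * (q1 * T q1)"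
      by (rule mult_left_mono[OF mult_left_mono[OF Tmax]]) (use q c QB in auto)
    finally have "(c1 * potential \<alpha> u y) * (q1 * max (u y powr (q1 - 1)) (kelvin \<alpha> u x r y powr (q1 - 1)))
        \<le> (c1 * QB) * (q1 * T q1)" .
    moreover have "c2 * q2 * max (u y powr (q2 - 1)) (kelvin \<alpha> u x r y powr (q2 - 1)) \<le> c2 * q2 * T q2"
      using c q Tmax by (intro mult_left_mono) auto
    ultimately have Lc: "L_coeff \<alpha> c1 c2 q1 q2 u x r y \<le> c1 * QB * q1 * T q1 + c2 * q2 * T q2"
      by (simp add: L_coeff_def mult_ac)
    define B where "B = B_minus \<alpha> u x r"
    have Beq: "B = (ball x r - {x}) \<inter> w -` {..<0} \<inter> space borel"
      by (auto simp: B_def B_minus_def w_def)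
    have [measurable]: "B \<in> sets borel"
      unfolding Beq using measurable_sets[OF wb, of "{..<0}"] by (auto simp: Int_assoc)
    define g where "g z = indicator B z *\<^sub>R (u z powr e * w z / norm (y - z) powr \<beta>)" for z
    define N where "N = (LINT z:B|lebesgue. u z powr e * w z / norm (y - z) powr \<beta>)"
    have [measurable]: "g \<in> borel_measurable borel" unfolding g_def[abs_def] by measurable
    have N_eq: "N = (LINT z|lborel. g z)"
      unfolding N_def set_lebesgue_integral_def g_def by (rule integral_completion) measurable
    \<comment> \<open>Worst case for the nonlocal term: \<open>w\<close> is replaced by its minimum,
      \<open>u\<close> by its upper bound and \<open>B\<close> by a ball about \<open>y\<close>,
      each of which lowers the integral.\<close>
    define h where "h z = (w y * U powr e) * (indicator (ball y (2 * b)) z * norm (z - y) powr (- \<beta>))" for z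
    have hi: "integrable lborel h"
      unfolding h_def[abs_def] using \<beta> by (intro integrable_mult_right integrable_norm_powr_ball) auto
    have h_int: "(LINT z|lborel. h z) = w y * J"
      unfolding h_def J_def by (simp add: integral_norm_powr_ball)
    have hg: "h z \<le> g z" for z
    proof (cases "z \<in> B")
      case True
      then have zb: "z \<in> ball x r - {x}" "w z < 0" by (auto simp: B_def B_minus_def w_def)
      have zx: "norm (z - x) < r" using zb by (simp add: dist_norm norm_minus_commute)
      then have "norm (z - y) < 2 * b"
        using norm_triangle_ineq[of "z - x" "x - y"] l(3) r by (simp add: norm_minus_commute)
      then have zy: "z \<in> ball y (2 * b)" by (simp add: dist_norm norm_minus_commute)
      have "dist z x \<le> 2 * b" using zx r r0 by (simp add: dist_norm)
      then have "u z \<le> U" by (intro mU) (simp add: dist_commute)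
      then have "u z powr e \<le> U powr e"
        using solution_pos[OF sol, of z] p by (intro powr_mono2) auto
      then have "u z powr e * (- w z) \<le> U powr e * (- w y)"
        using wy(3)[OF zb(1)] zb(2) by (intro mult_mono) auto
      then have "w y * U powr e \<le> u z powr e * w z" by (simp add: mult.commute)
      then have "(w y * U powr e) * norm (z - y) powr (- \<beta>) \<le> (u z powr e * w z) * norm (z - y) powr (- \<beta>)"
        by (rule mult_right_mono) simp
      then show ?thesis
        using True zy by (simp add: h_def g_def powr_minus divide_inverse norm_minus_commute[of y])
    next
      case False
      then show ?thesis using wy(1) by (auto simp: h_def g_def indicator_def mult_nonpos_nonneg)
    qed
    \<comment> \<open>Should \<open>g\<close> fail to be integrable, its integral is 0 by
      convention, and the bound \<open>w y * J\<close> is nonpositive.\<close>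
    have NJ: "w y * J \<le> N"
    proof (cases "integrable lborel g")
      case True
      then show ?thesis unfolding N_eq h_int[symmetric] using hi hg by (intro integral_mono) auto
    next
      case False
      then show ?thesis
        using wy(1) J by (simp add: N_eq not_integrable_integral_eq mult_nonpos_nonneg)
    qed
    have "y \<in> \<Omega> \<inter> B_minus \<alpha> u x r"
      using y by (auto simp: B_minus_def neg_min_at_def)
    then have "0 \<le> frac_laplacian \<alpha> w y - L_coeff \<alpha> c1 c2 q1 q2 u x r y * w y - c1 * p * N * u y powr q1"
      using hyps by (simp add: narrow_region_hyps_def omega_inequality_def w_def N_def B_def p_def e_def \<beta>_def)
    moreover have "Cf * L \<le> Cf * (w y * (\<kappa> * l powr (- \<alpha>)))"
      using Lle Cf by (intro mult_left_mono) auto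
    moreover have "L_coeff \<alpha> c1 c2 q1 q2 u x r y * (- w y) \<le> (c1 * QB * q1 * T q1 + c2 * q2 * T q2) * (- w y)"
      using Lc wy(1) by (intro mult_right_mono) auto
    moreover have "c1 * p * (- N) * u y powr q1 \<le> c1 * p * ((- w y) * J) * U powr q1"
    proof -
      have up: "u y powr q1 \<le> U powr q1" using kb solution_pos[OF sol, of y] q by (intro powr_mono2) auto
      have "c1 * p * (- N) * u y powr q1 \<le> c1 * p * ((- w y) * J) * u y powr q1"
        using c p NJ by (intro mult_right_mono mult_left_mono) auto
      also have "\<dots> \<le> c1 * p * ((- w y) * J) * U powr q1"
        using c p J wy(1) up by (intro mult_left_mono) (auto simp: mult_nonpos_nonneg mult_nonneg_nonpos)
      finally show ?thesis .
    qed
    ultimately have "0 \<le> (- w y) * (K - Cf * \<kappa> * l powr (- \<alpha>))"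
      by (simp add: L(2) K_def algebra_simps)
    then have "Cf * \<kappa> * l powr (- \<alpha>) \<le> K"
      using wy(1) by (simp add: mult_le_0_iff)
    then have "Cf * \<kappa> * l powr (- \<alpha>) < K + 1" by simp
    moreover have "l powr \<alpha> \<le> Cf * \<kappa> / (K + 1)"
    proof -
      have "l powr \<alpha> \<le> ((Cf * \<kappa> / (K + 1)) powr (1 / \<alpha>)) powr \<alpha>"
        using l l\<eta> \<alpha> by (intro powr_mono2) (auto simp: \<eta>_def)
      then show ?thesis using \<alpha> Cf \<kappa> K by (simp add: powr_powr)
    qed
    ultimately show False
      using l(1) K Cf \<kappa> by (simp add: powr_minus field_simps)
  qed
  then show ?thesis using \<eta> by blast
qed

subsection \<open>Second derivatives along the axes\<close>

text \<open>A relation instead of nested \<open>deriv\<close> terms: existence of the derivatives is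
  part of it, and the first derivative is required near 0 only, as suits functions that are singular
  at \<open>x\<close>.\<close>

definition line_deriv2 :: "(real^'n \<Rightarrow> real) \<Rightarrow> real^'n \<Rightarrow> 'n \<Rightarrow> real \<Rightarrow> bool" where
  "line_deriv2 w y i D \<longleftrightarrow> (\<exists>\<phi>.
     (\<forall>\<^sub>F t in nhds 0. ((\<lambda>t. w (y + t *\<^sub>R axis i 1)) has_real_derivative \<phi> t) (at t)) \<and>
     (\<phi> has_real_derivative D) (at 0))"

lemma line_deriv2_add:
  assumes "line_deriv2 v y i D" "line_deriv2 w y i E"
  shows "line_deriv2 (\<lambda>z. v z + w z) y i (D + E)"
proof -
  obtain \<phi> \<psi> where *: "\<forall>\<^sub>F t in nhds 0. ((\<lambda>t. v (y + t *\<^sub>R axis i 1)) has_real_derivative \<phi> t) (at t)"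
    "(\<phi> has_real_derivative D) (at 0)"
    "\<forall>\<^sub>F t in nhds 0. ((\<lambda>t. w (y + t *\<^sub>R axis i 1)) has_real_derivative \<psi> t) (at t)"
    "(\<psi> has_real_derivative E) (at 0)"
    using assms unfolding line_deriv2_def by blast
  have "\<forall>\<^sub>F t in nhds 0. ((\<lambda>t. v (y + t *\<^sub>R axis i 1) + w (y + t *\<^sub>R axis i 1)) has_real_derivative \<phi> t + \<psi> t) (at t)"
    using *(1,3) by eventually_elim (rule DERIV_add)
  then show ?thesis
    unfolding line_deriv2_def using DERIV_add[OF *(2,4)] by (intro exI[of _ "\<lambda>t. \<phi> t + \<psi> t"] conjI)
qed

lemma line_deriv2_cmult:
  assumes "line_deriv2 w y i D"
  shows "line_deriv2 (\<lambda>z. c * w z) y i (c * D)"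
proof -
  obtain \<phi> where *: "\<forall>\<^sub>F t in nhds 0. ((\<lambda>t. w (y + t *\<^sub>R axis i 1)) has_real_derivative \<phi> t) (at t)"
    "(\<phi> has_real_derivative D) (at 0)"
    using assms unfolding line_deriv2_def by blast
  have "\<forall>\<^sub>F t in nhds 0. ((\<lambda>t. c * w (y + t *\<^sub>R axis i 1)) has_real_derivative c * \<phi> t) (at t)"
    using *(1) by eventually_elim (rule DERIV_cmult)
  then show ?thesis
    unfolding line_deriv2_def using DERIV_cmult[OF *(2), of c] by (intro exI[of _ "\<lambda>t. c * \<phi> t"] conjI)
qed

text \<open>The first derivative vanishes at the minimum; were \<open>D\<close> negative, it would
  be negative just to the right of 0 and the function would fall below its minimum.\<close>

lemma line_deriv2_local_min:
  assumes d2: "line_deriv2 w y i D" and min: "\<forall>\<^sub>F z in nhds y. w y \<le> w z"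
  shows "0 \<le> D"
proof (rule ccontr)
  assume "\<not> 0 \<le> D"
  then have D: "D < 0" by simp
  define f where "f t = w (y + t *\<^sub>R axis i 1)" for t
  obtain \<phi> where ev: "\<forall>\<^sub>F t in nhds 0. (f has_real_derivative \<phi> t) (at t)"
    and D': "(\<phi> has_real_derivative D) (at 0)"
    using d2 unfolding line_deriv2_def f_def by blast
  have lim: "((\<lambda>t. y + t *\<^sub>R axis i 1) \<longlongrightarrow> y + 0 *\<^sub>R axis i 1) (nhds 0)"
    by (intro tendsto_intros filterlim_ident)
  have "\<forall>\<^sub>F t in nhds 0. w y \<le> f t"
    unfolding f_def by (rule eventually_compose_filterlim[OF min]) (use lim in simp)
  then have "\<forall>\<^sub>F t in nhds 0. w y \<le> f t \<and> (f has_real_derivative \<phi> t) (at t)"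
    using ev by eventually_elim simp
  then obtain d where d: "0 < d" "\<And>t. \<bar>t\<bar> < d \<Longrightarrow> w y \<le> f t"
    "\<And>t. \<bar>t\<bar> < d \<Longrightarrow> (f has_real_derivative \<phi> t) (at t)"
    unfolding eventually_nhds_metric by (auto simp: dist_real_def)
  have f0: "f 0 = w y" by (simp add: f_def)
  have \<phi>0: "\<phi> 0 = 0"
    using d by (intro DERIV_local_min[OF d(3)[of 0] d(1)]) (auto simp: f0)
  obtain e where e: "0 < e" "\<And>h. 0 < h \<Longrightarrow> h < e \<Longrightarrow> \<phi> h < 0"
    using DERIV_neg_dec_right[OF D' D] \<phi>0 by auto
  define h where "h = min d e / 2"
  have h: "0 < h" "h < d" "h < e" using d e by (auto simp: h_def)
  have "f h < f 0"
  proof (rule DERIV_neg_imp_decreasing_open[OF h(1)])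
    fix t assume "0 < t" "t < h"
    then show "\<exists>z. (f has_real_derivative z) (at t) \<and> z < 0"
      using d(3)[of t] e(2)[of t] h by auto
  next
    show "continuous_on {0..h} f"
      using d(3) h by (intro DERIV_continuous_on[where D=\<phi>]) (auto intro: has_field_derivative_at_within)
  qed
  then show False using d(2)[of h] h by (simp add: f0)
qed

lemma has_real_derivative_along_curve:
  fixes u :: "'a::euclidean_space \<Rightarrow> real"
  assumes "(u has_derivative (\<lambda>h. g \<bullet> h)) (at (c t))" "(c has_vector_derivative c') (at t)"
  shows "((\<lambda>t. u (c t)) has_real_derivative g \<bullet> c') (at t)"
  using vector_derivative_diff_chain_within[OF assms(2), of u "\<lambda>h. g \<bullet> h"] assms(1)
  by (simp add: o_def has_real_derivative_iff_has_vector_derivative has_derivative_at_withinI)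

lemma has_vector_derivative_along_curve:
  fixes G :: "real^'n \<Rightarrow> real^'n"
  assumes "(G has_derivative (\<lambda>h. H *v h)) (at (c t))" "(c has_vector_derivative c') (at t)"
  shows "((\<lambda>t. G (c t)) has_vector_derivative H *v c') (at t)"
  using vector_derivative_diff_chain_within[OF assms(2), of G "\<lambda>h. H *v h"] assms(1)
  by (simp add: o_def has_derivative_at_withinI)

lemma has_vector_derivative_line: "((\<lambda>t. y + t *\<^sub>R e) has_vector_derivative e) (at t)"
  by (auto intro!: derivative_eq_intros simp: has_vector_derivative_def)

lemma line_deriv2_C2:
  fixes u :: "real^'n \<Rightarrow> real"
  assumes G: "\<And>y. (u has_derivative (\<lambda>h. G y \<bullet> h)) (at y)"
    and H: "\<And>y. (G has_derivative (\<lambda>h. H y *v h)) (at y)"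
  shows "line_deriv2 u y i (H y $ i $ i)"
  unfolding line_deriv2_def
proof (intro exI conjI)
  show "\<forall>\<^sub>F t in nhds 0. ((\<lambda>t. u (y + t *\<^sub>R axis i 1)) has_real_derivative G (y + t *\<^sub>R axis i 1) $ i) (at t)"
    using has_real_derivative_along_curve[OF G has_vector_derivative_line[of y "axis i 1"]]
    by (intro always_eventually allI) (simp add: inner_axis)
  have "((\<lambda>t. G (y + t *\<^sub>R axis i 1) \<bullet> axis i 1) has_real_derivative (H (y + 0 *\<^sub>R axis i 1) *v axis i 1) \<bullet> axis i 1) (at 0)"
    unfolding has_real_derivative_iff_has_vector_derivative
    by (rule bounded_linear.has_vector_derivative[OF bounded_linear_inner_left])
      (rule has_vector_derivative_along_curve[OF H has_vector_derivative_line])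
  then show "((\<lambda>t. G (y + t *\<^sub>R axis i 1) $ i) has_real_derivative H y $ i $ i) (at 0)"
    by (simp add: inner_axis matrix_vector_mult_basis column_def)
qed

lemma laplacian_C2:
  fixes u :: "real^'n \<Rightarrow> real"
  assumes G: "\<And>y. (u has_derivative (\<lambda>h. G y \<bullet> h)) (at y)"
    and H: "\<And>y. (G has_derivative (\<lambda>h. H y *v h)) (at y)"
  shows "laplacian u y = (\<Sum>i\<in>UNIV. H y $ i $ i)"
proof -
  have 1: "partial_deriv i u = (\<lambda>y. G y $ i)" for i
    using has_real_derivative_along_curve[OF G has_vector_derivative_line[of _ "axis i 1" 0]]
    by (auto simp: partial_deriv_def inner_axis fun_eq_iff intro!: DERIV_imp_deriv)
  have 2: "partial_deriv i (\<lambda>y. G y $ i) y = H y $ i $ i" for i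
  proof -
    have "((\<lambda>t. G (y + t *\<^sub>R axis i 1) \<bullet> axis i 1) has_real_derivative (H (y + 0 *\<^sub>R axis i 1) *v axis i 1) \<bullet> axis i 1) (at 0)"
      unfolding has_real_derivative_iff_has_vector_derivative
      by (rule bounded_linear.has_vector_derivative[OF bounded_linear_inner_left])
        (rule has_vector_derivative_along_curve[OF H has_vector_derivative_line])
    then show ?thesis
      by (auto simp: partial_deriv_def inner_axis matrix_vector_mult_basis column_def intro!: DERIV_imp_deriv)
  qed
  show ?thesis by (simp add: laplacian_def 1 2)
qed

section \<open>Radial powers and Kelvin transforms along the axes\<close>

lemma norm_line_square:
  fixes v :: "real^'n"
  shows "(norm (v + t *\<^sub>R axis i 1))\<^sup>2 = (norm v)\<^sup>2 + 2 * t * v $ i + t\<^sup>2"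
  unfolding power2_norm_eq_inner
  by (simp add: inner_add inner_axis inner_axis' power2_eq_square algebra_simps)

lemma line_square_derivs:
  fixes \<sigma> b :: real
  shows "((\<lambda>t. \<sigma> + 2 * t * b + t\<^sup>2) has_real_derivative 2 * b + 2 * t) (at t)"
    "((\<lambda>t. 2 * b + 2 * t) has_real_derivative 2) (at t)"
  by (auto intro!: derivative_eq_intros)

text \<open>Along an axis the squared distance is such a quadratic polynomial \<open>s\<close>, with
  \<open>b\<close> the coordinate of the base vector; powers of \<open>s\<close> avoid
  differentiating the norm.\<close>

lemma line_square_powr_derivs:
  fixes s s1 :: "real \<Rightarrow> real"
  assumes s: "s = (\<lambda>t. \<sigma> + 2 * t * b + t\<^sup>2)" and s1: "s1 = (\<lambda>t. 2 * b + 2 * t)" and pos: "0 < s t"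
  shows "((\<lambda>t. s t powr (- a)) has_real_derivative - a * s t powr (- a - 1) * s1 t) (at t)"
    "((\<lambda>t. - a * s t powr (- a - 1) * s1 t) has_real_derivative
        - a * ((- a - 1) * s t powr (- a - 2) * (s1 t)\<^sup>2 + 2 * s t powr (- a - 1))) (at t)"
proof -
  have d: "(s has_real_derivative s1 t) (at t)" "(s1 has_real_derivative 2) (at t)"
    unfolding s s1 by (rule line_square_derivs)+
  have pw: "((\<lambda>t. s t powr q) has_real_derivative q * s t powr (q - 1) * s1 t) (at t)" for q
    by (rule DERIV_chain2[OF has_real_derivative_powr[OF pos] d(1)])
  show "((\<lambda>t. s t powr (- a)) has_real_derivative - a * s t powr (- a - 1) * s1 t) (at t)"
    by (rule pw)
  have "((\<lambda>t. - a * (s t powr (- a - 1) * s1 t)) has_real_derivative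
      - a * (((- a - 1) * s t powr (- a - 1 - 1) * s1 t) * s1 t + 2 * s t powr (- a - 1))) (at t)"
    by (rule DERIV_cmult[OF DERIV_mult[OF pw d(2)]])
  moreover have "- a - 1 - 1 = - a - 2" by simp
  ultimately show "((\<lambda>t. - a * s t powr (- a - 1) * s1 t) has_real_derivative
        - a * ((- a - 1) * s t powr (- a - 2) * (s1 t)\<^sup>2 + 2 * s t powr (- a - 1))) (at t)"
    by (simp only: power2_eq_square mult.assoc)
qed

lemma eventually_line_square_pos:
  "0 < (\<sigma>::real) \<Longrightarrow> \<forall>\<^sub>F t in nhds 0. 0 < \<sigma> + 2 * t * b + t\<^sup>2"
proof -
  assume "0 < \<sigma>"
  moreover have "((\<lambda>t. \<sigma> + 2 * t * b + t\<^sup>2) \<longlongrightarrow> \<sigma> + 2 * 0 * b + 0\<^sup>2) (nhds (0::real))"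
    by (intro tendsto_intros filterlim_ident)
  ultimately show ?thesis by (auto dest: order_tendstoD(1))
qed

lemma powr_divide_eq_mult:
  "0 \<le> x \<Longrightarrow> 0 \<le> y \<Longrightarrow> (x / y) powr c = x powr c * y powr (- c :: real)"
  by (simp add: powr_divide powr_minus_divide)

lemma norm_powr_eq: "norm v powr (- (2 * a)) = ((norm v)\<^sup>2) powr (- a)"
proof (cases "v = 0")
  case False
  then show ?thesis using powr_powr[of "norm v" 2 "- a"] by simp
qed simp

text \<open>Harmonicity of the fundamental solution, seen as the power \<open>- a\<close> of the
  squared distance. The second derivatives add up to a multiple of 4 (- a - 1) + 2n, which is 0
  because n = 2a + 2.\<close>

lemma fundamental_line_deriv2:
  fixes x y :: "real^'n"
  assumes y: "y \<noteq> x" and a: "2 * a = real CARD('n) - 2"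
  shows "\<exists>D. (\<forall>i. line_deriv2 (\<lambda>z. norm (z - x) powr (- (2 * a))) y i (D i)) \<and> (\<Sum>i\<in>UNIV. D i) = 0"
proof -
  define v where "v = y - x"
  define \<sigma> where "\<sigma> = (norm v)\<^sup>2"
  have \<sigma>: "0 < \<sigma>" using y by (simp add: \<sigma>_def v_def)
  define D where "D i = - a * ((- a - 1) * \<sigma> powr (- a - 2) * (2 * v $ i)\<^sup>2 + 2 * \<sigma> powr (- a - 1))" for i
  have "line_deriv2 (\<lambda>z. norm (z - x) powr (- (2 * a))) y i (D i)" for i
  proof -
    define s where "s = (\<lambda>t. \<sigma> + 2 * t * v $ i + t\<^sup>2)"
    note pd = line_square_powr_derivs[OF s_def refl, where a=a]
    have eq: "norm (y + t *\<^sub>R axis i 1 - x) powr (- (2 * a)) = s t powr (- a)" for t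
    proof -
      have "y + t *\<^sub>R axis i 1 - x = v + t *\<^sub>R axis i 1" by (simp add: v_def)
      then show ?thesis
        by (simp only: norm_powr_eq norm_line_square s_def \<sigma>_def)
    qed
    have "\<forall>\<^sub>F t in nhds 0. ((\<lambda>t. s t powr (- a)) has_real_derivative - a * s t powr (- a - 1) * (2 * v $ i + 2 * t)) (at t)"
      using eventually_line_square_pos[OF \<sigma>, of "v $ i"]
      by eventually_elim (rule pd(1), simp add: s_def)
    moreover have "((\<lambda>t. - a * s t powr (- a - 1) * (2 * v $ i + 2 * t)) has_real_derivative D i) (at 0)"
      using pd(2)[of 0] \<sigma> by (simp add: s_def D_def)
    ultimately show ?thesis
      unfolding line_deriv2_def eq by (intro exI conjI)
  qed
  moreover have "(\<Sum>i\<in>UNIV. D i) = 0"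
  proof -
    have vv: "(\<Sum>i\<in>UNIV. (v $ i)\<^sup>2) = \<sigma>"
      unfolding \<sigma>_def power2_norm_eq_inner by (simp add: inner_vec_def power2_eq_square)
    have "D i = (- a * ((- a - 1) * \<sigma> powr (- a - 2) * 4)) * (v $ i)\<^sup>2 + (- a * (2 * \<sigma> powr (- a - 1)))" for i
      by (simp add: D_def power_mult_distrib algebra_simps)
    then have "(\<Sum>i\<in>UNIV. D i) = (- a * ((- a - 1) * \<sigma> powr (- a - 2) * 4)) * (\<Sum>i\<in>UNIV. (v $ i)\<^sup>2) + real CARD('n) * (- a * (2 * \<sigma> powr (- a - 1)))"
      by (simp only: sum.distrib sum_distrib_left[symmetric] sum_constant) (simp only: mult_ac)
    also have "\<dots> = - a * ((- a - 1) * (\<sigma> powr (- a - 2) * 4 * (\<Sum>i\<in>UNIV. (v $ i)\<^sup>2)) + 2 * real CARD('n) * \<sigma> powr (- a - 1))"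
      by (simp add: algebra_simps)
    also have "\<sigma> powr (- a - 2) * 4 * (\<Sum>i\<in>UNIV. (v $ i)\<^sup>2) = 4 * \<sigma> powr (- a - 1)"
    proof -
      have "\<sigma> powr (- a - 2) * \<sigma> = \<sigma> powr (- a - 2) * \<sigma> powr 1" using \<sigma> by simp
      also have "\<dots> = \<sigma> powr (- a - 2 + 1)" by (simp only: powr_add)
      also have "- a - 2 + 1 = - a - 1" by simp
      finally show ?thesis unfolding vv by simp
    qed
    finally have *: "(\<Sum>i\<in>UNIV. D i) = - a * ((- a - 1) * (4 * \<sigma> powr (- a - 1)) + 2 * real CARD('n) * \<sigma> powr (- a - 1))" .
    have nn: "real CARD('n) = 2 * a + 2" using a by simp
    show ?thesis unfolding * nn by (simp add: algebra_simps)
  qed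
  ultimately show ?thesis by blast
qed

lemma quadratic_line_deriv2:
  fixes x y :: "real^'n"
  shows "line_deriv2 (\<lambda>z. R - (norm (z - x))\<^sup>2) y i (- 2)"
  unfolding line_deriv2_def
proof (intro exI conjI)
  define v where "v = y - x"
  have eq: "R - (norm (y + t *\<^sub>R axis i 1 - x))\<^sup>2 = R - ((norm v)\<^sup>2 + 2 * t * v $ i + t\<^sup>2)" for t
    using norm_line_square[of v t i] by (simp add: v_def algebra_simps)
  show "\<forall>\<^sub>F t in nhds 0. ((\<lambda>t. R - (norm (y + t *\<^sub>R axis i 1 - x))\<^sup>2) has_real_derivative - (2 * v $ i + 2 * t)) (at t)"
    unfolding eq by (intro always_eventually allI) (auto intro!: derivative_eq_intros)
  show "((\<lambda>t. - (2 * v $ i + 2 * t)) has_real_derivative - 2) (at 0)"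
    by (auto intro!: derivative_eq_intros)
qed

text \<open>The vectors \<open>E i\<close> are the images of the axes under a reflection, so this is
  invariance of the trace under orthogonal conjugation. In the expansion the two cross terms cancel
  against the quadratic one.\<close>

lemma trace_conjugate_reflection:
  fixes A :: "real^'n^'n" and v :: "real^'n"
  assumes v: "v \<noteq> 0"
  defines "E \<equiv> \<lambda>i. axis i 1 - (2 * v $ i / (v \<bullet> v)) *\<^sub>R v"
  shows "(\<Sum>i\<in>UNIV. (A *v E i) \<bullet> E i) = (\<Sum>i\<in>UNIV. A $ i $ i)"
proof -
  define k where "k = 2 / (v \<bullet> v)"
  have vv: "v \<bullet> v \<noteq> 0" using v by simp
  have vs: "(\<Sum>i\<in>UNIV. v $ i *\<^sub>R axis i 1) = v"
    using basis_expansion[of v] by (simp add: scalar_mult_eq_scaleR)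
  have s2: "(\<Sum>i\<in>UNIV. v $ i * v $ i) = v \<bullet> v" by (simp add: inner_vec_def)
  have e: "(A *v E i) \<bullet> E i = A $ i $ i - k * (v $ i * ((A *v axis i 1) \<bullet> v))
      - k * (v $ i * ((A *v v) \<bullet> axis i 1)) + k\<^sup>2 * ((A *v v) \<bullet> v) * (v $ i * v $ i)" for i
  proof -
    have Ei: "E i = axis i 1 - (k * v $ i) *\<^sub>R v" by (simp add: E_def k_def)
    have "(A *v E i) \<bullet> E i = (A *v axis i 1) \<bullet> axis i 1 - k * (v $ i * ((A *v axis i 1) \<bullet> v))
      - k * (v $ i * ((A *v v) \<bullet> axis i 1)) + k\<^sup>2 * ((A *v v) \<bullet> v) * (v $ i * v $ i)"
      unfolding Ei by (simp add: matrix_vector_mult_diff_distrib matrix_vector_mult_scaleR inner_diff_left inner_diff_right power2_eq_square algebra_simps)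
    moreover have "(A *v axis i 1) \<bullet> axis i 1 = A $ i $ i"
      by (simp add: inner_axis matrix_vector_mult_basis column_def)
    ultimately show ?thesis by simp
  qed
  have m1: "(\<Sum>i\<in>UNIV. v $ i * ((A *v axis i 1) \<bullet> v)) = (A *v v) \<bullet> v"
  proof -
    have "(A *v v) \<bullet> v = (A *v (\<Sum>i\<in>UNIV. v $ i *\<^sub>R axis i 1)) \<bullet> v" by (simp only: vs)
    also have "\<dots> = (\<Sum>i\<in>UNIV. v $ i * ((A *v axis i 1) \<bullet> v))"
      by (simp add: linear_sum[OF matrix_vector_mul_linear] matrix_vector_mult_scaleR inner_sum_left)
    finally show ?thesis ..
  qed
  have m2: "(\<Sum>i\<in>UNIV. v $ i * ((A *v v) \<bullet> axis i 1)) = (A *v v) \<bullet> v"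
    by (simp add: inner_axis inner_vec_def[of "A *v v" v] mult.commute)
  have "(\<Sum>i\<in>UNIV. (A *v E i) \<bullet> E i) = (\<Sum>i\<in>UNIV. A $ i $ i) - k * ((A *v v) \<bullet> v)
      - k * ((A *v v) \<bullet> v) + k\<^sup>2 * ((A *v v) \<bullet> v) * (v \<bullet> v)"
    unfolding e by (simp add: sum.distrib sum_subtractf sum_distrib_left[symmetric] m1 m2 s2)
  also have "k\<^sup>2 * ((A *v v) \<bullet> v) * (v \<bullet> v) = 2 * (k * ((A *v v) \<bullet> v))"
    using vv by (simp add: k_def power2_eq_square field_simps)
  finally show ?thesis by simp
qed

text \<open>Conformal covariance of the Laplacian. Along an axis the Kelvin transform is a radial
  power times \<open>u\<close> on the inverted line; after summation the terms in \<open>u\<close>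
  vanish by harmonicity, those in \<open>G\<close> cancel, and the Hessian enters conjugated by a
  reflection.\<close>

lemma kelvin_line_deriv2:
  fixes u :: "real^'n \<Rightarrow> real" and x y :: "real^'n"
  assumes G: "\<And>y. (u has_derivative (\<lambda>h. G y \<bullet> h)) (at y)"
    and H: "\<And>y. (G has_derivative (\<lambda>h. H y *v h)) (at y)"
    and y: "y \<noteq> x" and r: "0 < r"
  shows "\<exists>D. (\<forall>i. line_deriv2 (kelvin 2 u x r) y i (D i)) \<and>
    (\<Sum>i\<in>UNIV. D i) = (r / norm (y - x)) powr (real CARD('n) + 2) * (\<Sum>i\<in>UNIV. H (inversion x r y) $ i $ i)"
proof -
  define a where "a = (real CARD('n) - 2) / 2"
  have a: "real CARD('n) - 2 = 2 * a" by (simp add: a_def)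
  define v where "v = y - x"
  have v: "v \<noteq> 0" using y by (simp add: v_def)
  define \<sigma> where "\<sigma> = (norm v)\<^sup>2"
  have \<sigma>: "0 < \<sigma>" using v by (simp add: \<sigma>_def)
  have vv: "v \<bullet> v = \<sigma>" by (simp add: \<sigma>_def power2_norm_eq_inner)
  define C where "C = r powr (2 * a)"
  define p where "p = inversion x r y"
  have p: "p = x + (r\<^sup>2 / \<sigma>) *\<^sub>R v" by (simp add: p_def inversion_def v_def \<sigma>_def)
  \<comment> \<open>\<open>h0\<close>, \<open>h1\<close>, \<open>h2\<close> are the radial power and
    its two derivatives along the axis; \<open>c1\<close>, \<open>c2\<close> are the derivatives of
    \<open>r\<^sup>2 / s\<close>, and \<open>j1\<close>, \<open>j2\<close> those of the inverted
    line, all at parameter 0.\<close>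
  define h0 where "h0 = \<sigma> powr (- a)"
  define h1 where "h1 i = - a * \<sigma> powr (- a - 1) * (2 * v $ i)" for i
  define h2 where "h2 i = - a * ((- a - 1) * \<sigma> powr (- a - 2) * (2 * v $ i)\<^sup>2 + 2 * \<sigma> powr (- a - 1))" for i
  define c1 where "c1 i = - (r\<^sup>2 * (2 * v $ i)) / \<sigma>\<^sup>2" for i
  define c2 where "c2 i = r\<^sup>2 * (2 * (2 * v $ i)\<^sup>2 / \<sigma> ^ 3 - 2 / \<sigma>\<^sup>2)" for i
  define j1 where "j1 i = (r\<^sup>2 / \<sigma>) *\<^sub>R axis i 1 + c1 i *\<^sub>R v" for i
  define j2 where "j2 i = (2 * c1 i) *\<^sub>R axis i 1 + c2 i *\<^sub>R v" for i
  define D where "D i = C * (h2 i * u p + 2 * (h1 i * (G p \<bullet> j1 i)) + h0 * ((H p *v j1 i) \<bullet> j1 i + G p \<bullet> j2 i))" for i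
  have ld: "line_deriv2 (kelvin 2 u x r) y i (D i)" for i
  proof -
    let ?e = "axis i 1 :: real^'n"
    define b where "b = v $ i"
    define s where "s = (\<lambda>t. \<sigma> + 2 * t * b + t\<^sup>2)"
    define s1 where "s1 = (\<lambda>t. 2 * b + 2 * t)"
    note pd = line_square_powr_derivs[OF s_def s1_def, where a=a]
    define \<gamma> where "\<gamma> t = r\<^sup>2 / s t" for t
    define \<gamma>1 where "\<gamma>1 t = - (r\<^sup>2 * s1 t) / (s t)\<^sup>2" for t
    define Jc where "Jc t = x + \<gamma> t *\<^sub>R (v + t *\<^sub>R ?e)" for t
    define J1 where "J1 t = \<gamma> t *\<^sub>R ?e + \<gamma>1 t *\<^sub>R (v + t *\<^sub>R ?e)" for t
    define hf where "hf t = s t powr (- a)" for t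
    define hf1 where "hf1 t = - a * s t powr (- a - 1) * s1 t" for t
    have ds: "(s has_real_derivative s1 t) (at t)" "(s1 has_real_derivative 2) (at t)" for t
      unfolding s_def s1_def by (rule line_square_derivs)+
    have s0: "s 0 = \<sigma>" "s1 0 = 2 * b" by (simp_all add: s_def s1_def)
    have d\<gamma>: "(\<gamma> has_real_derivative \<gamma>1 t) (at t)" if "0 < s t" for t
      unfolding \<gamma>_def[abs_def] \<gamma>1_def using that
      by (auto intro!: derivative_eq_intros ds simp: power2_eq_square field_simps)
    have d\<gamma>1: "(\<gamma>1 has_real_derivative c2 i) (at 0)"
    proof -
      have "(\<gamma>1 has_real_derivative ((- (r\<^sup>2 * 2)) * (s 0)\<^sup>2 - (- (r\<^sup>2 * s1 0)) * (2 * s 0 * s1 0)) / ((s 0)\<^sup>2 * (s 0)\<^sup>2)) (at 0)"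
        unfolding \<gamma>1_def[abs_def] using \<sigma>
        by (auto intro!: derivative_eq_intros ds simp: s0)
          (simp only: minus_divide_left, simp add: algebra_simps)
      also have "((- (r\<^sup>2 * 2)) * (s 0)\<^sup>2 - (- (r\<^sup>2 * s1 0)) * (2 * s 0 * s1 0)) / ((s 0)\<^sup>2 * (s 0)\<^sup>2) = c2 i"
        unfolding s0 c2_def b_def using \<sigma> by (simp add: divide_simps) (simp add: algebra_simps eval_nat_numeral)
      finally show ?thesis .
    qed
    have dJ: "(Jc has_vector_derivative J1 t) (at t)" if "0 < s t" for t
    proof -
      have "((\<lambda>t. \<gamma> t *\<^sub>R (v + t *\<^sub>R ?e)) has_vector_derivative \<gamma> t *\<^sub>R ?e + \<gamma>1 t *\<^sub>R (v + t *\<^sub>R ?e)) (at t)"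
        by (rule has_vector_derivative_scaleR[OF d\<gamma>[OF that] has_vector_derivative_line])
      then show ?thesis
        unfolding Jc_def[abs_def] J1_def
        using has_vector_derivative_add[OF has_vector_derivative_const[of x]] by fastforce
    qed
    have dJ1: "(J1 has_vector_derivative j2 i) (at 0)"
    proof -
      have "0 < s 0" using \<sigma> s0 by simp
      have "((\<lambda>t. \<gamma> t *\<^sub>R ?e + \<gamma>1 t *\<^sub>R (v + t *\<^sub>R ?e)) has_vector_derivative
          (\<gamma> 0 *\<^sub>R 0 + \<gamma>1 0 *\<^sub>R ?e) + (\<gamma>1 0 *\<^sub>R ?e + c2 i *\<^sub>R (v + 0 *\<^sub>R ?e))) (at 0)"
        by (intro has_vector_derivative_add has_vector_derivative_scaleR d\<gamma> d\<gamma>1 has_vector_derivative_line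
            has_vector_derivative_const \<open>0 < s 0\<close>)
      moreover have "\<gamma>1 0 = c1 i" by (simp add: \<gamma>1_def c1_def s0 b_def)
      then have "(\<gamma> 0 *\<^sub>R 0 + \<gamma>1 0 *\<^sub>R ?e) + (\<gamma>1 0 *\<^sub>R ?e + c2 i *\<^sub>R (v + 0 *\<^sub>R ?e)) = j2 i"
        using scaleR_add_left[of "c1 i" "c1 i" ?e] by (simp add: j2_def)
      ultimately show ?thesis
        unfolding J1_def[abs_def] by (simp only:)
    qed
    have hfd: "(hf has_real_derivative hf1 t) (at t)" if "0 < s t" for t
      unfolding hf_def[abs_def] hf1_def using that by (rule pd(1))
    have hf1d: "(hf1 has_real_derivative h2 i) (at 0)"
      using pd(2)[of 0] \<sigma> unfolding s0 hf1_def[abs_def] h2_def b_def by simp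
    have J0: "Jc 0 = p" "J1 0 = j1 i" "hf 0 = h0" "hf1 0 = h1 i"
      by (simp_all add: Jc_def J1_def \<gamma>_def \<gamma>1_def s0 p j1_def c1_def b_def hf_def hf1_def h0_def h1_def)
    have line: "kelvin 2 u x r (y + t *\<^sub>R ?e) = C * (hf t * u (Jc t))" if "0 < s t" for t
    proof -
      have n2: "(norm (v + t *\<^sub>R ?e))\<^sup>2 = s t"
        using norm_line_square[of v t i] by (simp add: s_def \<sigma>_def b_def)
      have e1: "y + t *\<^sub>R ?e - x = v + t *\<^sub>R ?e" by (simp add: v_def)
      have "(r / norm (v + t *\<^sub>R ?e)) powr (2 * a) = C * hf t"
        using powr_divide_eq_mult[of r "norm (v + t *\<^sub>R ?e)" "2 * a"] r
        by (simp only: C_def hf_def n2[symmetric] norm_powr_eq) simp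
      then show ?thesis
        unfolding kelvin_def inversion_def e1 a n2 by (simp add: Jc_def \<gamma>_def add.commute)
    qed
    define F1 where "F1 t = C * (hf1 t * u (Jc t) + (G (Jc t) \<bullet> J1 t) * hf t)" for t
    have ev: "\<forall>\<^sub>F t in nhds 0. 0 < s t"
      unfolding s_def by (rule eventually_line_square_pos[OF \<sigma>])
    \<comment> \<open>The product formula is available only where \<open>s\<close> is positive;
      equality in a neighbourhood transfers the derivative.\<close>
    have "((\<lambda>t. kelvin 2 u x r (y + t *\<^sub>R ?e)) has_real_derivative F1 t) (at t)" if "\<forall>\<^sub>F t in nhds t. 0 < s t" for t
    proof -
      have st: "0 < s t" using that by (rule eventually_nhds_x_imp_x)
      have main: "((\<lambda>t. C * (hf t * u (Jc t))) has_real_derivative F1 t) (at t)"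
        unfolding F1_def
        by (intro DERIV_cmult DERIV_mult hfd[OF st] has_real_derivative_along_curve[OF G dJ[OF st]])
      have ev': "\<forall>\<^sub>F t in nhds t. kelvin 2 u x r (y + t *\<^sub>R ?e) = C * (hf t * u (Jc t))"
        using that by eventually_elim (rule line)
      show ?thesis
        using main unfolding DERIV_cong_ev[OF refl ev' refl] .
    qed
    then have "\<forall>\<^sub>F t in nhds 0. ((\<lambda>t. kelvin 2 u x r (y + t *\<^sub>R ?e)) has_real_derivative F1 t) (at t)"
      using ev unfolding eventually_eventually[of "\<lambda>t. 0 < s t" 0, symmetric] by (rule eventually_mono[rotated])
    moreover have "(F1 has_real_derivative D i) (at 0)"
    proof -
      have s0': "0 < s 0" using \<sigma> s0 by simp
      have g1: "((\<lambda>t. G (Jc t) \<bullet> J1 t) has_real_derivative G (Jc 0) \<bullet> j2 i + (H (Jc 0) *v J1 0) \<bullet> J1 0) (at 0)"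
        unfolding has_real_derivative_iff_has_vector_derivative
        by (rule bounded_bilinear.has_vector_derivative[OF bounded_bilinear_inner
              has_vector_derivative_along_curve[OF H dJ[OF s0']] dJ1])
      have "(F1 has_real_derivative C * ((h2 i * u (Jc 0) + (G (Jc 0) \<bullet> J1 0) * hf1 0) +
          ((G (Jc 0) \<bullet> j2 i + (H (Jc 0) *v J1 0) \<bullet> J1 0) * hf 0 + hf1 0 * (G (Jc 0) \<bullet> J1 0)))) (at 0)"
        unfolding F1_def[abs_def]
        by (intro DERIV_cmult DERIV_add DERIV_mult hf1d hfd[OF s0'] g1 has_real_derivative_along_curve[OF G dJ[OF s0']])
      then show ?thesis
        by (simp add: J0 D_def algebra_simps)
    qed
    ultimately show ?thesis unfolding line_deriv2_def by (intro exI conjI)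
  qed
  have v2: "(\<Sum>i\<in>UNIV. (v $ i)\<^sup>2) = \<sigma>"
    unfolding \<sigma>_def power2_norm_eq_inner by (simp add: inner_vec_def power2_eq_square)
  have vs: "(\<Sum>i\<in>UNIV. v $ i *\<^sub>R axis i 1) = v"
    using basis_expansion[of v] by (simp add: scalar_mult_eq_scaleR)
  have pw1: "\<sigma> powr (- a - 1) = h0 / \<sigma>" and pw2: "\<sigma> powr (- a - 2) = h0 / \<sigma>\<^sup>2"
    using \<sigma> by (simp_all add: h0_def powr_diff)
  have S1: "(\<Sum>i\<in>UNIV. h2 i) = 0"
  proof -
    have "h2 i = (- a * ((- a - 1) * (h0 / \<sigma>\<^sup>2) * 4)) * (v $ i)\<^sup>2 + (- a * (2 * (h0 / \<sigma>)))" for i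
      by (simp add: h2_def pw1 pw2 power_mult_distrib algebra_simps)
    then have "(\<Sum>i\<in>UNIV. h2 i) = (- a * ((- a - 1) * (h0 / \<sigma>\<^sup>2) * 4)) * \<sigma> + real CARD('n) * (- a * (2 * (h0 / \<sigma>)))"
      by (simp only: sum.distrib sum_distrib_left[symmetric] sum_constant v2) (simp only: mult_ac)
    also have "\<dots> = - a * (h0 / \<sigma>) * 2 * (2 * (- a - 1) + real CARD('n))"
      using \<sigma> by (simp add: field_simps power2_eq_square)
    also have "\<dots> = 0" using a by simp
    finally show ?thesis .
  qed
  have J1sum: "(\<Sum>i\<in>UNIV. v $ i *\<^sub>R j1 i) = (- (r\<^sup>2 / \<sigma>)) *\<^sub>R v"
  proof -
    have "v $ i *\<^sub>R j1 i = (r\<^sup>2 / \<sigma>) *\<^sub>R (v $ i *\<^sub>R axis i 1) + ((- (2 * r\<^sup>2 / \<sigma>\<^sup>2)) * (v $ i)\<^sup>2) *\<^sub>R v" for i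
      by (simp add: j1_def c1_def scaleR_add_right scaleR_diff_right power2_eq_square mult_ac)
    then have "(\<Sum>i\<in>UNIV. v $ i *\<^sub>R j1 i) = (r\<^sup>2 / \<sigma>) *\<^sub>R v + ((- (2 * r\<^sup>2 / \<sigma>\<^sup>2)) * \<sigma>) *\<^sub>R v"
      by (simp only: sum.distrib scaleR_sum_right[symmetric] scaleR_sum_left[symmetric] sum_distrib_left[symmetric] vs v2)
    also have "\<dots> = (r\<^sup>2 / \<sigma> + (- (2 * r\<^sup>2 / \<sigma>\<^sup>2)) * \<sigma>) *\<^sub>R v" by (rule scaleR_add_left[symmetric])
    also have "r\<^sup>2 / \<sigma> + (- (2 * r\<^sup>2 / \<sigma>\<^sup>2)) * \<sigma> = - (r\<^sup>2 / \<sigma>)"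
      using \<sigma> by (simp add: field_simps power2_eq_square)
    finally show ?thesis .
  qed
  have S2: "(\<Sum>i\<in>UNIV. h1 i * (G p \<bullet> j1 i)) = 2 * a * h0 * r\<^sup>2 / \<sigma>\<^sup>2 * (G p \<bullet> v)"
  proof -
    have "h1 i * (G p \<bullet> j1 i) = (- (2 * a * h0 / \<sigma>)) * (G p \<bullet> (v $ i *\<^sub>R j1 i))" for i
      by (simp add: h1_def pw1)
    then have "(\<Sum>i\<in>UNIV. h1 i * (G p \<bullet> j1 i)) = (- (2 * a * h0 / \<sigma>)) * (G p \<bullet> (\<Sum>i\<in>UNIV. v $ i *\<^sub>R j1 i))"
      by (simp only: sum_distrib_left[symmetric] inner_sum_right)
    then show ?thesis unfolding J1sum by (simp add: power2_eq_square)
  qed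
  have S3: "(\<Sum>i\<in>UNIV. G p \<bullet> j2 i) = - (4 * a * r\<^sup>2 / \<sigma>\<^sup>2) * (G p \<bullet> v)"
  proof -
    have "j2 i = (- (4 * r\<^sup>2 / \<sigma>\<^sup>2)) *\<^sub>R (v $ i *\<^sub>R axis i 1) + ((8 * r\<^sup>2 / \<sigma> ^ 3) * (v $ i)\<^sup>2) *\<^sub>R v + (- (2 * r\<^sup>2 / \<sigma>\<^sup>2)) *\<^sub>R v" for i
      unfolding j2_def add.assoc scaleR_add_left[symmetric]
      by (simp add: c1_def c2_def power_mult_distrib algebra_simps)
    then have "(\<Sum>i\<in>UNIV. j2 i) = (- (4 * r\<^sup>2 / \<sigma>\<^sup>2)) *\<^sub>R v + ((8 * r\<^sup>2 / \<sigma> ^ 3) * \<sigma>) *\<^sub>R v + (- (2 * r\<^sup>2 / \<sigma>\<^sup>2)) *\<^sub>R (real CARD('n) *\<^sub>R v)"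
      by (simp only: sum.distrib scaleR_sum_right[symmetric] scaleR_sum_left[symmetric] sum_distrib_left[symmetric] vs v2 sum_constant_scaleR)
    also have "\<dots> = (- (4 * r\<^sup>2 / \<sigma>\<^sup>2) + (8 * r\<^sup>2 / \<sigma> ^ 3) * \<sigma> + real CARD('n) * (- (2 * r\<^sup>2 / \<sigma>\<^sup>2))) *\<^sub>R v"
      by (simp only: scaleR_add_left scaleR_scaleR mult.commute[of "real CARD('n)"])
    also have "- (4 * r\<^sup>2 / \<sigma>\<^sup>2) + (8 * r\<^sup>2 / \<sigma> ^ 3) * \<sigma> + real CARD('n) * (- (2 * r\<^sup>2 / \<sigma>\<^sup>2)) = - (2 * r\<^sup>2 / \<sigma>\<^sup>2) * (real CARD('n) - 2)"
      using \<sigma> by (simp add: field_simps power2_eq_square power3_eq_cube)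
    finally show ?thesis
      by (simp add: inner_sum_right[symmetric] a)
  qed
  have S4: "(\<Sum>i\<in>UNIV. (H p *v j1 i) \<bullet> j1 i) = (r\<^sup>2 / \<sigma>)\<^sup>2 * (\<Sum>i\<in>UNIV. H p $ i $ i)"
  proof -
    have j: "j1 i = (r\<^sup>2 / \<sigma>) *\<^sub>R (axis i 1 - (2 * v $ i / (v \<bullet> v)) *\<^sub>R v)" for i
      using \<sigma> by (simp add: j1_def c1_def vv scaleR_diff_right power2_eq_square)
    have "(H p *v j1 i) \<bullet> j1 i = (r\<^sup>2 / \<sigma>)\<^sup>2 * ((H p *v (axis i 1 - (2 * v $ i / (v \<bullet> v)) *\<^sub>R v)) \<bullet> (axis i 1 - (2 * v $ i / (v \<bullet> v)) *\<^sub>R v))" for i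
      unfolding j matrix_vector_mult_scaleR inner_scaleR_left inner_scaleR_right by (simp only: power2_eq_square mult.assoc)
    then show ?thesis
      by (simp only: sum_distrib_left[symmetric] trace_conjugate_reflection[OF v])
  qed
  have "(\<Sum>i\<in>UNIV. D i) = C * ((\<Sum>i\<in>UNIV. h2 i) * u p + 2 * (\<Sum>i\<in>UNIV. h1 i * (G p \<bullet> j1 i))
      + h0 * ((\<Sum>i\<in>UNIV. (H p *v j1 i) \<bullet> j1 i) + (\<Sum>i\<in>UNIV. G p \<bullet> j2 i)))"
    by (simp only: D_def sum.distrib sum_distrib_left[symmetric] sum_distrib_right[symmetric])
  \<comment> \<open>Twice the sum in \<open>S2\<close> cancels with \<open>h0\<close> times the sum
    in \<open>S3\<close>; \<open>S1\<close> is 0, so only the trace in \<open>S4\<close>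
    survives.\<close>
  also have "\<dots> = C * h0 * (r\<^sup>2 / \<sigma>)\<^sup>2 * (\<Sum>i\<in>UNIV. H p $ i $ i)"
    unfolding S1 S2 S3 S4 by (simp add: algebra_simps)
  also have "C * h0 * (r\<^sup>2 / \<sigma>)\<^sup>2 = (r / norm v) powr (real CARD('n) + 2)"
  proof -
    have nv: "0 < norm v" using v by simp
    have "C * h0 = (r / norm v) powr (2 * a)"
      using powr_divide_eq_mult[of r "norm v" "2 * a"] r
      by (simp only: C_def h0_def \<sigma>_def norm_powr_eq) simp
    moreover have "(r\<^sup>2 / \<sigma>)\<^sup>2 = (r / norm v) powr 4"
      using r nv powr_realpow[of "r / norm v" 4] by (simp add: \<sigma>_def power_divide flip: power_mult)
    ultimately have "C * h0 * (r\<^sup>2 / \<sigma>)\<^sup>2 = (r / norm v) powr (2 * a + 4)"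
      by (simp add: powr_add)
    then show ?thesis using a by (simp add: algebra_simps)
  qed
  finally show ?thesis using ld unfolding p_def v_def by blast
qed

subsection \<open>The Laplacian\<close>

text \<open>Subtracting a multiple of the harmonic barrier does not change the Laplacian, and an
  interior minimum of the difference would have nonnegative second derivatives along all axes,
  against the negative Laplacian of \<open>u\<close>.\<close>

lemma lower_bound_classical:
  fixes u :: "real^'n \<Rightarrow> real" and x :: "real^'n"
  assumes n3: "2 < real CARD('n)" and pos: "\<And>y. 0 < u y"
    and G: "\<And>y. (u has_derivative (\<lambda>h. G y \<bullet> h)) (at y)"
    and H: "\<And>y. (G has_derivative (\<lambda>h. H y *v h)) (at y)"
    and lap: "\<And>y. laplacian u y < 0"
  shows "\<exists>c>0. \<forall>y. 2 \<le> norm (y - x) \<longrightarrow> c * norm (y - x) powr (2 - real CARD('n)) \<le> u y"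
proof -
  define a where "a = (real CARD('n) - 2) / 2"
  have a: "0 < a" "2 * a = real CARD('n) - 2" "2 - real CARD('n) = - (2 * a)"
  proof -
    have "2 * a = real CARD('n) - 2" by (simp add: a_def)
    then show "0 < a" "2 * a = real CARD('n) - 2" "2 - real CARD('n) = - (2 * a)"
      using n3 by linarith+
  qed
  have cont: "continuous_on S u" for S
    by (rule has_derivative_continuous_on) (rule has_derivative_at_withinI[OF G])
  obtain m where m: "0 < m" "\<And>y. y \<in> cball x 2 \<Longrightarrow> m \<le> u y"
    using positive_lower_bound_cball[OF cont pos, of 2 x] by auto
  define f where "f z = u z + (- m) * norm (z - x) powr (- (2 * a))" for z
  have "m * norm (y - x) powr (- (2 * a)) \<le> u y" if y: "2 \<le> norm (y - x)" for y
  proof (rule ccontr)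
    assume "\<not> m * norm (y - x) powr (- (2 * a)) \<le> u y"
    then obtain y1 where "2 \<le> norm (y1 - x)" and f1: "f y1 < 0"
      and fmin: "\<And>z. 2 \<le> norm (z - x) \<Longrightarrow> f y1 \<le> f z"
      using comparison_negative_min[OF cont pos _ m(1) y, of "2 * a"] a(1) by (auto simp: f_def)
    \<comment> \<open>On the inner sphere the barrier is at most \<open>m\<close>, hence at most
      \<open>u\<close>; a negative minimum is therefore interior, where second derivatives can be
      tested.\<close>
    moreover have "norm (y1 - x) \<noteq> 2"
    proof
      assume eq: "norm (y1 - x) = 2"
      have "norm (y1 - x) powr (- (2 * a)) \<le> 1"
        using powr_mono2'[of "- (2 * a)" 1 2] a(1) eq by simp
      then have "m * norm (y1 - x) powr (- (2 * a)) \<le> m"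
        using m by (simp add: mult_left_le)
      moreover have "m \<le> u y1" using eq by (intro m) (simp add: dist_norm norm_minus_commute)
      ultimately show False using f1 by (simp add: f_def)
    qed
    ultimately have in1: "2 < norm (y1 - x)" by simp
    have "open {z. 2 < norm (z - x)}"
      by (intro open_Collect_less continuous_intros)
    then have "\<forall>\<^sub>F z in nhds y1. z \<in> {z. 2 < norm (z - x)}"
      using in1 by (intro eventually_nhds_in_open) auto
    then have min: "\<forall>\<^sub>F z in nhds y1. f y1 \<le> f z"
      by eventually_elim (use fmin in auto)
    have "y1 \<noteq> x" using in1 by auto
    then obtain D where D: "\<And>i. line_deriv2 (\<lambda>z. norm (z - x) powr (- (2 * a))) y1 i (D i)" "(\<Sum>i\<in>UNIV. D i) = 0"
      using fundamental_line_deriv2[of y1 x a] a(2) by blast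
    have "0 \<le> H y1 $ i $ i + (- m) * D i" for i
    proof (rule line_deriv2_local_min[OF _ min])
      show "line_deriv2 f y1 i (H y1 $ i $ i + (- m) * D i)"
        unfolding f_def[abs_def] by (intro line_deriv2_add line_deriv2_cmult line_deriv2_C2[OF G H] D(1))
    qed
    then have "0 \<le> (\<Sum>i\<in>UNIV. H y1 $ i $ i + (- m) * D i)" by (intro sum_nonneg) auto
    also have "\<dots> = laplacian u y1"
      by (simp only: sum.distrib sum_distrib_left[symmetric] D(2) laplacian_C2[OF G H])
    finally show False using lap[of y1] by simp
  qed
  then show ?thesis using m(1) a(3) by auto
qed

section \<open>The differential inequality near the sphere for the Laplacian\<close>

lemma powr_diff_le:
  fixes v w q C :: real
  assumes "0 < v" "v \<le> w" "0 \<le> q" and C: "\<And>\<xi>. v \<le> \<xi> \<Longrightarrow> \<xi> \<le> w \<Longrightarrow> \<xi> powr (q - 1) \<le> C"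
  shows "w powr q - v powr q \<le> q * C * (w - v)"
proof (cases "v < w")
  case True
  have "\<exists>\<xi>. v < \<xi> \<and> \<xi> < w \<and> w powr q - v powr q = (w - v) * (q * \<xi> powr (q - 1))"
    using True assms(1) by (intro MVT2) (auto intro!: derivative_eq_intros)
  then obtain \<xi> where \<xi>: "v < \<xi>" "\<xi> < w" "w powr q - v powr q = (w - v) * (q * \<xi> powr (q - 1))" by blast
  have "(w - v) * (q * \<xi> powr (q - 1)) \<le> (w - v) * (q * C)"
    using C[of \<xi>] \<xi> assms by (intro mult_left_mono) auto
  then show ?thesis using \<xi>(3) by (simp add: mult_ac)
qed (use assms in auto)

text \<open>With \<beta> = n - \<alpha>, the critical power of the Kelvin transform brings r / |z -
  x| to the exponent n + \<alpha>, while Jacobian and kernel together leave 2n - \<beta>. The two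
  agree, so no weight remains under the integral.\<close>

lemma
  fixes u :: "real^'n \<Rightarrow> real" and x y :: "real^'n"
  assumes [measurable]: "u \<in> borel_measurable borel" and pos: "\<And>z. 0 < u z"
    and \<alpha>: "\<alpha> < real CARD('n)"
    and int: "\<And>y. integrable lborel (\<lambda>z. u z powr ((real CARD('n) + \<alpha>) / (real CARD('n) - \<alpha>)) * norm (z - y) powr (- (real CARD('n) - \<alpha>)))"
    and y: "y \<noteq> x" and r: "0 < r"
  shows integrable_kelvin_potential: "integrable lborel (\<lambda>z. kelvin \<alpha> u x r z powr ((real CARD('n) + \<alpha>) / (real CARD('n) - \<alpha>)) * norm (z - y) powr (- (real CARD('n) - \<alpha>)))"
    and potential_inversion: "(r / norm (y - x)) powr (real CARD('n) - \<alpha>) * potential \<alpha> u (inversion x r y) =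
       (LINT z|lborel. kelvin \<alpha> u x r z powr ((real CARD('n) + \<alpha>) / (real CARD('n) - \<alpha>)) * norm (z - y) powr (- (real CARD('n) - \<alpha>)))"
proof -
  let ?n = "CARD('n)"
  define \<beta> where "\<beta> = real ?n - \<alpha>"
  define p where "p = (real ?n + \<alpha>) / \<beta>"
  have \<beta>: "0 < \<beta>" "\<beta> * p = real ?n + \<alpha>" "2 * real ?n - \<beta> = real ?n + \<alpha>" using \<alpha> by (auto simp: \<beta>_def p_def)
  define F where "F z = u z powr p * norm (z - inversion x r y) powr (- \<beta>)" for z
  define K where "K z = kelvin \<alpha> u x r z powr p * norm (z - y) powr (- \<beta>)" for z
  define k where "k = (r / norm (y - x)) powr \<beta>"
  have k: "0 < k" using y r by (simp add: k_def)
  have [measurable]: "F \<in> borel_measurable borel" "K \<in> borel_measurable borel"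
    unfolding F_def[abs_def] K_def[abs_def] kelvin_def by measurable
  have F: "integrable lborel F"
    unfolding F_def[abs_def] p_def \<beta>_def by (rule int)
  define R where "R z = (r / norm (z - x)) ^ (2 * ?n) * F (inversion x r z)" for z
  have [measurable]: "R \<in> borel_measurable borel" unfolding R_def[abs_def] by measurable
  have R: "integrable lborel R" "integral\<^sup>L lborel F = integral\<^sup>L lborel R"
    unfolding R_def[abs_def] using integrable_inversion_iff[of r F x] integral_inversion[of r F x] F r by auto
  have eq: "k * R z = K z" if z: "z \<noteq> x" for z
  proof -
    define t where "t = norm (z - x)"
    define v where "v = norm (y - x)"
    define d where "d = norm (z - y)"
    have tv: "0 < t" "0 < v" "0 \<le> d" using z y by (auto simp: t_def v_def d_def)
    have n1: "norm (inversion x r z - inversion x r y) = (r / t) * ((r / v) * d)"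
      using norm_inversion_inversion_diff[OF z y, of r] by (simp add: t_def v_def d_def power2_eq_square)
    have p1: "((r / t) * ((r / v) * d)) powr (- \<beta>) = (r / t) powr (- \<beta>) * ((r / v) powr (- \<beta>) * d powr (- \<beta>))"
      using tv r by (simp only: powr_mult zero_le_divide_iff zero_le_mult_iff less_imp_le)
    have p2: "(r / v) powr \<beta> * (r / v) powr (- \<beta>) = 1"
      using tv r by (simp add: powr_minus)
    have p3: "(r / t) ^ (2 * ?n) * (r / t) powr (- \<beta>) = (r / t) powr (real ?n + \<alpha>)"
    proof -
      have "(r / t) ^ (2 * ?n) = (r / t) powr (2 * real ?n)"
        using tv r by (intro power_eq_powr) simp
      then have "(r / t) ^ (2 * ?n) * (r / t) powr (- \<beta>) = (r / t) powr (2 * real ?n + - \<beta>)"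
        by (simp only: powr_add)
      also have "2 * real ?n + - \<beta> = real ?n + \<alpha>" using \<beta>(3) by simp
      finally show ?thesis .
    qed
    have p4: "kelvin \<alpha> u x r z powr p = (r / t) powr (real ?n + \<alpha>) * u (inversion x r z) powr p"
    proof -
      have "kelvin \<alpha> u x r z = (r / t) powr \<beta> * u (inversion x r z)"
        by (simp add: kelvin_def t_def \<beta>_def)
      then show ?thesis
        using less_imp_le[OF pos[of "inversion x r z"]] \<beta>(2) by (simp add: powr_mult powr_powr)
    qed
    have "k * R z = ((r / v) powr \<beta> * (r / v) powr (- \<beta>)) * ((r / t) ^ (2 * ?n) * (r / t) powr (- \<beta>)) * u (inversion x r z) powr p * d powr (- \<beta>)"
      unfolding k_def R_def F_def n1 p1 t_def[symmetric] v_def[symmetric] by (simp only: mult_ac)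
    also have "\<dots> = K z"
      unfolding p2 p3 K_def p4 by (simp add: d_def)
    finally show ?thesis .
  qed
  have AE: "AE z in lborel. k * R z = K z"
    using AE_lborel_singleton[of x] by eventually_elim (rule eq)
  have kR: "integrable lborel (\<lambda>z. k * R z)" using R(1) by (rule integrable_mult_right)
  have "integrable lborel K"
    by (rule integrable_cong_AE_imp[OF kR]) (use AE in \<open>auto elim: eventually_mono\<close>)
  then show "integrable lborel (\<lambda>z. kelvin \<alpha> u x r z powr ((real CARD('n) + \<alpha>) / (real CARD('n) - \<alpha>)) * norm (z - y) powr (- (real CARD('n) - \<alpha>)))"
    by (simp only: K_def[abs_def] p_def \<beta>_def)
  have "k * potential \<alpha> u (inversion x r y) = k * integral\<^sup>L lborel R"
    unfolding potential_lborel[OF assms(1)] R(2)[symmetric] by (simp only: F_def[abs_def] p_def \<beta>_def)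
  also have "\<dots> = (LINT z|lborel. k * R z)" by simp
  also have "\<dots> = integral\<^sup>L lborel K"
    by (rule integral_cong_AE) (use AE in auto)
  finally show "(r / norm (y - x)) powr (real CARD('n) - \<alpha>) * potential \<alpha> u (inversion x r y) =
       (LINT z|lborel. kelvin \<alpha> u x r z powr ((real CARD('n) + \<alpha>) / (real CARD('n) - \<alpha>)) * norm (z - y) powr (- (real CARD('n) - \<alpha>)))"
    by (simp only: k_def K_def[abs_def] p_def \<beta>_def)
qed

lemma kelvin_pos: "(\<And>z. 0 < u z) \<Longrightarrow> 0 < r \<Longrightarrow> z \<noteq> x \<Longrightarrow> 0 < kelvin \<alpha> u x r z"
  by (simp add: kelvin_def)

text \<open>Folding the exterior turns the difference of the potentials into the integral of
  \<open>d z * (k1 z - k2)\<close> over the ball, where \<open>k2\<close>, the weighted kernel at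
  the inverse of \<open>z\<close>, satisfies \<open>0 \<le> k2 \<le> k1 z\<close>. A lower bound on
  \<open>d\<close>, of order \<open>M\<close> by the mean value theorem, then suffices.\<close>

lemma potential_inversion_ge:
  fixes u :: "real^'n \<Rightarrow> real" and x y :: "real^'n"
  assumes [measurable]: "u \<in> borel_measurable borel" and pos: "\<And>z. 0 < u z"
    and \<alpha>: "0 < \<alpha>" "\<alpha> < real CARD('n)"
    and int: "\<And>y. integrable lborel (\<lambda>z. u z powr ((real CARD('n) + \<alpha>) / (real CARD('n) - \<alpha>)) * norm (z - y) powr (- (real CARD('n) - \<alpha>)))"
    and y: "y \<noteq> x" "norm (y - x) < r" and r: "r \<le> b"
    and U: "\<And>z. z \<in> ball x r \<Longrightarrow> u z \<le> U"
    and M: "0 \<le> M" "\<And>z. z \<in> ball x r - {x} \<Longrightarrow> - M \<le> omega \<alpha> u x r z"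
  shows "- ((real CARD('n) + \<alpha>) / (real CARD('n) - \<alpha>) * (U powr (2 * \<alpha> / (real CARD('n) - \<alpha>)) *
      (LINT z|lborel. indicator (ball (0::real^'n) (2 * b)) z * norm z powr (- (real CARD('n) - \<alpha>)))) * M)
    \<le> (r / norm (y - x)) powr (real CARD('n) - \<alpha>) * potential \<alpha> u (inversion x r y) - potential \<alpha> u y"
proof -
  let ?n = "CARD('n)"
  have r0: "0 < r" using y(2) norm_ge_zero[of "y - x"] by linarith
  define \<beta> where "\<beta> = real ?n - \<alpha>"
  define p where "p = (real ?n + \<alpha>) / \<beta>"
  define e where "e = 2 * \<alpha> / \<beta>"
  have \<beta>: "0 < \<beta>" "\<beta> < real ?n" "\<beta> * p = real ?n + \<alpha>" "2 * real ?n - (real ?n + \<alpha>) = \<beta>"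
    using \<alpha> by (auto simp: \<beta>_def p_def)
  have p: "0 < p" "p - 1 = e" "0 < e" using \<beta> \<alpha> by (auto simp: p_def e_def \<beta>_def field_simps)
  define w where "w = kelvin \<alpha> u x r"
  have [measurable]: "w \<in> borel_measurable borel" unfolding w_def kelvin_def by measurable
  define k1 where "k1 z = norm (z - y) powr (- \<beta>)" for z
  have [measurable]: "k1 \<in> borel_measurable borel" unfolding k1_def[abs_def] by measurable
  define d where "d z = w z powr p - u z powr p" for z
  have [measurable]: "d \<in> borel_measurable borel" unfolding d_def[abs_def] by measurable
  have iu: "integrable lborel (\<lambda>z. u z powr p * k1 z)"
    unfolding k1_def p_def \<beta>_def by (rule int)
  have iw: "integrable lborel (\<lambda>z. w z powr p * k1 z)"
    unfolding k1_def p_def \<beta>_def w_def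
    by (rule integrable_kelvin_potential[OF assms(1) pos \<alpha>(2) int y(1) r0])
  have dk: "integrable lborel (\<lambda>z. d z * k1 z)"
    unfolding d_def left_diff_distrib using iw iu by (rule Bochner_Integration.integrable_diff)
  have diff: "(r / norm (y - x)) powr \<beta> * potential \<alpha> u (inversion x r y) - potential \<alpha> u y = (LINT z|lborel. d z * k1 z)"
    unfolding d_def left_diff_distrib Bochner_Integration.integral_diff[OF iw iu]
    unfolding potential_lborel[OF assms(1)] k1_def w_def p_def \<beta>_def
    using potential_inversion[OF assms(1) pos \<alpha>(2) int y(1) r0] potential_lborel[OF assms(1), of \<alpha>] by simp
  define Di where "Di z = indicator (ball x r - {x}) z * (d z * k1 z)" for z
  define Do where "Do z = indicator {z. r < norm (z - x)} z * (d z * k1 z)" for z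
  have [measurable]: "Di \<in> borel_measurable borel" "Do \<in> borel_measurable borel"
    unfolding Di_def[abs_def] Do_def[abs_def] by measurable
  have Di: "integrable lborel Di"
    by (rule Bochner_Integration.integrable_bound[OF dk]) (auto simp: Di_def indicator_def)
  have Do: "integrable lborel Do"
    by (rule Bochner_Integration.integrable_bound[OF dk]) (auto simp: Do_def indicator_def)
  have split: "d z * k1 z = Di z + Do z" if z: "z \<noteq> x" for z
  proof (cases "norm (z - x)" r rule: linorder_cases)
    case less
    then have "z \<in> ball x r" by (simp add: dist_norm norm_minus_commute)
    then show ?thesis using less z by (simp add: Di_def Do_def)
  next
    case equal
    then have "z \<notin> ball x r" by (simp add: dist_norm norm_minus_commute)
    moreover have "w z = u z"
      using equal r0 inversion_sphere[of z x r] by (simp add: w_def kelvin_def)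
    ultimately show ?thesis by (simp add: Di_def Do_def d_def)
  next
    case greater
    then have "z \<notin> ball x r" by (simp add: dist_norm norm_minus_commute)
    then show ?thesis using greater by (simp add: Di_def Do_def)
  qed
  define R where "R z = (r / norm (z - x)) ^ (2 * ?n) * Do (inversion x r z)" for z
  have [measurable]: "R \<in> borel_measurable borel" unfolding R_def[abs_def] by measurable
  have R: "integrable lborel R" "integral\<^sup>L lborel Do = integral\<^sup>L lborel R"
    unfolding R_def[abs_def] using integrable_inversion_iff[of r Do x] integral_inversion[of r Do x] Do r0 by auto
  define N where "N z = - (p * U powr e * M) * (indicator (ball y (2 * b)) z * norm (z - y) powr (- \<beta>))" for z
  have N: "integrable lborel N"
    unfolding N_def[abs_def] using \<beta> by (intro integrable_mult_right integrable_norm_powr_ball) auto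
  \<comment> \<open>The point \<open>z = y\<close> is excluded because the kernel is 0 there by
    convention, which would break \<open>k2 \<le> k1 z\<close>.\<close>
  have pw: "N z \<le> Di z + R z" if z: "z \<noteq> x" "z \<noteq> y" for z
  proof (cases "norm (z - x) < r")
    case False
    have "r\<^sup>2 / norm (z - x) \<le> r"
      using False r0 z by (simp add: field_simps power2_eq_square)
    then have "R z = 0"
      using z by (simp add: R_def Do_def norm_inversion_diff)
    moreover have "Di z = 0" using False by (simp add: Di_def dist_norm norm_minus_commute)
    moreover have "N z \<le> 0" using p M by (simp add: N_def)
    ultimately show ?thesis by simp
  next
    case True
    define t where "t = norm (z - x)"
    have t: "0 < t" "t < r" using True z by (auto simp: t_def)
    have zb: "z \<in> ball x r - {x}" using True z by (simp add: dist_norm norm_minus_commute)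
    define q where "q = norm (inversion x r z - y)"
    have ni: "norm (inversion x r z - x) = r\<^sup>2 / t" using z by (simp add: norm_inversion_diff t_def)
    have rt: "r < r\<^sup>2 / t" using t r0 by (simp add: field_simps power2_eq_square)
    have le: "norm (z - y) \<le> t / r * q"
      using norm_diff_inversion_inner[OF z(1) True] y(2) by (simp add: t_def q_def)
    have dinv: "d (inversion x r z) = - ((t / r) powr (real ?n + \<alpha>) * d z)"
    proof -
      have 1: "w (inversion x r z) powr p = (t / r) powr (real ?n + \<alpha>) * u z powr p"
        using kelvin_inversion(1)[OF z(1) r0, of \<alpha> u] less_imp_le[OF pos[of z]] \<beta>(3)
        by (simp add: w_def powr_mult powr_powr t_def \<beta>_def)
      have 2: "u (inversion x r z) powr p = (t / r) powr (real ?n + \<alpha>) * w z powr p"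
        using kelvin_inversion(2)[OF z(1) r0, of u \<alpha>] less_imp_le[OF kelvin_pos[of u r z x \<alpha>]] pos r0 z \<beta>(3)
        by (simp add: w_def powr_mult powr_powr t_def \<beta>_def)
      show ?thesis unfolding d_def 1 2 by (simp add: algebra_simps)
    qed
    define k2 where "k2 = (t / r * q) powr (- \<beta>)"
    have Rz: "R z = - (d z * k2)"
    proof -
      have "(r / t) ^ (2 * ?n) = (r / t) powr (2 * real ?n)"
        using t r0 by (intro power_eq_powr) simp
      also have "\<dots> = (t / r) powr (- (2 * real ?n))"
        using t r0 by (simp add: powr_divide powr_minus field_simps)
      finally have 1: "(r / t) ^ (2 * ?n) * (t / r) powr (real ?n + \<alpha>) = (t / r) powr (- (2 * real ?n) + (real ?n + \<alpha>))"
        by (simp only: powr_add)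
      have 2: "- (2 * real ?n) + (real ?n + \<alpha>) = - \<beta>" by (simp add: \<beta>_def)
      have 3: "k2 = (t / r) powr (- \<beta>) * q powr (- \<beta>)"
        unfolding k2_def using t r0 by (intro powr_mult)
      have "R z = (r / t) ^ (2 * ?n) * (- ((t / r) powr (real ?n + \<alpha>) * d z) * q powr (- \<beta>))"
        using rt by (simp add: R_def Do_def ni dinv k1_def q_def t_def[symmetric])
      also have "\<dots> = - (((r / t) ^ (2 * ?n) * (t / r) powr (real ?n + \<alpha>)) * d z * q powr (- \<beta>))"
        by (simp add: mult_ac)
      also have "\<dots> = - (d z * k2)" unfolding 1 2 3 by (simp add: mult_ac)
      finally show ?thesis .
    qed
    have k21: "k2 \<le> k1 z" "0 \<le> k2"
      using le z \<beta> by (auto simp: k2_def k1_def intro!: powr_mono2')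
    have wz: "0 < w z" unfolding w_def using pos r0 z by (intro kelvin_pos)
    have uU: "u z \<le> U" using zb by (intro U) auto
    have dge: "- (p * U powr e * M) \<le> d z"
    proof (cases "u z \<le> w z")
      case True
      then have "0 \<le> d z" using pos[of z] p by (simp add: d_def powr_mono2)
      moreover have "0 \<le> p * U powr e * M" using p M by simp
      ultimately show ?thesis by linarith
    next
      case False
      have "u z powr p - w z powr p \<le> p * U powr e * (u z - w z)"
        using False wz p uU by (intro powr_diff_le) (auto intro!: powr_mono2)
      also have "\<dots> \<le> p * U powr e * M"
        using M(2)[OF zb] p by (intro mult_left_mono) (auto simp: omega_def w_def)
      finally show ?thesis by (simp add: d_def)
    qed
    have "- (p * U powr e * M) * k1 z \<le> - (p * U powr e * M) * (k1 z - k2)"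
      using k21 p M by (intro mult_left_mono_neg) auto
    also have "\<dots> \<le> d z * (k1 z - k2)"
      using dge k21 by (intro mult_right_mono) auto
    also have "\<dots> = Di z + R z"
      using zb by (simp add: Di_def Rz algebra_simps)
    finally have "- (p * U powr e * M) * k1 z \<le> Di z + R z" .
    moreover have "z \<in> ball y (2 * b)"
      using norm_triangle_ineq[of "z - x" "x - y"] t y r
      by (simp add: t_def[symmetric] dist_norm norm_minus_commute[of y z] norm_minus_commute[of x y])
    ultimately show ?thesis by (simp add: N_def k1_def)
  qed
  have "- (p * (U powr e * (LINT z|lborel. indicator (ball (0::real^'n) (2 * b)) z * norm z powr (- \<beta>))) * M) = integral\<^sup>L lborel N"
    unfolding N_def by (simp add: integral_norm_powr_ball)
  also have "\<dots> \<le> (LINT z|lborel. Di z + R z)"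
  proof (rule integral_mono_AE[OF N])
    show "AE z in lborel. N z \<le> Di z + R z"
      using AE_lborel_singleton[of x] AE_lborel_singleton[of y] by eventually_elim (rule pw)
  qed (use Di R in auto)
  also have "\<dots> = (LINT z|lborel. Di z + Do z)"
    using Di Do R by simp
  also have "\<dots> = (LINT z|lborel. d z * k1 z)"
    by (rule integral_cong_AE) (use split AE_lborel_singleton[of x] in \<open>auto elim!: eventually_mono\<close>)
  finally show ?thesis
    unfolding diff[symmetric] by (simp only: p_def e_def \<beta>_def)
qed

lemma potential_nonneg:
  fixes u :: "real^'n \<Rightarrow> real"
  shows "0 \<le> potential \<alpha> u y"
  unfolding potential_def by (intro Bochner_Integration.integral_nonneg) auto

text \<open>This is where subcritical exponents enter: the left-over power of the Kelvin factor has
  a base of at least 1, so comparing exponents is enough. The uses below take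
  \<open>\<gamma>\<close> as 0 for the local term and as n - 2 for the nonlocal one.\<close>

lemma powr_kelvin_le:
  fixes u :: "real^'n \<Rightarrow> real" and x z :: "real^'n"
  assumes "0 < u (inversion x r z)" and \<tau>: "1 \<le> r / norm (z - x)"
    and q: "\<gamma> + (real CARD('n) - \<alpha>) * q \<le> \<delta>"
  shows "(r / norm (z - x)) powr \<gamma> * kelvin \<alpha> u x r z powr q \<le> (r / norm (z - x)) powr \<delta> * u (inversion x r z) powr q"
proof -
  have "kelvin \<alpha> u x r z powr q = (r / norm (z - x)) powr ((real CARD('n) - \<alpha>) * q) * u (inversion x r z) powr q"
    using assms(1) \<tau> by (simp add: kelvin_def powr_mult powr_powr)
  then have "(r / norm (z - x)) powr \<gamma> * kelvin \<alpha> u x r z powr q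
      = (r / norm (z - x)) powr (\<gamma> + (real CARD('n) - \<alpha>) * q) * u (inversion x r z) powr q"
    by (simp only: powr_add mult.assoc)
  also have "\<dots> \<le> (r / norm (z - x)) powr \<delta> * u (inversion x r z) powr q"
    using q \<tau> by (intro mult_right_mono powr_mono) auto
  finally show ?thesis .
qed

lemma threshold_classical:
  fixes u :: "real^'n \<Rightarrow> real" and x :: "real^'n"
  assumes n3: "2 < real CARD('n)"
    and c: "0 \<le> c1" "0 \<le> c2" "0 < c1 + c2" and q: "0 < q1" "0 < q2"
    and qn: "q1 \<le> 2 * 2 / (real CARD('n) - 2)" "q2 \<le> (real CARD('n) + 2) / (real CARD('n) - 2)"
    and sol: "positive_classical_solution 2 c1 c2 q1 q2 u"
    and ab: "0 < a" "a \<le> b"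
  shows "\<exists>\<eta>>0. \<forall>r l \<Omega>. a \<le> r \<and> r \<le> b \<and> narrow_region_hyps 2 c1 c2 q1 q2 u x r l \<Omega> \<and>
      (\<exists>y\<in>\<Omega>. omega 2 u x r y < 0) \<longrightarrow> \<eta> \<le> l"
proof -
  let ?n = "CARD('n)"
  define \<beta> where "\<beta> = real ?n - 2"
  define p where "p = (real ?n + 2) / \<beta>"
  define e where "e = 2 * 2 / \<beta>"
  have \<beta>: "0 < \<beta>" using n3 by (simp add: \<beta>_def)
  have p: "0 < p" "0 < e" using \<beta> by (auto simp: p_def e_def)
  \<comment> \<open>The upper bounds on \<open>q1\<close> and \<open>q2\<close>, in the form in
    which exponents of the Kelvin factor are compared.\<close>
  have b\<beta>: "\<beta> + \<beta> * q1 \<le> real ?n + 2" "0 + \<beta> * q2 \<le> real ?n + 2"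
    using qn \<beta> by (auto simp: \<beta>_def field_simps)
  obtain G H where G: "\<And>y. (u has_derivative (\<lambda>h. G y \<bullet> h)) (at y)"
    and H: "\<And>y. (G has_derivative (\<lambda>h. H y *v h)) (at y)"
    using sol by (auto simp: positive_classical_solution_def C2_on_def)
  define f where "f y = c1 * potential 2 u y * u y powr q1 + c2 * u y powr q2" for y
  have trH: "(\<Sum>i\<in>UNIV. H y $ i $ i) = - f y" for y
  proof -
    have "- laplacian u y = f y"
      using sol by (simp add: positive_classical_solution_def frac_laplacian_def f_def)
    then show ?thesis unfolding laplacian_C2[OF G H] by simp
  qed
  have ub: "u \<in> borel_measurable borel" by (rule solution_borel[OF sol])
  have pos: "0 < u z" for z by (rule solution_pos[OF sol])
  have b: "0 < b" using ab by simp
  obtain m U where m: "0 < m" and mU: "\<And>z. z \<in> cball x (2 * b) \<Longrightarrow> m \<le> u z"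
    "\<And>z. z \<in> cball x (2 * b) \<Longrightarrow> u z \<le> U"
    using solution_bounds[OF sol, of x "2 * b"] by blast
  have U: "0 < U" using mU[of x] m b by simp
  obtain QB where QB: "0 \<le> QB" "\<And>y. norm (y - x) \<le> b \<Longrightarrow> c1 * potential 2 u y \<le> c1 * QB"
    using solution_potential_bounded[OF sol _ n3 c(1) b mU(2)] by auto
  define J where "J = U powr e * (LINT z|lborel. indicator (ball (0::real^'n) (2 * b)) z * norm z powr (- \<beta>))"
  have J: "0 \<le> J" by (simp add: J_def)
  define T where "T q = m powr (q - 1) + U powr (q - 1)" for q
  have T: "0 \<le> T q" for q by (simp add: T_def)
  define K where "K = c1 * QB * q1 * T q1 + c2 * q2 * T q2 + c1 * p * J * U powr q1"
  have K: "0 \<le> K" using c q QB p J T by (simp add: K_def)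
  \<comment> \<open>On the inner sphere \<open>r\<^sup>2 - (r / 2)\<^sup>2\<close> is at least
    \<open>3 / 4 * a\<^sup>2\<close>, whose reciprocal is the second summand; the final 1 makes
    \<open>K < \<kappa>\<close> strict.\<close>
  define \<kappa> where "\<kappa> = K + 4 / (3 * a\<^sup>2) + 1"
  have \<kappa>: "0 < \<kappa>" "K < \<kappa>" "4 / (3 * a\<^sup>2) \<le> \<kappa>" using K by (auto simp: \<kappa>_def add_nonneg_pos)
  \<comment> \<open>\<open>a / 2\<close> keeps the minimum point in the half shell. Within
    \<open>l\<close> of the sphere \<open>r\<^sup>2 - (norm (y - x))\<^sup>2\<close> is at most
    \<open>2 * b * l\<close>, so the other bound keeps the barrier below \<open>M\<close> at that
    point.\<close>
  define \<eta> where "\<eta> = min (a / 2) (1 / (2 * b * \<kappa>))"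
  have \<eta>: "0 < \<eta>" using ab b \<kappa> by (simp add: \<eta>_def)
  have "\<eta> \<le> l" if r: "a \<le> r" "r \<le> b" and hyps: "narrow_region_hyps 2 c1 c2 q1 q2 u x r l \<Omega>"
    and neg: "\<exists>y\<in>\<Omega>. omega 2 u x r y < 0" for r l \<Omega>
  proof (rule ccontr)
    assume "\<not> \<eta> \<le> l"
    then have l\<eta>: "l < \<eta>" by simp
    define w where "w = omega 2 u x r"
    obtain y where y: "y \<in> \<Omega>" "neg_min_at 2 u x r y"
      using narrow_region_negative_min[OF hyps] neg by blast
    have l: "0 < l" "r - l < norm (y - x)" "norm (y - x) < r"
      using hyps y(1) by (auto simp: narrow_region_hyps_def narrow_region_def)
    have r0: "0 < r" using r ab by simp
    define M where "M = - w y"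
    have M: "0 < M" "\<And>z. z \<in> ball x r - {x} \<Longrightarrow> - M \<le> w z"
      using y(2) by (auto simp: neg_min_at_def w_def M_def)
    have half: "r / 2 \<le> norm (y - x)"
      using l l\<eta> r by (simp add: \<eta>_def)
    \<comment> \<open>The left side is the Laplacian of \<open>w\<close> at \<open>z\<close>:
      \<open>f\<close> is minus the Laplacian of \<open>u\<close>, and the Kelvin transform rescales
      it with exponent n + 2.\<close>
    have key: "f z - (r / norm (z - x)) powr (real ?n + 2) * f (inversion x r z) \<le> K * M"
      if z: "r / 2 \<le> norm (z - x)" "norm (z - x) < r" and wz: "w z < 0" for z
    proof -
      define \<tau> where "\<tau> = r / norm (z - x)"
      define k where "k = kelvin 2 u x r z"
      define ui where "ui = u (inversion x r z)"
      define Qz where "Qz = potential 2 u z"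
      define Qi where "Qi = potential 2 u (inversion x r z)"
      have zx: "z \<noteq> x" using z r0 by auto
      have \<tau>: "1 \<le> \<tau>" using z zx by (simp add: \<tau>_def)
      have kb: "m \<le> k" "k \<le> u z" "u z \<le> U"
        using kelvin_bounds[of x b m u U r z 2] mU m z r n3 wz by (auto simp: w_def k_def)
      have Q0: "0 \<le> Qz" "0 \<le> Qi" by (simp_all add: Qz_def Qi_def potential_nonneg)
      have zb: "z \<in> ball x r - {x}" using z zx by (simp add: dist_norm norm_minus_commute)
      have uk: "u z - k \<le> M" using M(2)[OF zb] by (simp add: w_def omega_def k_def)
      have Tb: "u z powr q - k powr q \<le> q * T q * M" if "0 < q" for q
      proof -
        have "u z powr q - k powr q \<le> q * T q * (u z - k)"
          using kb m that unfolding T_def by (intro powr_diff_le powr_le_sum_endpoints) auto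
        also have "\<dots> \<le> q * T q * M" using uk that T by (intro mult_left_mono) auto
        finally show ?thesis .
      qed
      have t2: "c2 * (u z powr q2 - \<tau> powr (real ?n + 2) * ui powr q2) \<le> c2 * (q2 * T q2 * M)"
      proof (rule mult_left_mono[OF _ c(2)])
        have "\<tau> powr 0 * k powr q2 \<le> \<tau> powr (real ?n + 2) * ui powr q2"
          unfolding \<tau>_def k_def ui_def using \<tau> b\<beta>(2)
          by (intro powr_kelvin_le pos) (auto simp: \<tau>_def \<beta>_def)
        then have "k powr q2 \<le> \<tau> powr (real ?n + 2) * ui powr q2" using \<tau> by simp
        then show "u z powr q2 - \<tau> powr (real ?n + 2) * ui powr q2 \<le> q2 * T q2 * M"
          using Tb[OF q(2)] by linarith
      qed
      have t1: "c1 * (Qz * u z powr q1 - \<tau> powr (real ?n + 2) * (Qi * ui powr q1))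
          \<le> c1 * (QB * (q1 * T q1 * M) + p * J * M * U powr q1)"
      proof (cases "0 < c1")
        case True
        have int: "\<And>y. integrable lborel (\<lambda>z. u z powr ((real CARD('n) + 2) / (real CARD('n) - 2)) * norm (z - y) powr (- (real CARD('n) - 2)))"
          by (rule solution_potential_integrable[OF sol True])
        have QzB: "Qz \<le> QB" using QB(2)[of z] z r True by (simp add: Qz_def)
        have "z' \<in> ball x r \<Longrightarrow> u z' \<le> U" for z'
          using r r0 by (intro mU) auto
        then have QL: "- (p * J * M) \<le> \<tau> powr \<beta> * Qi - Qz"
          using potential_inversion_ge[OF ub pos _ n3 int zx z(2) r(2), of U M] M
          unfolding \<tau>_def Qi_def Qz_def J_def p_def e_def \<beta>_def w_def by auto
        \<comment> \<open>Three exchanges: the power of \<open>u\<close> at the inverse point for a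
          power of \<open>k\<close>, the reflected potential for \<open>Qz\<close>, and
          \<open>k\<close> for \<open>u z\<close>. The first has the favourable sign, the others
          cost multiples of \<open>M\<close>.\<close>
        have "(\<tau> powr \<beta> * Qi) * k powr q1 = Qi * (\<tau> powr \<beta> * k powr q1)" by simp
        also have "\<dots> \<le> Qi * (\<tau> powr (real ?n + 2) * ui powr q1)"
          unfolding \<tau>_def k_def ui_def using \<tau> b\<beta>(1) Q0
          by (intro mult_left_mono powr_kelvin_le pos) (auto simp: \<tau>_def \<beta>_def)
        finally have 1: "(\<tau> powr \<beta> * Qi) * k powr q1 \<le> \<tau> powr (real ?n + 2) * (Qi * ui powr q1)"
          by (simp add: mult_ac)
        have 2: "(Qz - p * J * M) * k powr q1 \<le> (\<tau> powr \<beta> * Qi) * k powr q1"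
          using QL by (intro mult_right_mono) auto
        have 3: "Qz * (u z powr q1 - k powr q1) \<le> QB * (q1 * T q1 * M)"
        proof -
          have "Qz * (u z powr q1 - k powr q1) \<le> Qz * (q1 * T q1 * M)"
            using Tb[OF q(1)] Q0 by (intro mult_left_mono)
          also have "\<dots> \<le> QB * (q1 * T q1 * M)"
            using QzB q T M by (intro mult_right_mono) auto
          finally show ?thesis .
        qed
        have 4: "p * J * M * k powr q1 \<le> p * J * M * U powr q1"
          using kb m q p J M by (intro mult_left_mono powr_mono2) auto
        have "Qz * u z powr q1 - \<tau> powr (real ?n + 2) * (Qi * ui powr q1)
            \<le> QB * (q1 * T q1 * M) + p * J * M * U powr q1"
          using 1 2 3 4 unfolding right_diff_distrib left_diff_distrib by linarith
        then show ?thesis using c(1) by (intro mult_left_mono)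
      next
        case False
        then show ?thesis using c(1) by simp
      qed
      have "f z - \<tau> powr (real ?n + 2) * f (inversion x r z)
          = c1 * (Qz * u z powr q1 - \<tau> powr (real ?n + 2) * (Qi * ui powr q1))
            + c2 * (u z powr q2 - \<tau> powr (real ?n + 2) * ui powr q2)"
        by (simp add: f_def Qz_def Qi_def ui_def algebra_simps)
      also have "\<dots> \<le> c1 * (QB * (q1 * T q1 * M) + p * J * M * U powr q1) + c2 * (q2 * T q2 * M)"
        using t1 t2 by (rule add_mono)
      also have "\<dots> = K * M" by (simp add: K_def algebra_simps)
      finally show ?thesis by (simp only: \<tau>_def)
    qed
    \<comment> \<open>\<open>\<kappa>\<close> is so large that the barrier beats \<open>K * M\<close> in the Laplacian and \<open>M\<close> on the inner sphere,
      whereas near the outer sphere the barrier is smaller than \<open>M\<close>.\<close>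
    define \<Psi> where "\<Psi> z = (kelvin 2 u x r z + (- 1) * u z) + (M * \<kappa>) * (r\<^sup>2 - (norm (z - x))\<^sup>2)" for z
    have \<Psi>w: "\<Psi> z = w z + M * \<kappa> * (r\<^sup>2 - (norm (z - x))\<^sup>2)" for z
      by (simp add: \<Psi>_def w_def omega_def)
    define S where "S = cball x r - ball x (r / 2)"
    have S: "compact S" unfolding S_def by (intro compact_diff) auto
    have yS: "y \<in> S" using half l by (simp add: S_def dist_norm norm_minus_commute)
    have "continuous_on S w"
    proof (intro continuous_at_imp_continuous_on ballI)
      fix z assume "z \<in> S"
      then have "z \<noteq> x" using r0 by (auto simp: S_def)
      then show "isCont w z"
        unfolding w_def by (rule isCont_omega[OF solution_continuous[OF sol] _ r0])
    qed
    then have "continuous_on S \<Psi>"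
      unfolding \<Psi>w[abs_def] by (intro continuous_intros)
    then obtain y1 where y1: "y1 \<in> S" "\<And>z. z \<in> S \<Longrightarrow> \<Psi> y1 \<le> \<Psi> z"
      using continuous_attains_inf[OF S] yS by blast
    have y1r: "r / 2 \<le> norm (y1 - x)" "norm (y1 - x) \<le> r"
      using y1(1) by (auto simp: S_def dist_norm norm_minus_commute)
    have "0 \<le> \<Psi> y1"
    proof (rule ccontr)
      assume "\<not> 0 \<le> \<Psi> y1"
      then have neg1: "\<Psi> y1 < 0" by simp
      have y1x: "y1 \<noteq> x" using y1r r0 by auto
      have "norm (y1 - x) \<noteq> r"
      proof
        assume "norm (y1 - x) = r"
        then show False
          using neg1 r0 inversion_sphere[of y1 x r] by (simp add: \<Psi>_def kelvin_def)
      qed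
      then have in2: "norm (y1 - x) < r" using y1r by simp
      then have "- M \<le> w y1" using y1x by (intro M(2)) (simp add: dist_norm norm_minus_commute)
      have "norm (y1 - x) \<noteq> r / 2"
      proof
        assume eq: "norm (y1 - x) = r / 2"
        have "1 = 4 / (3 * a\<^sup>2) * (3 / 4 * a\<^sup>2)" using ab by simp
        also have "\<dots> \<le> \<kappa> * (3 / 4 * r\<^sup>2)"
          using \<kappa> r ab by (intro mult_mono) (auto intro: power_mono)
        finally have "M * 1 \<le> M * (\<kappa> * (3 / 4 * r\<^sup>2))" using M by (intro mult_left_mono) auto
        moreover have "r\<^sup>2 - (norm (y1 - x))\<^sup>2 = 3 / 4 * r\<^sup>2"
          unfolding eq by (simp add: power_divide)
        ultimately have "M \<le> M * \<kappa> * (r\<^sup>2 - (norm (y1 - x))\<^sup>2)" by (simp only: mult.assoc mult_1_right)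
        then show False using neg1 \<open>- M \<le> w y1\<close> by (simp add: \<Psi>w)
      qed
      then have in1: "r / 2 < norm (y1 - x)" using y1r by simp
      have "(norm (y1 - x))\<^sup>2 \<le> r\<^sup>2" using in2 by (intro power_mono) auto
      then have "0 \<le> M * \<kappa> * (r\<^sup>2 - (norm (y1 - x))\<^sup>2)" using M \<kappa> by simp
      then have w1: "w y1 < 0" using neg1 by (simp add: \<Psi>w)
      have "open {z. r / 2 < norm (z - x) \<and> norm (z - x) < r}"
        by (intro open_Collect_conj open_Collect_less continuous_intros)
      then have "\<forall>\<^sub>F z in nhds y1. z \<in> {z. r / 2 < norm (z - x) \<and> norm (z - x) < r}"
        using in1 in2 by (intro eventually_nhds_in_open) auto
      then have min: "\<forall>\<^sub>F z in nhds y1. \<Psi> y1 \<le> \<Psi> z"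
        by eventually_elim (rule y1(2), auto simp: S_def dist_norm norm_minus_commute)
      obtain D where D: "\<And>i. line_deriv2 (kelvin 2 u x r) y1 i (D i)"
        "(\<Sum>i\<in>UNIV. D i) = (r / norm (y1 - x)) powr (real ?n + 2) * (\<Sum>i\<in>UNIV. H (inversion x r y1) $ i $ i)"
        using kelvin_line_deriv2[OF G H y1x r0] by blast
      have "0 \<le> (D i + (- 1) * H y1 $ i $ i) + (M * \<kappa>) * (- 2)" for i
      proof (rule line_deriv2_local_min[OF _ min])
        show "line_deriv2 \<Psi> y1 i ((D i + (- 1) * H y1 $ i $ i) + (M * \<kappa>) * (- 2))"
          unfolding \<Psi>_def[abs_def]
          by (intro line_deriv2_add line_deriv2_cmult line_deriv2_C2[OF G H] D(1) quadratic_line_deriv2)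
      qed
      then have "0 \<le> (\<Sum>i\<in>UNIV. (D i + (- 1) * H y1 $ i $ i) + (M * \<kappa>) * (- 2))" by (intro sum_nonneg) auto
      also have "\<dots> = f y1 - (r / norm (y1 - x)) powr (real ?n + 2) * f (inversion x r y1) - 2 * real ?n * (M * \<kappa>)"
        by (simp only: sum.distrib sum_distrib_left[symmetric] D(2) trH sum_constant) simp
      also have "\<dots> \<le> K * M - 2 * real ?n * (M * \<kappa>)"
        using key[OF y1r(1) in2 w1] by simp
      \<comment> \<open>Of the factor \<open>2 * real ?n\<close> only that it is at least 1 is kept;
        \<open>K < \<kappa>\<close> does the rest.\<close>
      also have "\<dots> \<le> K * M - 1 * (M * \<kappa>)"
        using n3 M \<kappa> by (intro diff_left_mono mult_right_mono) auto
      also have "\<dots> < 0" using M \<kappa> by (simp add: mult.commute)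
      finally show False by simp
    qed
    then have "0 \<le> \<Psi> y" using y1(2)[OF yS] by simp
    then have "M * 1 \<le> M * (\<kappa> * (r\<^sup>2 - (norm (y - x))\<^sup>2))"
      by (simp add: \<Psi>w M_def mult.assoc)
    then have "1 \<le> \<kappa> * (r\<^sup>2 - (norm (y - x))\<^sup>2)"
      using M(1) by (simp only: mult_le_cancel_left_pos)
    also have "r\<^sup>2 - (norm (y - x))\<^sup>2 = (r - norm (y - x)) * (r + norm (y - x))"
      by (simp add: power2_eq_square algebra_simps)
    also have "\<kappa> * \<dots> \<le> \<kappa> * (l * (2 * b))"
      using \<kappa> l r r0 by (intro mult_left_mono mult_mono) auto
    finally have "1 \<le> 2 * b * \<kappa> * l" by (simp add: mult_ac)
    moreover have "l < 1 / (2 * b * \<kappa>)" using l\<eta> by (simp add: \<eta>_def)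
    ultimately show False using b \<kappa> by (simp add: field_simps)
  qed
  then show ?thesis using \<eta> by blast
qed

subsection \<open>The narrow region principle\<close>

lemma solution_lower_bound:
  fixes u :: "real^'n \<Rightarrow> real" and x :: "real^'n"
  assumes n2: "2 \<le> CARD('n)" and \<alpha>: "0 < \<alpha>" "\<alpha> \<le> 2" "\<alpha> < real CARD('n)"
    and c: "0 \<le> c1" "0 \<le> c2" "0 < c1 + c2"
    and sol: "positive_classical_solution \<alpha> c1 c2 q1 q2 u"
  shows "\<exists>c>0. \<forall>y. 2 \<le> norm (y - x) \<longrightarrow> c * norm (y - x) powr (\<alpha> - real CARD('n)) \<le> u y"
proof (cases "\<alpha> = 2")
  case True
  obtain G H where GH: "\<And>y. (u has_derivative (\<lambda>h. G y \<bullet> h)) (at y)" "\<And>y. (G has_derivative (\<lambda>h. H y *v h)) (at y)"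
    using sol True by (auto simp: positive_classical_solution_def C2_on_def)
  have "laplacian u y < 0" for y
    using solution_frac_laplacian_pos[OF sol c, of y] True by (simp add: frac_laplacian_def)
  then show ?thesis
    using lower_bound_classical[OF _ solution_pos[OF sol] GH] \<alpha> True by simp
next
  case False
  then have \<alpha>2: "\<alpha> < 2" using \<alpha> by simp
  have uL: "u \<in> L_space \<alpha>" "C11_loc_on UNIV u"
    using sol False by (auto simp: positive_classical_solution_def)
  note ub = solution_borel[OF sol]
  have "\<exists>L>0. (truncated (real CARD('n) + \<alpha>) u y \<longlongrightarrow> L) (at_right 0)" for y
  proof -
    obtain L where L: "(truncated (real CARD('n) + \<alpha>) u y \<longlongrightarrow> L) (at_right 0)"
      "frac_laplacian \<alpha> u y = frac_const TYPE('n) \<alpha> * L"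
      using frac_laplacian_limit[OF \<alpha>(1) \<alpha>2 n2 ub uL(1) open_UNIV UNIV_I uL(2)] by blast
    then have "0 < L"
      using solution_frac_laplacian_pos[OF sol c, of y] frac_const_nonneg[where 'n='n, of \<alpha>]
      by (simp add: zero_less_mult_iff)
    then show ?thesis using L by blast
  qed
  then show ?thesis
    using lower_bound_fractional[OF \<alpha>(1) \<alpha>2 n2 solution_pos[OF sol] solution_continuous[OF sol] L_space_integrable[OF ub uL(1)]]
    by blast
qed

theorem theorem3p1:
  fixes u :: "real^'n \<Rightarrow> real" and x :: "real^'n" and \<alpha> c1 c2 q1 q2 :: real
  assumes "2 \<le> CARD('n)"
    and "0 < \<alpha>" and "\<alpha> \<le> 2" and "\<alpha> < real CARD('n)"
    and "0 \<le> c1" and "0 \<le> c2" and "0 < c1 + c2"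
    and "0 < q1" and "q1 \<le> 2 * \<alpha> / (real CARD('n) - \<alpha>)"
    and "0 < q2" and "q2 \<le> (real CARD('n) + \<alpha>) / (real CARD('n) - \<alpha>)"
    and "positive_classical_solution \<alpha> c1 c2 q1 q2 u"
  shows "(\<exists>\<delta>0>0. \<forall>r l \<Omega>. 0 < r \<and> r \<le> \<delta>0 \<and> narrow_region_hyps \<alpha> c1 c2 q1 q2 u x r l \<Omega>
            \<longrightarrow> (\<forall>y\<in>\<Omega>. 0 \<le> omega \<alpha> u x r y))
       \<and> (\<exists>l0 :: real \<Rightarrow> real. continuous_on {0<..} l0 \<and> (\<forall>r>0. 0 < l0 r) \<and>
            (\<forall>r l \<Omega>. 0 < r \<and> l \<le> l0 r \<and> narrow_region_hyps \<alpha> c1 c2 q1 q2 u x r l \<Omega>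
               \<longrightarrow> (\<forall>y\<in>\<Omega>. 0 \<le> omega \<alpha> u x r y)))"
proof
  note sol = assms(12)
  obtain G where G: "\<And>y. (u has_derivative (\<lambda>h. G y \<bullet> h)) (at y)" "continuous_on UNIV G"
    using solution_gradient[OF sol] by blast
  obtain c where c: "0 < c" "\<And>y. 2 \<le> norm (y - x) \<Longrightarrow> c * norm (y - x) powr (\<alpha> - real CARD('n)) \<le> u y"
    using solution_lower_bound[OF assms(1-7) sol] by blast
  obtain \<delta> where \<delta>: "0 < \<delta>" "\<And>r y. 0 < r \<Longrightarrow> r \<le> \<delta> \<Longrightarrow> y \<in> ball x r - {x} \<Longrightarrow> 0 \<le> omega \<alpha> u x r y"
    using omega_nonneg_small_radius[OF assms(4) solution_pos[OF sol] G c] by blast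
  have sub: "y \<in> ball x r - {x}" if "narrow_region_hyps \<alpha> c1 c2 q1 q2 u x r l \<Omega>" "y \<in> \<Omega>" for r l \<Omega> y
  proof -
    have "r - l < norm (y - x)" "norm (y - x) < r" "l < r"
      using that by (auto simp: narrow_region_hyps_def narrow_region_def)
    then show ?thesis by (auto simp: dist_norm norm_minus_commute)
  qed
  show "\<exists>\<delta>0>0. \<forall>r l \<Omega>. 0 < r \<and> r \<le> \<delta>0 \<and> narrow_region_hyps \<alpha> c1 c2 q1 q2 u x r l \<Omega>
            \<longrightarrow> (\<forall>y\<in>\<Omega>. 0 \<le> omega \<alpha> u x r y)"
    using \<delta> sub by (intro exI[of _ \<delta>]) blast
  \<comment> \<open>\<Omega> is quantified inside \<open>Bad\<close>, so the threshold obtained from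
    this set is a function of the radius alone.\<close>
  define Bad where "Bad = {(r, l). \<exists>\<Omega>. narrow_region_hyps \<alpha> c1 c2 q1 q2 u x r l \<Omega> \<and> (\<exists>y\<in>\<Omega>. omega \<alpha> u x r y < 0)}"
  have "\<exists>\<eta>>0. \<forall>r l. a \<le> r \<and> r \<le> b \<and> (r, l) \<in> Bad \<longrightarrow> \<eta> \<le> l" if ab: "0 < a" "a \<le> b" for a b
  proof -
    have "\<exists>\<eta>>0. \<forall>r l \<Omega>. a \<le> r \<and> r \<le> b \<and> narrow_region_hyps \<alpha> c1 c2 q1 q2 u x r l \<Omega> \<and>
        (\<exists>y\<in>\<Omega>. omega \<alpha> u x r y < 0) \<longrightarrow> \<eta> \<le> l"
    proof (cases "\<alpha> = 2")
      case True
      show ?thesis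
        unfolding True using threshold_classical[of c1 c2 q1 q2 u a b x] assms ab by (simp add: True)
    next
      case False
      then have "\<alpha> < 2" using assms(3) by simp
      then show ?thesis
        using threshold_fractional[OF assms(1,2) _ assms(5-8,10) sol ab, of x] by blast
    qed
    then show ?thesis unfolding Bad_def by fast
  qed
  then obtain l0 where l0: "continuous_on {0<..} l0" "\<And>r. 0 < r \<Longrightarrow> 0 < l0 r"
    "\<And>r l. 0 < r \<Longrightarrow> 0 < l \<Longrightarrow> l \<le> l0 r \<Longrightarrow> (r, l) \<notin> Bad"
    using continuous_threshold[of Bad] by blast
  have "0 \<le> omega \<alpha> u x r y"
    if "0 < r" "l \<le> l0 r" "narrow_region_hyps \<alpha> c1 c2 q1 q2 u x r l \<Omega>" "y \<in> \<Omega>" for r l \<Omega> y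
  proof (rule ccontr)
    assume "\<not> 0 \<le> omega \<alpha> u x r y"
    then have "(r, l) \<in> Bad" using that by (auto simp: Bad_def not_le)
    moreover have "0 < l" using that(3) by (simp add: narrow_region_hyps_def narrow_region_def)
    ultimately show False using l0(3) that by blast
  qed
  then show "\<exists>l0 :: real \<Rightarrow> real. continuous_on {0<..} l0 \<and> (\<forall>r>0. 0 < l0 r) \<and>
            (\<forall>r l \<Omega>. 0 < r \<and> l \<le> l0 r \<and> narrow_region_hyps \<alpha> c1 c2 q1 q2 u x r l \<Omega>
               \<longrightarrow> (\<forall>y\<in>\<Omega>. 0 \<le> omega \<alpha> u x r y))"
    using l0(1,2) by blast
qed

end
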